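(* Let $f\in W^{3,1}([0,T],X)$, $u_0=0$, and $f(0)=f'(0)=f''(0)=0$. Let $F\colon \mathsf{D}(F)\subset\mathcal{L}^*(X)\to\mathcal{C}([0,T],X)$, $B\mapsto u$, be the parameter-to-solution map of the evolution equation $$Bu'(t)+Au(t)+BQu(t)=f(t),\quad t\in\,]0,T[,\qquad u(0)=u_0 ,$$ and let $F''$ be its second Fréchet derivative on $\operatorname{int}(\mathsf{D}(F))$. Then there is a constant $c>0$, depending only on $\beta_-$, $\beta_+$, $T$, $Q$, and $f$, such that for all $B,\widetilde{B}\in\operatorname{int}(\mathsf{D}(F))$ $$\|F''(B)-F''(\widetilde{B})\|_{\mathcal{L}^2(\mathcal{L}^*(X),\,\mathcal{C}([0,T],X))}\le c\,\|B-\widetilde{B}\|_{\mathcal{L}(X)} .$$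
   Context: $X$ is a Hilbert space, $T>0$, $\mathcal{L}(X)$ is the space of bounded linear operators on $X$ and $\mathcal{L}^*(X)=\{J\in\mathcal{L}(X): J^*=J\}$ is the Banach space of bounded self-adjoint operators (with the operator norm). $A\colon\mathsf{D}(A)\subset X\to X$ is a (linear) maximal monotone operator: $\langle Ax,x\rangle_X\ge 0$ for all $x\in\mathsf{D}(A)$ and $I+A\colon\mathsf{D}(A)\to X$ is onto; $\mathsf{D}(A)$ carries the graph norm. $Q\in\mathcal{L}(X)$. For fixed $0<\beta_-<\beta_+<\infty$, $$\mathsf{D}(F)=\{B\in\mathcal{L}^*(X): \beta_-\|x\|_X^2\le\langle Bx,x\rangle_X\le\beta_+\|x\|_X^2\ \text{for all } x\in X\}.$$ For $B\in\mathsf{D}(F)$, $h\in L^1([0,T],X)$, $z_0\in X$, the mild solution of $Bz'(t)+Az(t)+BQz(t)=h(t)$, $z(0)=z_0$, is $z(t)=S(t)z_0+\int_0^tS(t-s)B^{-1}h(s)\,ds$, where $\{S(t)\}_{t\ge0}$ is the $C_0$-semigroup on $X$ generated by $-(B^{-1}A+Q)$ (with domain $\mathsf{D}(A)$). A classical solution is one in $\mathcal{C}^1([0,T],X)\cap\mathcal{C}([0,T],\mathsf{D}(A))$. With $f$ and $u_0$ fixed, $F(B)$ is the mild solution $u$ of $Bu'+Au+BQu=f$, $u(0)=u_0$. Under the hypotheses of the claim $F$ is twice Fréchet differentiable at each $B\in\operatorname{int}(\mathsf{D}(F))$ (interior in $\mathcal{L}^*(X)$), and $F''(B)[H_1,H_2]=\overline{\overline{u}}$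 for $H_1,H_2\in\mathcal{L}^*(X)$, where $\overline{\overline{u}}$ is the mild (in fact classical) solution of $$B\overline{\overline{u}}\,'+(A+BQ)\overline{\overline{u}}=-H_1(u_2'+Qu_2)-H_2(u_1'+Qu_1),\qquad\overline{\overline{u}}(0)=0,$$ with $u_i$, $i=1,2$, the classical solution of $Bu_i'+(A+BQ)u_i=-H_i(u'+Qu)$, $u_i(0)=0$, and $u=F(B)$. $\mathcal{L}^2(V,W)$ denotes the space of bounded bilinear mappings $V\times V\to W$ with its usual norm. *)

theory Defs
  imports "HOL-Analysis.Analysis"
begin

text \<open>The Banach space of bounded self-adjoint operators on \<open>'a\<close> with the operator norm.  The
  adjoint of a bounded operator is determined by the identity below, so it expresses \<open>J* = J\<close>.
  A type of its own makes Frechet derivatives, interiors and operator norms refer to this space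
  rather than to the surrounding space of all bounded operators.\<close>

typedef (overloaded) 'a::real_inner selfadj =
    "{J :: 'a \<Rightarrow>\<^sub>L 'a. \<forall>x y. inner (J x) y = inner x (J y)}"
  morphisms op_of Selfadj
  by (rule exI[of _ 0]) simp

instantiation selfadj :: (real_inner) real_normed_vector
begin

definition zero_selfadj :: "'a selfadj"
  where "zero_selfadj = Selfadj 0"
definition plus_selfadj :: "'a selfadj \<Rightarrow> 'a selfadj \<Rightarrow> 'a selfadj"
  where "plus_selfadj J K = Selfadj (op_of J + op_of K)"
definition uminus_selfadj :: "'a selfadj \<Rightarrow> 'a selfadj"
  where "uminus_selfadj J = Selfadj (- op_of J)"
definition minus_selfadj :: "'a selfadj \<Rightarrow> 'a selfadj \<Rightarrow> 'a selfadj"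
  where "minus_selfadj J K = Selfadj (op_of J - op_of K)"
definition scaleR_selfadj :: "real \<Rightarrow> 'a selfadj \<Rightarrow> 'a selfadj"
  where "scaleR_selfadj r J = Selfadj (r *\<^sub>R op_of J)"
definition norm_selfadj :: "'a selfadj \<Rightarrow> real"
  where "norm_selfadj J = norm (op_of J)"
definition dist_selfadj :: "'a selfadj \<Rightarrow> 'a selfadj \<Rightarrow> real"
  where "dist_selfadj J K = norm (J - K)"
definition sgn_selfadj :: "'a selfadj \<Rightarrow> 'a selfadj"
  where "sgn_selfadj J = scaleR (inverse (norm J)) J"
definition [code del]:
  "(uniformity :: ('a selfadj \<times> 'a selfadj) filter) =
     (INF e\<in>{0<..}. principal {(x, y). dist x y < e})"
definition open_selfadj :: "'a selfadj set \<Rightarrow> bool"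
  where [code del]: "open_selfadj U = (\<forall>x\<in>U. \<forall>\<^sub>F (x', y) in uniformity. x' = x \<longrightarrow> y \<in> U)"

lemma op_of_zero: "op_of (0 :: 'a selfadj) = 0"
  by (simp add: zero_selfadj_def Selfadj_inverse)

lemma op_of_plus: "op_of (J + K) = op_of J + op_of K" for J K :: "'a selfadj"
  using op_of[of J] op_of[of K]
  by (simp add: plus_selfadj_def Selfadj_inverse blinfun.add_left inner_add_left inner_add_right)

lemma op_of_uminus: "op_of (- J) = - op_of J" for J :: "'a selfadj"
  using op_of[of J] by (simp add: uminus_selfadj_def Selfadj_inverse blinfun.minus_left)

lemma op_of_minus: "op_of (J - K) = op_of J - op_of K" for J K :: "'a selfadj"
  using op_of[of J] op_of[of K]
  by (simp add: minus_selfadj_def Selfadj_inverse blinfun.diff_left inner_diff_left inner_diff_right)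

lemma op_of_scaleR: "op_of (r *\<^sub>R J) = r *\<^sub>R op_of J" for J :: "'a selfadj"
  using op_of[of J] by (simp add: scaleR_selfadj_def Selfadj_inverse blinfun.scaleR_left)

instance
  by standard
    (simp_all add: op_of_inject[symmetric] op_of_zero op_of_plus op_of_uminus op_of_minus
      op_of_scaleR norm_selfadj_def dist_selfadj_def sgn_selfadj_def uniformity_selfadj_def
      open_selfadj_def algebra_simps norm_triangle_ineq)

end

text \<open>An unbounded operator is given by its domain \<open>D\<close> and a function \<open>A\<close> of which only the values
  on \<open>D\<close> matter.\<close>

definition maximal_monotone :: "'a::real_inner set \<Rightarrow> ('a \<Rightarrow> 'a) \<Rightarrow> bool" where
  "maximal_monotone D A \<longleftrightarrow>
     subspace D \<and>
     (\<forall>x\<in>D. \<forall>y\<in>D. A (x + y) = A x + A y) \<and>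
     (\<forall>r. \<forall>x\<in>D. A (r *\<^sub>R x) = r *\<^sub>R A x) \<and>
     (\<forall>x\<in>D. 0 \<le> inner (A x) x) \<and>
     (\<forall>y. \<exists>x\<in>D. x + A x = y)"

text \<open>Only the values \<open>S t\<close> with \<open>t \<ge> 0\<close> matter.\<close>

definition C0_semigroup :: "(real \<Rightarrow> 'a::real_normed_vector \<Rightarrow>\<^sub>L 'a) \<Rightarrow> bool" where
  "C0_semigroup S \<longleftrightarrow>
     S 0 = id_blinfun \<and>
     (\<forall>s\<ge>0. \<forall>t\<ge>0. S (s + t) = S s o\<^sub>L S t) \<and>
     (\<forall>x. ((\<lambda>t. S t x) \<longlongrightarrow> x) (at_right 0))"

definition generated_by ::
    "(real \<Rightarrow> 'a::real_normed_vector \<Rightarrow>\<^sub>L 'a) \<Rightarrow> 'a set \<Rightarrow> ('a \<Rightarrow> 'a) \<Rightarrow> bool" where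
  "generated_by S D G \<longleftrightarrow>
     C0_semigroup S \<and>
     D = {x. \<exists>y. ((\<lambda>t. (S t x - x) /\<^sub>R t) \<longlongrightarrow> y) (at_right 0)} \<and>
     (\<forall>x\<in>D. ((\<lambda>t. (S t x - x) /\<^sub>R t) \<longlongrightarrow> G x) (at_right 0))"

text \<open>The semigroup is unique on \<open>[0,\<infinity>[\<close>, so the choice made by \<open>SOME\<close> is immaterial.  The
  Henstock-Kurzweil integral agrees with the Bochner integral on Bochner integrable functions;
  the Bochner integral of the library is confined to separable spaces.\<close>

definition mild_solution ::
    "'a::{real_inner,banach} set \<Rightarrow> ('a \<Rightarrow> 'a) \<Rightarrow> ('a \<Rightarrow>\<^sub>L 'a) \<Rightarrow> ('a \<Rightarrow>\<^sub>L 'a) \<Rightarrow>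
      (real \<Rightarrow> 'a) \<Rightarrow> 'a \<Rightarrow> real \<Rightarrow> 'a" where
  "mild_solution D A Q B h z0 =
     (let S = (SOME S. generated_by S D (\<lambda>x. - (inv (blinfun_apply B) (A x) + Q x)))
      in (\<lambda>t. S t z0 + integral {0..t} (\<lambda>s. S (t - s) (inv (blinfun_apply B) (h s)))))"

definition param_dom :: "real \<Rightarrow> real \<Rightarrow> 'a::real_inner selfadj set" where
  "param_dom \<beta>m \<beta>p =
     {B. \<forall>x. \<beta>m * (norm x)\<^sup>2 \<le> inner (op_of B x) x \<and> inner (op_of B x) x \<le> \<beta>p * (norm x)\<^sup>2}"

text \<open>\<open>C([0,T],X)\<close> is embedded isometrically into the bounded continuous functions on the real
  line by extending functions constantly to the left and to the right of \<open>[0,T]\<close>.\<close>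

definition sol_map ::
    "'a::{real_inner,banach} set \<Rightarrow> ('a \<Rightarrow> 'a) \<Rightarrow> ('a \<Rightarrow>\<^sub>L 'a) \<Rightarrow> real \<Rightarrow> (real \<Rightarrow> 'a) \<Rightarrow> 'a \<Rightarrow>
      'a selfadj \<Rightarrow> (real \<Rightarrow>\<^sub>C 'a)" where
  "sol_map D A Q T f u0 B = Bcontfun (ext_cont (mild_solution D A Q (op_of B) f u0) 0 T)"

definition frechet1 ::
    "('v::real_normed_vector \<Rightarrow> 'w::real_normed_vector) \<Rightarrow> 'v \<Rightarrow> 'v \<Rightarrow>\<^sub>L 'w" where
  "frechet1 F x = Blinfun (frechet_derivative F (at x))"

text \<open>Bounded bilinear maps on \<open>V \<times> V\<close> are identified with elements of \<open>L(V, L(V,W))\<close>, which is an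
  isometry for the usual norms.\<close>

definition frechet2 ::
    "('v::real_normed_vector \<Rightarrow> 'w::real_normed_vector) \<Rightarrow> 'v \<Rightarrow> 'v \<Rightarrow>\<^sub>L 'v \<Rightarrow>\<^sub>L 'w" where
  "frechet2 F = frechet1 (frechet1 F)"

definition twice_frechet_differentiable ::
    "('v::real_normed_vector \<Rightarrow> 'w::real_normed_vector) \<Rightarrow> 'v \<Rightarrow> bool" where
  "twice_frechet_differentiable F x \<longleftrightarrow>
     (\<forall>\<^sub>F y in nhds x. F differentiable (at y)) \<and> frechet1 F differentiable (at x)"

text \<open>Bochner integrability, without assuming that the values lie in a separable space: \<open>h\<close> is
  almost everywhere the limit of simple functions, and its norm is integrable.\<close>

definition bochner_L1 :: "real \<Rightarrow> (real \<Rightarrow> 'a::real_normed_vector) \<Rightarrow> bool" where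
  "bochner_L1 T h \<longleftrightarrow>
     (\<exists>s. (\<forall>i::nat. simple_function (lebesgue_on {0..T}) (s i)) \<and>
          (AE t in lebesgue_on {0..T}. (\<lambda>i. s i t) \<longlonglongrightarrow> h t)) \<and>
     integrable (lebesgue_on {0..T}) (\<lambda>t. norm (h t))"

text \<open>The Sobolev space \<open>W\<^sup>k\<^sup>,\<^sup>1([0,T],X)\<close>: an element of order \<open>k + 1\<close> is a primitive of one of order
  \<open>k\<close>.  For \<open>k \<ge> 1\<close> this refers to the continuous representative, so that values at \<open>0\<close> make
  sense.\<close>

primrec sobolev_W1 :: "nat \<Rightarrow> real \<Rightarrow> (real \<Rightarrow> 'a::banach) \<Rightarrow> bool" where
  "sobolev_W1 0 T f \<longleftrightarrow> bochner_L1 T f"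
| "sobolev_W1 (Suc k) T f \<longleftrightarrow>
     (\<exists>g. sobolev_W1 k T g \<and> (\<forall>t\<in>{0..T}. (g has_integral (f t - f 0)) {0..t}))"

text \<open>The derivative on the closed interval, one-sided at the end points.\<close>

definition deriv_on :: "real \<Rightarrow> (real \<Rightarrow> 'a::real_normed_vector) \<Rightarrow> real \<Rightarrow> 'a" where
  "deriv_on T f t = vector_derivative f (at t within {0..T})"

end

theory Submission
  imports Defs
begin

text \<open>Let \<open>V\<^sub>B\<close> send an inhomogeneity \<open>h\<close> to the mild solution of \<open>B u' + A u + B Q u = h\<close>, \<open>u(0) = 0\<close>, and let \<open>J\<close> be
integration from \<open>0\<close>.  Both are bounded operators on \<open>C([0,T],X)\<close>, and \<open>w = J v\<close> with \<open>v = V\<^sub>B h\<close> is a classical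
solution for the inhomogeneity \<open>J h\<close>.  Hence \<open>V\<^sub>B J = J V\<^sub>B\<close>, and subtracting the equations of two coefficients gives

  \<open>V\<^sub>B\<^sub>' J - V\<^sub>B J = - V\<^sub>B (B' - B) K V\<^sub>B\<^sub>'\<close>,  where  \<open>K = I + Q J\<close>.

So a difference of solution operators is controlled at the price of one integration \<open>J\<close>, and the unbounded
operator \<open>A\<close> has disappeared.

The hypotheses on \<open>f\<close> say that \<open>f = J J G\<close> with \<open>G = J f'''\<close> and \<open>f''' \<in> L\<^sup>1\<close>, so three integrations are
available.  Each Frechet derivative of \<open>B \<mapsto> V\<^sub>B J J G\<close> spends one of them:
\<open>F'(B)H = - V\<^sub>B H K V\<^sub>B J G\<close>, and \<open>F''(B)[H\<^sub>1,H\<^sub>2]\<close> is the symmetrisation of \<open>V\<^sub>B H\<^sub>1 K V\<^sub>B H\<^sub>2 K V\<^sub>B G\<close>.  The Lipschitz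
estimate for \<open>F''\<close> spends the last one.  It is hidden in \<open>G\<close>, where it meets the function \<open>f'''\<close>, which is only
integrable.  For that reason \<open>G\<close> is a uniform limit of \<open>J g\<^sub>n\<close> with continuous \<open>g\<^sub>n\<close> that are bounded in \<open>L\<^sup>1\<close>: since
\<open>V\<^sub>B\<close> is bounded from \<open>L\<^sup>1\<close> to \<open>C\<close>, every estimate holds for the \<open>g\<^sub>n\<close> uniformly in \<open>n\<close> and passes to the limit.  All
bounds depend on \<open>B\<close> and \<open>A\<close> only through the bound for the semigroup in \<open>semigroup_bound\<close>, which is explicit in
\<open>\<beta>\<^sub>-\<close>, \<open>\<beta>\<^sub>+\<close>, \<open>T\<close> and \<open>Q\<close>; this makes the constant uniform.

The abstract part of the argument is \<open>twice_differentiable_Lipschitz\<close>; its hypotheses are verified in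
\<open>smoothed_resolvent_family\<close>.  The latter rests on the existence of the semigroups, obtained by \<open>Hille_Yosida\<close> from
the implicit Euler scheme, and on the two directions of the correspondence between mild solutions and classical
solutions of the integrated equation, \<open>Duhamel_primitive\<close> and \<open>classical_solution_Duhamel\<close>.\<close>

section \<open>Families of operators with a smoothed resolvent identity\<close>

text \<open>The algebra of the proof, free of differential equations.  Read \<open>V B\<close> as the solution operator of the coefficient
\<open>B\<close>, \<open>J\<close> as integration and \<open>N H\<close> as \<open>p \<mapsto> H (p + Q J p)\<close>.  The vector \<open>G\<close> is
almost of the form \<open>J g\<close>: it is a limit of vectors \<open>J (g n)\<close>, where the \<open>g n\<close> may diverge but the \<open>V B (g n)\<close> stay
bounded.\<close>

locale smoothed_resolvent_family =
  fixes V :: "'v::real_normed_vector \<Rightarrow> 'w::real_normed_vector \<Rightarrow>\<^sub>L 'w"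
    and J :: "'w \<Rightarrow>\<^sub>L 'w"
    and N :: "'v \<Rightarrow>\<^sub>L 'w \<Rightarrow>\<^sub>L 'w"
    and P :: "'v set"
    and G :: 'w and g :: "nat \<Rightarrow> 'w"
    and M k M1 :: real
  assumes nonneg: "0 \<le> M" "0 \<le> k" "0 \<le> M1"
    and V_bound: "B \<in> P \<Longrightarrow> norm (V B) \<le> M"
    and N_bound: "norm N \<le> k"
    and V_commute: "B \<in> P \<Longrightarrow> V B (J x) = J (V B x)"
    and N_commute: "N H (J x) = J (N H x)"
    and resolvent: "B \<in> P \<Longrightarrow> B' \<in> P \<Longrightarrow> V B' (J x) - V B (J x) = - V B (N (B' - B) (V B' x))"
    and g_lim: "(\<lambda>n. J (g n)) \<longlonglongrightarrow> G"
    and Vg_bound: "B \<in> P \<Longrightarrow> norm (V B (g n)) \<le> M1"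
begin

lemma V_le: "B \<in> P \<Longrightarrow> norm x \<le> c \<Longrightarrow> norm (V B x) \<le> M * c"
  by (meson V_bound mult_mono nonneg(1) norm_blinfun norm_ge_zero order_trans)

lemma N_le: "norm x \<le> c \<Longrightarrow> norm (N H x) \<le> k * norm H * c"
proof -
  assume "norm x \<le> c"
  have "norm (N H) \<le> k * norm H"
    by (meson N_bound mult_right_mono norm_blinfun norm_ge_zero order_trans)
  then have "norm (N H) * norm x \<le> k * norm H * c"
    using \<open>norm x \<le> c\<close> by (intro mult_mono) (auto simp: nonneg)
  then show ?thesis
    by (meson norm_blinfun order_trans)
qed

text \<open>On vectors \<open>J (W (g n))\<close> the resolvent identity bounds the difference by \<open>norm (B' - B)\<close> times the norm of
\<open>V B' (W (g n))\<close>, which is bounded uniformly in \<open>n\<close>; then \<open>n\<close> tends to infinity.  The operator \<open>W\<close> is the product that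
has accumulated to the right of the difference in the estimates for \<open>F'\<close> and \<open>F''\<close>.\<close>

lemma V_Lipschitz:
  fixes W :: "'w \<Rightarrow>\<^sub>L 'w"
  assumes B: "B \<in> P" and B': "B' \<in> P"
    and W: "\<And>x. W (J x) = J (W x)"
    and c: "\<And>n. norm (V B' (W (g n))) \<le> c"
  shows "norm (V B' (W G) - V B (W G)) \<le> M * (k * norm (B' - B) * c)"
proof (rule LIMSEQ_le_const2)
  show "(\<lambda>n. norm (V B' (W (J (g n))) - V B (W (J (g n)))))
      \<longlonglongrightarrow> norm (V B' (W G) - V B (W G))"
    by (intro tendsto_norm tendsto_diff blinfun.tendsto tendsto_const g_lim)
  have "norm (V B' (W (J (g n))) - V B (W (J (g n)))) \<le> M * (k * norm (B' - B) * c)" for n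
    unfolding W resolvent[OF B B'] norm_minus_cancel
    by (intro V_le[OF B] N_le c)
  then show "\<exists>N. \<forall>n\<ge>N. norm (V B' (W (J (g n))) - V B (W (J (g n))))
      \<le> M * (k * norm (B' - B) * c)"
    by blast
qed

lemma V_Lipschitz_0:
  assumes B: "B \<in> P" and B': "B' \<in> P"
  shows "norm (V B' G - V B G) \<le> M * (k * norm (B' - B) * M1)"
  using V_Lipschitz[OF B B', of id_blinfun M1] Vg_bound[OF B'] by simp

lemma V_Lipschitz_1:
  assumes B: "B \<in> P" and B': "B' \<in> P"
  shows "norm (V B' (N H (V B' G)) - V B (N H (V B' G)))
    \<le> M * (k * norm (B' - B) * (M * (k * norm H * M1)))"
proof -
  define W where "W = N H o\<^sub>L V B'"
  have "W (J x) = J (W x)" for x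
    by (simp add: W_def V_commute[OF B'] N_commute)
  moreover have "norm (V B' (W (g n))) \<le> M * (k * norm H * M1)" for n
    by (simp add: W_def) (intro V_le[OF B'] N_le Vg_bound[OF B'])
  ultimately show ?thesis
    using V_Lipschitz[OF B B', of W] by (simp add: W_def)
qed

lemma V_Lipschitz_2:
  assumes B: "B \<in> P" and B': "B' \<in> P"
  shows "norm (V B' (N H (V B' (N K (V B' G)))) - V B (N H (V B' (N K (V B' G)))))
    \<le> M * (k * norm (B' - B) * (M * (k * norm H * (M * (k * norm K * M1)))))"
proof -
  define W where "W = N H o\<^sub>L V B' o\<^sub>L N K o\<^sub>L V B'"
  have "W (J x) = J (W x)" for x
    by (simp add: W_def V_commute[OF B'] N_commute)
  moreover have "norm (V B' (W (g n))) \<le> M * (k * norm H * (M * (k * norm K * M1)))" for n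
    by (simp add: W_def) (intro V_le[OF B'] N_le Vg_bound[OF B'])
  ultimately show ?thesis
    using V_Lipschitz[OF B B', of W] by (simp add: W_def)
qed

definition D1 :: "'v \<Rightarrow> 'v \<Rightarrow>\<^sub>L 'w" where
  "D1 B = Blinfun (\<lambda>H. - V B (N H (V B (J G))))"

text \<open>One of the two summands of the symmetric second derivative.\<close>

definition half_D2 :: "'v \<Rightarrow> 'v \<Rightarrow> 'v \<Rightarrow> 'w" where
  "half_D2 B H1 H2 = V B (N H1 (V B (N H2 (V B G))))"

definition D2 :: "'v \<Rightarrow> 'v \<Rightarrow>\<^sub>L 'v \<Rightarrow>\<^sub>L 'w" where
  "D2 B = Blinfun (bounded_bilinear.prod_right (\<lambda>H1 H2. half_D2 B H1 H2 + half_D2 B H2 H1))"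

lemma D1_apply: "D1 B H = - V B (N H (V B (J G)))"
proof -
  have "bounded_linear (\<lambda>H. - V B (N H (V B (J G))))"
    by (intro bounded_linear_minus bounded_linear_compose[OF blinfun.bounded_linear_right, of _ "V B"]
        bounded_linear_compose[OF blinfun.bounded_linear_left, of N] blinfun.bounded_linear_right)
  then show ?thesis
    by (simp add: D1_def bounded_linear_Blinfun_apply)
qed

lemma norm_half_D2_le:
  "norm (half_D2 B H1 H2) \<le> norm H1 * norm H2 * (norm (V B) * norm N * norm (V B) * norm N * norm (V B G))"
proof -
  have V: "norm x \<le> c \<Longrightarrow> norm (V B x) \<le> norm (V B) * c" for x c
    by (meson mult_left_mono norm_blinfun norm_ge_zero order_trans)
  have N: "norm x \<le> c \<Longrightarrow> norm (N H x) \<le> norm N * norm H * c" for H x c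
    by (meson mult_mono norm_blinfun norm_ge_zero order_trans mult_nonneg_nonneg)
  have "norm (half_D2 B H1 H2)
      \<le> norm (V B) * (norm N * norm H1 * (norm (V B) * (norm N * norm H2 * norm (V B G))))"
    unfolding half_D2_def by (intro V N order_refl)
  then show ?thesis
    by (simp add: mult_ac)
qed

lemma D2_apply: "D2 B H1 H2 = half_D2 B H1 H2 + half_D2 B H2 H1"
proof -
  interpret bounded_bilinear "\<lambda>H1 H2. half_D2 B H1 H2 + half_D2 B H2 H1"
  proof
    let ?K = "norm (V B) * norm N * norm (V B) * norm N * norm (V B G)"
    have "norm (half_D2 B H1 H2 + half_D2 B H2 H1) \<le> norm H1 * norm H2 * (2 * ?K)" for H1 H2
      using norm_triangle_mono[OF norm_half_D2_le[of B H1 H2] norm_half_D2_le[of B H2 H1]]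
      by (simp add: algebra_simps)
    then show "\<exists>K. \<forall>H1 H2. norm (half_D2 B H1 H2 + half_D2 B H2 H1) \<le> norm H1 * norm H2 * K"
      by blast
  qed (simp_all add: half_D2_def blinfun.bilinear_simps scaleR_add_right)
  show ?thesis
    by (simp add: D2_def bounded_linear_Blinfun_apply[OF bounded_linear_prod_right])
qed

text \<open>The identity is used twice: one application leaves \<open>V B' (J G)\<close> where the derivative has \<open>V B (J G)\<close>, the second one
turns this discrepancy into another factor \<open>B' - B\<close>.\<close>

lemma first_remainder:
  assumes B: "B \<in> P" and B': "B' \<in> P"
  shows "norm (V B' (J (J G)) - V B (J (J G)) - D1 B (B' - B))
    \<le> M * (k * norm (B' - B) * (M * (k * norm (B' - B) * (M * norm G))))"
proof -
  have "V B' (J (J G)) - V B (J (J G)) - D1 B (B' - B)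
      = - V B (N (B' - B) (V B' (J G) - V B (J G)))"
    by (simp add: resolvent[OF B B', of "J G"] D1_apply blinfun.bilinear_simps)
  also have "\<dots> = V B (N (B' - B) (V B (N (B' - B) (V B' G))))"
    by (simp add: resolvent[OF B B'] blinfun.bilinear_simps)
  finally show ?thesis
    by (simp only:) (intro V_le B N_le B' order_refl)
qed

text \<open>The product rule in exact form.  Since \<open>J\<close> commutes with all factors, the single \<open>J\<close> in \<open>D1\<close> can be moved to the
factor \<open>V B\<close> that is being differenced.\<close>

lemma D1_diff:
  assumes B: "B \<in> P" and B': "B' \<in> P"
  shows "D1 B' H - D1 B H =
     V B (N (B' - B) (V B' (N H (V B' G)))) + V B (N H (V B (N (B' - B) (V B' G))))"
proof -
  have "D1 B' H - D1 B H
      = - (V B' (J (N H (V B' G))) - V B (J (N H (V B' G))))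
        - V B (N H (V B' (J G) - V B (J G)))"
    by (simp add: D1_apply V_commute[OF B'] V_commute[OF B] N_commute blinfun.bilinear_simps)
  then show ?thesis
    by (simp add: resolvent[OF B B'] blinfun.bilinear_simps)
qed

text \<open>Compared with \<open>D2\<close>, the expression of \<open>D1_diff\<close> has \<open>V B'\<close> in place of \<open>V B\<close> in three places, and each replacement is
Lipschitz although no \<open>J\<close> is visible any more; here the approximation of \<open>G\<close> by \<open>J (g n)\<close> enters.\<close>

lemma second_remainder:
  assumes B: "B \<in> P" and B': "B' \<in> P"
  shows "norm (D1 B' - D1 B - D2 B (B' - B)) \<le> 3 * (k * M) ^ 3 * M1 * norm (B' - B) * norm (B' - B)"
proof (rule norm_blinfun_bound)
  show "0 \<le> 3 * (k * M) ^ 3 * M1 * norm (B' - B) * norm (B' - B)"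
    using nonneg by simp
  fix H
  let ?d = "B' - B"
  let ?X = "V B' (N H (V B' G)) - V B (N H (V B' G))" and ?Y = "V B' G - V B G"
  let ?e = "k * norm ?d"
  have "(D1 B' - D1 B - D2 B ?d) H
      = V B (N ?d ?X) + V B (N ?d (V B (N H ?Y))) + V B (N H (V B (N ?d ?Y)))"
    by (simp add: D1_diff[OF B B'] D2_apply half_D2_def blinfun.bilinear_simps)
  also have "norm \<dots> \<le> M * (?e * (M * (?e * (M * (k * norm H * M1)))))
      + M * (?e * (M * (k * norm H * (M * (?e * M1)))))
      + M * (k * norm H * (M * (?e * (M * (?e * M1)))))"
    by (intro norm_triangle_mono V_le B B' N_le V_Lipschitz_0 V_Lipschitz_1)
  also have "\<dots> = 3 * (k * M) ^ 3 * M1 * norm ?d * norm ?d * norm H"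
    by (simp add: power3_eq_cube algebra_simps)
  finally show "norm ((D1 B' - D1 B - D2 B ?d) H) \<le> 3 * (k * M) ^ 3 * M1 * norm ?d * norm ?d * norm H" .
qed

lemma half_D2_diff:
  assumes B: "B \<in> P" and B': "B' \<in> P"
  shows "norm (half_D2 B' H1 H2 - half_D2 B H1 H2)
    \<le> 3 * (k * M) ^ 3 * M1 * norm (B' - B) * norm H1 * norm H2"
proof -
  let ?e = "k * norm (B' - B)"
  let ?Z = "V B' (N H1 (V B' (N H2 (V B' G)))) - V B (N H1 (V B' (N H2 (V B' G))))"
  let ?X = "V B' (N H2 (V B' G)) - V B (N H2 (V B' G))" and ?Y = "V B' G - V B G"
  have "half_D2 B' H1 H2 - half_D2 B H1 H2
      = ?Z + V B (N H1 ?X) + V B (N H1 (V B (N H2 ?Y)))"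
    by (simp add: half_D2_def blinfun.bilinear_simps)
  also have "norm \<dots> \<le> M * (?e * (M * (k * norm H1 * (M * (k * norm H2 * M1)))))
      + M * (k * norm H1 * (M * (?e * (M * (k * norm H2 * M1)))))
      + M * (k * norm H1 * (M * (k * norm H2 * (M * (?e * M1)))))"
    by (intro norm_triangle_mono V_le B B' N_le V_Lipschitz_0 V_Lipschitz_1 V_Lipschitz_2)
  also have "\<dots> = 3 * (k * M) ^ 3 * M1 * norm (B' - B) * norm H1 * norm H2"
    by (simp add: power3_eq_cube algebra_simps)
  finally show ?thesis .
qed

lemma D2_Lipschitz:
  assumes B: "B \<in> P" and B': "B' \<in> P"
  shows "norm (D2 B' - D2 B) \<le> 6 * (k * M) ^ 3 * M1 * norm (B' - B)"
proof (rule norm_blinfun_bound)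
  let ?c = "6 * (k * M) ^ 3 * M1 * norm (B' - B)"
  show "0 \<le> ?c"
    using nonneg by simp
  fix H1
  show "norm ((D2 B' - D2 B) H1) \<le> ?c * norm H1"
  proof (rule norm_blinfun_bound)
    show "0 \<le> ?c * norm H1"
      using nonneg by simp
    fix H2
    have "(D2 B' - D2 B) H1 H2 = (half_D2 B' H1 H2 - half_D2 B H1 H2)
        + (half_D2 B' H2 H1 - half_D2 B H2 H1)"
      by (simp add: D2_apply blinfun.bilinear_simps)
    also have "norm \<dots> \<le> 3 * (k * M) ^ 3 * M1 * norm (B' - B) * norm H1 * norm H2
        + 3 * (k * M) ^ 3 * M1 * norm (B' - B) * norm H2 * norm H1"
      by (intro norm_triangle_mono half_D2_diff B B')
    also have "\<dots> = ?c * norm H1 * norm H2"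
      by simp
    finally show "norm ((D2 B' - D2 B) H1 H2) \<le> ?c * norm H1 * norm H2" .
  qed
qed

end

lemma has_derivative_if_quadratic_remainder:
  fixes F :: "'v::real_normed_vector \<Rightarrow> 'w::real_normed_vector"
  assumes x: "x \<in> S" and S: "open S" and L: "bounded_linear L"
    and le: "\<And>y. y \<in> S \<Longrightarrow> norm (F y - F x - L (y - x)) \<le> c * norm (y - x) * norm (y - x)"
  shows "(F has_derivative L) (at x)"
proof -
  obtain e where e: "e > 0" "ball x e \<subseteq> S"
    using x S open_contains_ball by blast
  show ?thesis
  proof (rule has_derivativeI_sandwich[OF e(1) L])
    show "norm (F y - F x - L (y - x)) / norm (y - x) \<le> c * norm (y - x)"
      if "y \<noteq> x" "dist y x < e" for y
    proof -
      have "y \<in> S"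
        using that e(2) by (auto simp: dist_commute)
      then show ?thesis
        using le[of y] that(1) by (simp add: field_simps)
    qed
    have "((\<lambda>y. c * norm (y - x)) \<longlongrightarrow> c * norm (x - x)) (at x)"
      by (intro tendsto_intros)
    then show "((\<lambda>y. c * norm (y - x)) \<longlongrightarrow> 0) (at x)"
      by simp
  qed
qed

lemma frechet1_eq:
  assumes "(F has_derivative blinfun_apply L) (at x)"
  shows "frechet1 F x = L"
  unfolding frechet1_def frechet_derivative_at[OF assms, symmetric]
  by (rule blinfun_apply_inverse)

context smoothed_resolvent_family
begin

text \<open>The quadratic remainders are available on \<open>P\<close>, so derivatives exist at interior points.\<close>

lemma has_derivative_V:
  assumes "B \<in> interior P" "\<And>B. B \<in> P \<Longrightarrow> F B = V B (J (J G))"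
  shows "(F has_derivative D1 B) (at B)"
proof (rule has_derivative_if_quadratic_remainder[OF assms(1) open_interior])
  fix B' assume B': "B' \<in> interior P"
  have "B \<in> P" "B' \<in> P"
    using assms(1) B' interior_subset by auto
  then show "norm (F B' - F B - D1 B (B' - B))
    \<le> ((k * M) ^ 2 * M * norm G) * norm (B' - B) * norm (B' - B)"
    using first_remainder[of B B'] assms(2) by (simp add: power2_eq_square algebra_simps)
qed (rule blinfun.bounded_linear_right)

lemma has_derivative_D1:
  assumes "B \<in> interior P" "\<And>B. B \<in> P \<Longrightarrow> F B = V B (J (J G))"
  shows "(frechet1 F has_derivative D2 B) (at B)"
proof (rule has_derivative_if_quadratic_remainder[OF assms(1) open_interior])
  fix B' assume B': "B' \<in> interior P"
  have "B \<in> P" "B' \<in> P"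
    using assms(1) B' interior_subset by auto
  then show "norm (frechet1 F B' - frechet1 F B - D2 B (B' - B))
    \<le> (3 * (k * M) ^ 3 * M1) * norm (B' - B) * norm (B' - B)"
    using second_remainder[of B B'] frechet1_eq[OF has_derivative_V[OF assms(1,2)]]
      frechet1_eq[OF has_derivative_V[OF B' assms(2)]] by simp
qed (rule blinfun.bounded_linear_right)

theorem twice_differentiable_Lipschitz:
  assumes F: "\<And>B. B \<in> P \<Longrightarrow> F B = V B (J (J G))"
  shows "B \<in> interior P \<Longrightarrow> twice_frechet_differentiable F B"
    and "B \<in> interior P \<Longrightarrow> B' \<in> interior P \<Longrightarrow>
      norm (frechet2 F B - frechet2 F B') \<le> 6 * (k * M) ^ 3 * M1 * norm (B - B')"
proof -
  show "twice_frechet_differentiable F B" if "B \<in> interior P"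
  proof -
    have "\<forall>\<^sub>F y in nhds B. y \<in> interior P"
      using that by (simp add: eventually_nhds_in_open)
    then have "\<forall>\<^sub>F y in nhds B. F differentiable (at y)"
      by (rule eventually_mono) (use has_derivative_V F in \<open>auto simp: differentiable_def\<close>)
    then show ?thesis
      using has_derivative_D1[OF that F] by (auto simp: twice_frechet_differentiable_def differentiable_def)
  qed
  have "frechet2 F B = D2 B" if "B \<in> interior P" for B
    unfolding frechet2_def by (rule frechet1_eq[OF has_derivative_D1[OF that F]])
  then show "norm (frechet2 F B - frechet2 F B') \<le> 6 * (k * M) ^ 3 * M1 * norm (B - B')"
    if "B \<in> interior P" "B' \<in> interior P"
    using D2_Lipschitz[of B' B] that interior_subset[of P] by (simp add: subset_iff)
qed

end

section \<open>Range and domain of maximal monotone operators\<close>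

text \<open>Monotonicity makes \<open>P + A\<close> expand distances at least by the coercivity constant \<open>c\<close>.  Its inverse \<open>R\<close> therefore has Lipschitz
constant \<open>1 / c\<close>, and \<open>P' x + A x = y\<close> is the fixed point equation \<open>x = R (y - (P' - P) x)\<close> of a contraction.\<close>

lemma maximal_monotone_onto_near:
  fixes A :: "'a::{real_inner,banach} \<Rightarrow> 'a" and P P' :: "'a \<Rightarrow>\<^sub>L 'a"
  assumes A: "maximal_monotone D A"
    and onto: "\<And>y. \<exists>x\<in>D. P x + A x = y"
    and coercive: "\<And>x. c * (norm x)\<^sup>2 \<le> inner (P x) x" "0 < c"
    and near: "norm (P' - P) < c"
  shows "\<exists>x\<in>D. P' x + A x = y"
proof -
  obtain R where R: "\<And>y. R y \<in> D" "\<And>y. P (R y) + A (R y) = y"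
    using onto by metis
  have R_Lip: "c * norm (R y - R z) \<le> norm (y - z)" for y z
  proof -
    define d where "d = R y - R z"
    have sub: "subspace D" and add: "\<And>x y. x \<in> D \<Longrightarrow> y \<in> D \<Longrightarrow> A (x + y) = A x + A y"
      and scale: "\<And>x r. x \<in> D \<Longrightarrow> A (r *\<^sub>R x) = r *\<^sub>R A x"
      and mono: "\<And>x. x \<in> D \<Longrightarrow> 0 \<le> inner (A x) x"
      using A by (auto simp: maximal_monotone_def)
    have dD: "d \<in> D"
      using sub R(1) by (simp add: d_def subspace_diff)
    have "A d = A (R y) - A (R z)"
      using add[of "R y" "(-1) *\<^sub>R R z"] scale[of "R z" "-1"] R(1) sub
      by (simp add: d_def subspace_neg)
    moreover have "P d = P (R y) - P (R z)"
      by (simp add: d_def blinfun.diff_right)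
    ultimately have "P d + A d = (P (R y) + A (R y)) - (P (R z) + A (R z))"
      by simp
    then have yz: "P d + A d = y - z"
      by (simp only: R(2))
    have "c * (norm d)\<^sup>2 \<le> inner (P d + A d) d"
      using coercive(1)[of d] mono[OF dD] by (simp add: inner_add_left)
    also have "\<dots> \<le> norm (y - z) * norm d"
      unfolding yz by (rule norm_cauchy_schwarz)
    finally have "c * norm d * norm d \<le> norm (y - z) * norm d"
      by (simp add: power2_eq_square)
    then have "c * norm d \<le> norm (y - z)"
      by (cases "norm d = 0") (auto simp: mult_le_cancel_right)
    then show ?thesis
      by (simp add: d_def)
  qed
  define q where "q = norm (P' - P) / c"
  have q: "0 \<le> q" "q < 1"
    using near coercive(2) by (auto simp: q_def)
  have "\<exists>!x. R (y - (P' - P) x) = x"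
  proof (rule banach_fix_type[OF q])
    show "\<forall>x z. dist (R (y - (P' - P) x)) (R (y - (P' - P) z)) \<le> q * dist x z"
    proof (intro allI)
      fix x z
      have "c * norm (R (y - (P' - P) x) - R (y - (P' - P) z)) \<le> norm ((P' - P) (z - x))"
        using R_Lip[of "y - (P' - P) x" "y - (P' - P) z"] by (simp add: blinfun.diff_right algebra_simps)
      also have "\<dots> \<le> norm (P' - P) * norm (z - x)"
        by (rule norm_blinfun)
      finally show "dist (R (y - (P' - P) x)) (R (y - (P' - P) z)) \<le> q * dist x z"
        using coercive(2) by (simp add: q_def dist_norm norm_minus_commute field_simps)
    qed
  qed
  then obtain x where x: "R (y - (P' - P) x) = x"
    by blast
  have "P x + A x = y - (P' - P) x"
    using R(2)[of "y - (P' - P) x"] by (simp add: x)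
  then show ?thesis
    using R(1)[of "y - (P' - P) x", unfolded x]
    by (intro bexI[of _ x]) (simp_all add: blinfun.diff_left algebra_simps)
qed

text \<open>A multiple \<open>l I\<close> of the identity is at distance less than \<open>l\<close> from \<open>P\<close> once \<open>l > norm P ^ 2 / c\<close>, so that \<open>P + A\<close> is
a perturbation of \<open>l I + A\<close>.  The factor \<open>l = (3/2) ^ n\<close> is reached from \<open>1\<close> in steps that are small enough for the
perturbation lemma: \<open>3/2 l - l < l\<close>.\<close>

lemma maximal_monotone_onto_coercive:
  fixes A :: "'a::{real_inner,banach} \<Rightarrow> 'a" and P :: "'a \<Rightarrow>\<^sub>L 'a"
  assumes A: "maximal_monotone D A"
    and coercive: "\<And>x. c * (norm x)\<^sup>2 \<le> inner (P x) x" and c: "0 < c"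
  shows "\<exists>x\<in>D. P x + A x = y"
proof -
  let ?I = "\<lambda>l. l *\<^sub>R id_blinfun :: 'a \<Rightarrow>\<^sub>L 'a"
  have I: "\<exists>x\<in>D. ?I ((3/2) ^ n) x + A x = y" for n y
  proof (induction n arbitrary: y)
    case 0
    show ?case
      using A by (auto simp: maximal_monotone_def)
  next
    case (Suc n)
    have "?I ((3/2) ^ Suc n) - ?I ((3/2) ^ n) = ?I ((1/2) * (3/2) ^ n)"
      by (simp add: scaleR_diff_left[symmetric] algebra_simps)
    then have "norm (?I ((3/2) ^ Suc n) - ?I ((3/2) ^ n)) \<le> (1/2) * (3/2) ^ n * 1"
      by (simp only: norm_scaleR) (intro mult_mono norm_blinfun_id_le, auto)
    also have "\<dots> < (3/2) ^ n"
      by simp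
    finally show ?case
      by (intro maximal_monotone_onto_near[OF A Suc.IH, of "(3/2) ^ n"])
         (simp_all add: blinfun.scaleR_left power2_norm_eq_inner)
  qed
  define s where "s = norm P"
  obtain n where n: "(3/2 :: real) ^ n > max c (s\<^sup>2 / c)"
    using real_arch_pow[of "3/2" "max c (s\<^sup>2 / c)"] by auto
  define l :: real where "l = (3/2) ^ n"
  have l: "c < l" "s\<^sup>2 < c * l"
    using n c by (auto simp: l_def field_simps)
  have "norm (P - ?I l) \<le> sqrt (l\<^sup>2 - c * l)"
  proof (rule norm_blinfun_bound)
    fix x
    have "(norm ((P - ?I l) x))\<^sup>2 = (norm (P x))\<^sup>2 - 2 * l * inner (P x) x + l\<^sup>2 * (norm x)\<^sup>2"
      unfolding power2_norm_eq_inner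
      by (simp add: blinfun.diff_left blinfun.scaleR_left inner_diff_left
          inner_diff_right inner_commute power2_eq_square algebra_simps)
    also have "\<dots> \<le> s\<^sup>2 * (norm x)\<^sup>2 - 2 * l * (c * (norm x)\<^sup>2) + l\<^sup>2 * (norm x)\<^sup>2"
    proof -
      have "(norm (P x))\<^sup>2 \<le> s\<^sup>2 * (norm x)\<^sup>2"
        unfolding power_mult_distrib[symmetric] s_def by (intro power_mono norm_blinfun) simp
      moreover have "2 * l * (c * (norm x)\<^sup>2) \<le> 2 * l * inner (P x) x"
        using l c by (intro mult_left_mono coercive) auto
      ultimately show ?thesis
        by linarith
    qed
    also have "\<dots> = (s\<^sup>2 - 2 * l * c + l\<^sup>2) * (norm x)\<^sup>2"
      by (simp add: algebra_simps)
    also have "\<dots> \<le> (l\<^sup>2 - c * l) * (norm x)\<^sup>2"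
      using l by (intro mult_right_mono) (auto simp: algebra_simps)
    finally show "norm ((P - ?I l) x) \<le> sqrt (l\<^sup>2 - c * l) * norm x"
      by (smt (verit) norm_ge_zero real_le_rsqrt real_sqrt_mult real_sqrt_abs abs_norm_cancel)
  qed (use l c in \<open>auto simp: power2_eq_square\<close>)
  also have "\<dots> < l"
    using l c by (intro real_less_lsqrt) (auto simp: power2_eq_square)
  finally have near: "norm (P - ?I l) < l" .
  show ?thesis
    by (rule maximal_monotone_onto_near[OF A I[of n, folded l_def] _ _ near])
       (use l c in \<open>auto simp: blinfun.scaleR_left power2_norm_eq_inner\<close>)
qed

text \<open>The resolvents \<open>y n\<close> of a vector \<open>x\<close> converge to \<open>x\<close>.  Monotonicity, applied to two resolvents, shows that the
deviations \<open>d n = x - y n\<close> have decreasing norms and form a Cauchy sequence.  Applied to a resolvent and an arbitrary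
element of \<open>D\<close>, it shows in the limit that \<open>lim d\<close> is orthogonal to \<open>D\<close>; and only \<open>0\<close> is, since \<open>I + A\<close> is onto.\<close>

lemma maximal_monotone_dense:
  fixes A :: "'a::{real_inner,banach} \<Rightarrow> 'a"
  assumes A: "maximal_monotone D A"
  shows "closure D = UNIV"
proof -
  have sub: "subspace D" and add: "\<And>x y. x \<in> D \<Longrightarrow> y \<in> D \<Longrightarrow> A (x + y) = A x + A y"
    and scale: "\<And>x r. x \<in> D \<Longrightarrow> A (r *\<^sub>R x) = r *\<^sub>R A x"
    and mono: "\<And>x. x \<in> D \<Longrightarrow> 0 \<le> inner (A x) x"
    using A by (auto simp: maximal_monotone_def)
  have diffD: "x - y \<in> D" and diffA: "A (x - y) = A x - A y" if "x \<in> D" "y \<in> D" for x y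
    using that add[of x "(-1) *\<^sub>R y"] scale[of y "-1"] sub by (auto simp: subspace_diff subspace_neg)
  have orth: "x = 0" if "\<And>z. z \<in> D \<Longrightarrow> inner x z = 0" for x
  proof -
    obtain z where z: "z \<in> D" "z + A z = x"
      using A unfolding maximal_monotone_def by blast
    have "inner z z + inner (A z) z = 0"
      using that[OF z(1)] z(2) by (simp add: inner_add_left[symmetric])
    then have "z = 0"
      using mono[OF z(1)] inner_ge_zero[of z] inner_eq_zero_iff[of z] by linarith
    moreover have "A 0 = 0"
      using scale[of 0 0] sub subspace_0 by fastforce
    ultimately show ?thesis
      using z(2) by simp
  qed
  have "x \<in> closure D" for x
  proof -
    define a :: "nat \<Rightarrow> real" where "a n = real (Suc n)" for n
    have "\<exists>y\<in>D. a n *\<^sub>R y + A y = a n *\<^sub>R x" for n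
      using maximal_monotone_onto_coercive[OF A, of "a n" "a n *\<^sub>R id_blinfun" "a n *\<^sub>R x"]
      by (auto simp: blinfun.scaleR_left power2_norm_eq_inner a_def)
    then obtain y where yD: "\<And>n. y n \<in> D" and y: "\<And>n. a n *\<^sub>R y n + A (y n) = a n *\<^sub>R x"
      by metis
    define d where "d n = x - y n" for n
    have Ay: "A (y n) = a n *\<^sub>R d n" for n
      using y[of n] by (simp add: d_def algebra_simps)
    have key: "(norm (d m))\<^sup>2 + (norm (d m - d n))\<^sup>2 \<le> (norm (d n))\<^sup>2" if "n < m" for m n
    proof -
      have "0 \<le> inner (A (y m - y n)) (y m - y n)"
        by (intro mono diffD yD)
      also have "\<dots> = inner (a m *\<^sub>R d m - a n *\<^sub>R d n) (d n - d m)"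
        by (simp add: diffA yD Ay) (simp add: d_def)
      finally have 1: "a m * inner (d m) (d m) - (a m + a n) * inner (d m) (d n)
          + a n * inner (d n) (d n) \<le> 0"
        by (simp add: inner_diff_left inner_diff_right inner_commute algebra_simps)
      have 2: "(norm (d m - d n))\<^sup>2 = inner (d m) (d m) + inner (d n) (d n) - 2 * inner (d m) (d n)"
        by (simp add: power2_norm_eq_inner inner_diff_left inner_diff_right inner_commute)
      have amn: "a m > a n" "a n > 0"
        using that by (auto simp: a_def)
      have "(a m - a n) * inner (d m) (d m) + (a m + a n) * (norm (d m - d n))\<^sup>2
          \<le> (a m - a n) * inner (d n) (d n)"
        using 1 unfolding 2 by (simp add: algebra_simps)
      moreover have "(a m - a n) * (norm (d m - d n))\<^sup>2 \<le> (a m + a n) * (norm (d m - d n))\<^sup>2"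
        using amn by (intro mult_right_mono) auto
      ultimately have "(a m - a n) * (inner (d m) (d m) + (norm (d m - d n))\<^sup>2)
          \<le> (a m - a n) * inner (d n) (d n)"
        by (simp add: distrib_left)
      then show ?thesis
        using amn by (simp add: power2_norm_eq_inner)
    qed
    have "decseq (\<lambda>n. (norm (d n))\<^sup>2)"
      unfolding decseq_Suc_iff using key by (smt (verit) lessI zero_le_power2)
    then have "convergent (\<lambda>n. (norm (d n))\<^sup>2)"
      using decseq_convergent[of "\<lambda>n. (norm (d n))\<^sup>2" 0] by (auto simp: convergent_def)
    then have Cau: "Cauchy (\<lambda>n. (norm (d n))\<^sup>2)"
      by (rule convergent_Cauchy)
    have "Cauchy d"
    proof (rule CauchyI')
      fix e :: real assume "0 < e"
      then obtain M where M: "\<And>m n. m \<ge> M \<Longrightarrow> n \<ge> M \<Longrightarrow> norm ((norm (d m))\<^sup>2 - (norm (d n))\<^sup>2) < e\<^sup>2"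
        using CauchyD[OF Cau, of "e\<^sup>2"] by auto
      have "norm (d m - d n) < e" if "m \<ge> M" "n > m" for m n
      proof -
        have "(norm (d m - d n))\<^sup>2 < e\<^sup>2"
          using M[of m n] key[of m n] that by (simp add: norm_minus_commute)
        then show ?thesis
          using \<open>0 < e\<close> by (simp add: power_less_imp_less_base)
      qed
      then show "\<exists>M. \<forall>m\<ge>M. \<forall>n>m. dist (d m) (d n) < e"
        by (auto simp: dist_norm)
    qed
    then obtain d0 where d0: "d \<longlonglongrightarrow> d0"
      using Cauchy_convergent_iff convergent_def by blast
    have lim_a: "(\<lambda>n. inverse (a n)) \<longlonglongrightarrow> 0"
      unfolding a_def by (rule LIMSEQ_inverse_real_of_nat)
    have "inner d0 (x - d0 - z) \<ge> 0" if z: "z \<in> D" for z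
    proof -
      have "0 \<le> inner (d n - inverse (a n) *\<^sub>R A z) (x - d n - z)" for n
      proof -
        have "0 \<le> inner (A (y n - z)) (y n - z)"
          by (intro mono diffD yD z)
        also have "A (y n - z) = a n *\<^sub>R (d n - inverse (a n) *\<^sub>R A z)"
          by (simp add: diffA yD z Ay scaleR_diff_right a_def)
        also have "y n - z = x - d n - z"
          by (simp add: d_def)
        also have "inner (a n *\<^sub>R (d n - inverse (a n) *\<^sub>R A z)) (x - d n - z)
            = a n * inner (d n - inverse (a n) *\<^sub>R A z) (x - d n - z)"
          by simp
        finally show ?thesis
          by (simp add: zero_le_mult_iff a_def)
      qed
      moreover have "(\<lambda>n. inner (d n - inverse (a n) *\<^sub>R A z) (x - d n - z))
          \<longlonglongrightarrow> inner (d0 - 0 *\<^sub>R A z) (x - d0 - z)"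
        by (intro tendsto_intros d0 lim_a)
      ultimately show ?thesis
        by (intro LIMSEQ_le_const[of _ "inner d0 (x - d0 - z)" 0]) auto
    qed
    note ge = this
    have "inner d0 z = 0" if z: "z \<in> D" for z
    proof (rule ccontr)
      assume nz: "inner d0 z \<noteq> 0"
      \<comment> \<open>With this multiple of \<open>z\<close> the inner product in \<open>ge\<close> equals \<open>-1\<close>.\<close>
      define r where "r = (inner d0 (x - d0) + 1) / inner d0 z"
      have "r *\<^sub>R z \<in> D"
        using z sub by (simp add: subspace_scale)
      from ge[OF this] show False
        using nz by (simp add: inner_diff_right r_def)
    qed
    then have "d0 = 0"
      by (rule orth)
    then have "(\<lambda>n. x - d n) \<longlonglongrightarrow> x"
      using tendsto_diff[OF tendsto_const d0, of x] by simp
    then have "y \<longlonglongrightarrow> x"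
      by (simp add: d_def)
    then show ?thesis
      using yD closure_sequential by blast
  qed
  then show ?thesis
    by blast
qed

section \<open>Generation of semigroups by the implicit Euler scheme\<close>

lemma dense_approach:
  assumes "closure D = UNIV" "0 < e"
  obtains z where "z \<in> D" "dist z x < e"
  using assms closure_approachable[of x D] by auto

text \<open>A limit of uniformly Lipschitz maps need only be checked on a dense set.  This lemma and the next one replace
the density arguments for uniformly bounded families of linear operators.\<close>

lemma equi_Lipschitz_convergent:
  fixes f :: "nat \<Rightarrow> 'a::metric_space \<Rightarrow> 'b::complete_space"
  assumes Lip: "\<And>k x y. dist (f k x) (f k y) \<le> M * dist x y"
    and D: "closure D = UNIV" and conv: "\<And>x. x \<in> D \<Longrightarrow> convergent (\<lambda>k. f k x)"
  shows "convergent (\<lambda>k. f k x)"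
proof -
  have "Cauchy (\<lambda>k. f k x)"
  proof (rule metric_CauchyI)
    fix e :: real assume e: "0 < e"
    define d where "d = e / (3 * (\<bar>M\<bar> + 1))"
    have d: "0 < d"
      using e by (simp add: d_def)
    obtain z where z: "z \<in> D" "dist z x < d"
      using dense_approach[OF D d] .
    have Md: "M * dist x z \<le> e / 3" "M * dist z x \<le> e / 3"
    proof -
      have "M * dist z x \<le> \<bar>M\<bar> * d"
        using z by (intro mult_mono) auto
      also have "\<dots> \<le> e / 3"
        using e by (simp add: d_def field_simps)
      finally show "M * dist x z \<le> e / 3" "M * dist z x \<le> e / 3"
        by (simp_all add: dist_commute)
    qed
    obtain N where N: "\<And>m n. m \<ge> N \<Longrightarrow> n \<ge> N \<Longrightarrow> dist (f m z) (f n z) < e / 3"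
      using metric_CauchyD[OF convergent_Cauchy[OF conv[OF z(1)]], of "e / 3"] e by auto
    have "dist (f m x) (f n x) < e" if "m \<ge> N" "n \<ge> N" for m n
      using N[OF that] Lip[of m x z] Lip[of n z x] Md
        dist_triangle[of "f m x" "f n x" "f m z"] dist_triangle[of "f m z" "f n x" "f n z"]
      by linarith
    then show "\<exists>N. \<forall>m\<ge>N. \<forall>n\<ge>N. dist (f m x) (f n x) < e"
      by blast
  qed
  then show ?thesis
    by (simp add: Cauchy_convergent_iff)
qed

lemma equi_Lipschitz_tendsto:
  fixes f :: "'t \<Rightarrow> 'a::metric_space \<Rightarrow> 'b::metric_space"
  assumes Lip: "\<forall>\<^sub>F t in F. \<forall>x y. dist (f t x) (f t y) \<le> M * dist x y"
    and g: "\<And>x y. dist (g x) (g y) \<le> M' * dist x y"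
    and D: "closure D = UNIV" and lim: "\<And>x. x \<in> D \<Longrightarrow> ((\<lambda>t. f t x) \<longlongrightarrow> g x) F"
  shows "((\<lambda>t. f t x) \<longlongrightarrow> g x) F"
proof (rule tendstoI)
  fix e :: real assume e: "0 < e"
  define d where "d = e / (3 * (\<bar>M\<bar> + \<bar>M'\<bar> + 1))"
  have d: "0 < d"
    using e by (simp add: d_def)
  obtain z where z: "z \<in> D" "dist z x < d"
    using dense_approach[OF D d] .
  have Md: "C * dist x z \<le> e / 3" "C * dist z x \<le> e / 3" if "\<bar>C\<bar> \<le> \<bar>M\<bar> + \<bar>M'\<bar>" for C
  proof -
    have "C * dist z x \<le> (\<bar>M\<bar> + \<bar>M'\<bar>) * d"
      using z that by (intro mult_mono) auto
    also have "\<dots> \<le> e / 3"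
      using e by (simp add: d_def field_simps)
    finally show "C * dist x z \<le> e / 3" "C * dist z x \<le> e / 3"
      by (simp_all add: dist_commute)
  qed
  have "\<forall>\<^sub>F t in F. dist (f t z) (g z) < e / 3"
    using tendstoD[OF lim[OF z(1)], of "e / 3"] e by simp
  with Lip show "\<forall>\<^sub>F t in F. dist (f t x) (g x) < e"
  proof eventually_elim
    case (elim t)
    have "dist (f t x) (f t z) \<le> e / 3" "dist (g z) (g x) \<le> e / 3"
      using elim(1) g[of z x] Md[of M] Md[of M'] by (smt (verit))+
    then show ?case
      using elim(2) dist_triangle[of "f t x" "g x" "f t z"] dist_triangle[of "f t z" "g x" "g z"]
      by linarith
  qed
qed

lemma blinfun_eq_on_dense:
  fixes L L' :: "'a::real_normed_vector \<Rightarrow>\<^sub>L 'b::real_normed_vector"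
  assumes "closure D = UNIV" "\<And>x. x \<in> D \<Longrightarrow> L x = L' x"
  shows "L = L'"
proof (rule blinfun_eqI)
  fix x
  have "closed {x. L x = L' x}"
    by (intro closed_Collect_eq blinfun.continuous_on continuous_intros)
  then have "closure D \<subseteq> {x. L x = L' x}"
    using assms(2) by (intro closure_minimal) auto
  then show "L x = L' x"
    using assms(1) by auto
qed

lemma floor_add_cases:
  fixes a b :: real
  assumes "0 \<le> a" "0 \<le> b"
  shows "nat \<lfloor>a + b\<rfloor> = nat \<lfloor>a\<rfloor> + nat \<lfloor>b\<rfloor> \<or> nat \<lfloor>a + b\<rfloor> = nat \<lfloor>a\<rfloor> + nat \<lfloor>b\<rfloor> + 1"
proof -
  have "\<lfloor>a + b\<rfloor> = \<lfloor>a\<rfloor> + \<lfloor>b\<rfloor> \<or> \<lfloor>a + b\<rfloor> = \<lfloor>a\<rfloor> + \<lfloor>b\<rfloor> + 1"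
    by linarith
  moreover have "0 \<le> \<lfloor>a\<rfloor>" "0 \<le> \<lfloor>b\<rfloor>"
    using assms by auto
  ultimately show ?thesis
    by linarith
qed

text \<open>The hypotheses of the Hille-Yosida theorem: \<open>R h\<close> is the inverse of \<open>I - h G\<close>, that is, one step of the implicit Euler
scheme for \<open>u' = G u\<close>, and the scheme is stable.\<close>

locale resolvents =
  fixes D :: "'a::banach set" and G :: "'a \<Rightarrow> 'a" and R :: "real \<Rightarrow> 'a \<Rightarrow>\<^sub>L 'a" and M :: real
  assumes R_D: "0 < h \<Longrightarrow> h \<le> 1 \<Longrightarrow> R h x \<in> D"
    and R_right: "0 < h \<Longrightarrow> h \<le> 1 \<Longrightarrow> R h x - h *\<^sub>R G (R h x) = x"
    and R_left: "0 < h \<Longrightarrow> h \<le> 1 \<Longrightarrow> x \<in> D \<Longrightarrow> R h (x - h *\<^sub>R G x) = x"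
    and R_pow: "0 < h \<Longrightarrow> h \<le> 1 \<Longrightarrow> norm ((blinfun_apply (R h) ^^ n) x) \<le> M * norm x"
    and dense: "closure D = UNIV"
begin

abbreviation E :: "real \<Rightarrow> nat \<Rightarrow> 'a \<Rightarrow> 'a" where
  "E h n \<equiv> blinfun_apply (R h) ^^ n"

lemma E_le: "norm x \<le> c \<Longrightarrow> 0 < h \<Longrightarrow> h \<le> 1 \<Longrightarrow> norm (E h n x) \<le> \<bar>M\<bar> * c"
  using R_pow[of h n x] by (smt (verit) mult_mono norm_ge_zero)

lemma R_le: "norm x \<le> c \<Longrightarrow> 0 < h \<Longrightarrow> h \<le> 1 \<Longrightarrow> norm (R h x) \<le> \<bar>M\<bar> * c"
  using E_le[of x c h 1] by simp

lemma G_R: "0 < h \<Longrightarrow> h \<le> 1 \<Longrightarrow> x \<in> D \<Longrightarrow> G (R h x) = R h (G x)"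
proof -
  assume h: "0 < h" "h \<le> 1" and x: "x \<in> D"
  have "R h x - h *\<^sub>R G (R h x) = R h x - h *\<^sub>R R h (G x)"
    using R_right[OF h, of x] R_left[OF h x]
    by (simp add: blinfun.diff_right blinfun.scaleR_right)
  then show ?thesis
    using h by simp
qed

lemma G_E: "0 < h \<Longrightarrow> h \<le> 1 \<Longrightarrow> x \<in> D \<Longrightarrow> E h n x \<in> D \<and> G (E h n x) = E h n (G x)"
  by (induction n) (auto simp: G_R R_D)

lemma R_commute: "0 < h \<Longrightarrow> h \<le> 1 \<Longrightarrow> 0 < k \<Longrightarrow> k \<le> 1 \<Longrightarrow> R h (R k x) = R k (R h x)"
proof -
  assume h: "0 < h" "h \<le> 1" and k: "0 < k" "k \<le> 1"
  let ?y = "R k (R h x)"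
  have "?y - h *\<^sub>R G ?y = R k (R h x - h *\<^sub>R G (R h x))"
    by (simp add: G_R[OF k R_D[OF h]] blinfun.diff_right blinfun.scaleR_right)
  also have "\<dots> = R k x"
    by (simp add: R_right[OF h])
  finally show ?thesis
    using R_left[OF h R_D[OF k], of "R h x"] by simp
qed

lemma E_diff: "E h n x - E h n y = E h n (x - y)"
  by (induction n arbitrary: x y) (simp_all add: blinfun.diff_right funpow_swap1)

lemma bounded_linear_E: "bounded_linear (E h n)"
  by (induction n)
     (auto simp: o_def bounded_linear_ident
       intro!: bounded_linear_compose[OF blinfun.bounded_linear_right])

lemma E_step: "0 < h \<Longrightarrow> h \<le> 1 \<Longrightarrow> x \<in> D \<Longrightarrow> E h (Suc n) x - E h n x = h *\<^sub>R E h (Suc n) (G x)"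
proof -
  assume h: "0 < h" "h \<le> 1" and x: "x \<in> D"
  have "R h x - x = h *\<^sub>R R h (G x)"
    using R_right[OF h, of x] G_R[OF h x] by (simp add: algebra_simps)
  then have "E h n (R h x) - E h n x = E h n (h *\<^sub>R R h (G x))"
    by (simp add: E_diff)
  then show ?thesis
    by (simp add: funpow_swap1 linear_cmul[OF bounded_linear.linear[OF bounded_linear_E]])
qed

lemma E_steps:
  assumes h: "0 < h" "h \<le> 1" and x: "x \<in> D"
  shows "norm (E h (n + j) x - E h n x) \<le> real j * h * (\<bar>M\<bar> * norm (G x))"
proof (induction j)
  case (Suc j)
  have "norm (E h (n + Suc j) x - E h (n + j) x) \<le> h * (\<bar>M\<bar> * norm (G x))"
    using E_step[OF h x, of "n + j"] E_le[OF order_refl h, of "Suc (n + j)" "G x"] h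
    by (simp del: funpow.simps add: mult_left_mono)
  with Suc.IH show ?case
    using norm_triangle_ineq[of "E h (n + Suc j) x - E h (n + j) x" "E h (n + j) x - E h n x"]
    by (simp del: funpow.simps add: algebra_simps)
qed simp

lemma E_second_order:
  assumes h: "0 < h" "h \<le> 1" and x: "x \<in> D" "G x \<in> D"
  shows "norm (E h n x - x - (real n * h) *\<^sub>R G x) \<le> (real n * h)\<^sup>2 * (\<bar>M\<bar> * norm (G (G x)))"
proof (induction n)
  case (Suc n)
  let ?c = "\<bar>M\<bar> * norm (G (G x))"
  have "norm (E h (Suc n) (G x) - G x) \<le> real (Suc n) * h * ?c"
    using E_steps[OF h x(2), of 0 "Suc n"] by (simp del: funpow.simps add: funpow_0)
  then have 1: "norm (h *\<^sub>R (E h (Suc n) (G x) - G x)) \<le> h * (real (Suc n) * h * ?c)"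
    using h by (simp del: funpow.simps)
  have "E h (Suc n) x - x - (real (Suc n) * h) *\<^sub>R G x
      = h *\<^sub>R (E h (Suc n) (G x) - G x) + (E h n x - x - (real n * h) *\<^sub>R G x)"
    using E_step[OF h x(1), of n]
    by (simp del: funpow.simps add: algebra_simps)
  also have "norm \<dots> \<le> h * (real (Suc n) * h * ?c) + (real n * h)\<^sup>2 * ?c"
    by (rule norm_triangle_mono[OF 1 Suc.IH])
  also have "\<dots> \<le> (real (Suc n) * h)\<^sup>2 * ?c"
  proof -
    have "0 \<le> real n * h\<^sup>2 * ?c"
      by simp
    then show ?thesis
      by (simp add: power2_eq_square algebra_simps)
  qed
  finally show ?case .
qed simp

text \<open>With \<open>z = R h (R h x)\<close> one has \<open>x = (I - h G)\<^sup>2 z = (I - 2 h G) z + h\<^sup>2 G\<^sup>2 z\<close>, and \<open>R (2 h)\<close> inverts the first term.  Two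
steps of size \<open>h\<close> thus differ from one of size \<open>2 h\<close> by a term of second order.\<close>

lemma halving:
  assumes h: "0 < h" "2 * h \<le> 1" and x: "x \<in> D" "G x \<in> D"
  shows "R h (R h x) - R (2 * h) x = - (h\<^sup>2 *\<^sub>R R (2 * h) (R h (R h (G (G x)))))"
proof -
  have h1: "h \<le> 1" "0 < 2 * h"
    using h by auto
  note h' = h(1) h1(1) and hh = h1(2) h(2)
  define z where "z = R h (R h x)"
  have zD: "z \<in> D"
    by (simp add: z_def R_D[OF h'])
  have Gz: "G z = R h (R h (G x))" and GGz: "G (G z) = R h (R h (G (G x)))"
    using x by (simp_all add: z_def G_R[OF h'] R_D[OF h'])
  have 1: "z - h *\<^sub>R G z = R h x"
    unfolding z_def by (rule R_right[OF h'])
  have 2: "G z - h *\<^sub>R G (G z) = R h (G x)"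
    unfolding Gz by (rule R_right[OF h'])
  have 3: "R h x - h *\<^sub>R R h (G x) = x"
    using R_right[OF h', of x] G_R[OF h' x(1)] by simp
  have "x = (z - h *\<^sub>R G z) - h *\<^sub>R (G z - h *\<^sub>R G (G z))"
    by (simp only: 1 2 3)
  also have "\<dots> = (z - (2 * h) *\<^sub>R G z) + h\<^sup>2 *\<^sub>R G (G z)"
    by (simp add: algebra_simps power2_eq_square) (simp add: scaleR_2[symmetric])
  finally have x_eq: "x = (z - (2 * h) *\<^sub>R G z) + h\<^sup>2 *\<^sub>R G (G z)" .
  have "R (2 * h) x = z + h\<^sup>2 *\<^sub>R R (2 * h) (G (G z))"
    using arg_cong[OF x_eq, of "R (2 * h)"]
    by (simp add: blinfun.add_right blinfun.scaleR_right R_left[OF hh zD])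
  then show ?thesis
    by (simp add: GGz z_def[symmetric])
qed

text \<open>The local errors of \<open>halving\<close> are added up; stability keeps each of them bounded.  The generality in \<open>i\<close> is what the
induction needs, since the coarse step is peeled off on the right.\<close>

lemma halving_iterated:
  assumes h: "0 < h" "2 * h \<le> 1" and x: "x \<in> D" "G x \<in> D"
  shows "norm (E h (2 * n) (E (2 * h) i x) - E (2 * h) n (E (2 * h) i x))
    \<le> real n * (h\<^sup>2 * (\<bar>M\<bar> * (\<bar>M\<bar> * (\<bar>M\<bar> * (\<bar>M\<bar> * norm (G (G x)))))))"
proof (induction n arbitrary: i)
  case (Suc n)
  have h1: "h \<le> 1" "0 < 2 * h"
    using h by auto
  note h' = h(1) h1(1) and hh = h1(2) h(2)
  let ?y = "E (2 * h) i x"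
  have y: "?y \<in> D" "G ?y \<in> D" and GGy: "G (G ?y) = E (2 * h) i (G (G x))"
    using x by (simp_all add: G_E[OF hh])
  have "E h (2 * Suc n) ?y - E (2 * h) (Suc n) ?y
      = E h (2 * n) (R h (R h ?y) - R (2 * h) ?y)
        + (E h (2 * n) (E (2 * h) (Suc i) x) - E (2 * h) n (E (2 * h) (Suc i) x))"
    by (simp add: E_diff[symmetric] funpow_swap1)
  also have "norm \<dots> \<le> h\<^sup>2 * (\<bar>M\<bar> * (\<bar>M\<bar> * (\<bar>M\<bar> * (\<bar>M\<bar> * norm (G (G x))))))
      + real n * (h\<^sup>2 * (\<bar>M\<bar> * (\<bar>M\<bar> * (\<bar>M\<bar> * (\<bar>M\<bar> * norm (G (G x)))))))"
  proof (rule norm_triangle_mono[OF _ Suc.IH])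
    have "E h (2 * n) (R h (R h ?y) - R (2 * h) ?y)
        = - (h\<^sup>2 *\<^sub>R E h (2 * n) (R (2 * h) (E h 2 (E (2 * h) i (G (G x))))))"
      unfolding halving[OF h y] GGy
      by (simp add: bounded_linear.linear[OF bounded_linear_E] linear_neg linear_cmul eval_nat_numeral)
    also have "norm \<dots> = h\<^sup>2 * norm (E h (2 * n) (R (2 * h) (E h 2 (E (2 * h) i (G (G x))))))"
      by simp
    also have "\<dots> \<le> h\<^sup>2 * (\<bar>M\<bar> * (\<bar>M\<bar> * (\<bar>M\<bar> * (\<bar>M\<bar> * norm (G (G x))))))"
      by (intro mult_left_mono E_le R_le h' hh order_refl) auto
    finally show "norm (E h (2 * n) (R h (R h ?y) - R (2 * h) ?y))
      \<le> h\<^sup>2 * (\<bar>M\<bar> * (\<bar>M\<bar> * (\<bar>M\<bar> * (\<bar>M\<bar> * norm (G (G x))))))" .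
  qed
  finally show ?case
    by (simp add: algebra_simps)
qed simp

definition steps :: "real \<Rightarrow> nat \<Rightarrow> nat" where
  "steps t k = nat \<lfloor>t * 2 ^ k\<rfloor>"

text \<open>The scheme with step size \<open>2\<^sup>-\<^sup>k\<close>.  Dyadic step sizes let the approximations be compared by repeated halving.\<close>

definition euler :: "nat \<Rightarrow> real \<Rightarrow> 'a \<Rightarrow> 'a" where
  "euler k t = E ((1/2) ^ k) (steps t k)"

lemma step_size: "0 < (1/2 :: real) ^ k" "(1/2 :: real) ^ k \<le> 1"
  by (auto simp: power_le_one)

lemma steps_le: "0 \<le> t \<Longrightarrow> real (steps t k) * (1/2) ^ k \<le> t"
  by (simp add: steps_def power_one_over field_simps)

lemma steps_lim: "0 \<le> t \<Longrightarrow> (\<lambda>k. real (steps t k) * (1/2) ^ k) \<longlonglongrightarrow> t"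
proof (rule tendsto_sandwich[of "\<lambda>k. t - (1/2) ^ k" _ _ "\<lambda>_. t"])
  assume t: "0 \<le> t"
  have "t * 2 ^ k - 1 \<le> real (steps t k)" for k
    using t by (simp add: steps_def)
  then have "(t * 2 ^ k - 1) * (1/2) ^ k \<le> real (steps t k) * (1/2) ^ k" for k
    by (intro mult_right_mono) auto
  then show "\<forall>\<^sub>F k in sequentially. t - (1/2) ^ k \<le> real (steps t k) * (1/2) ^ k"
    by (simp add: algebra_simps power_one_over)
  show "(\<lambda>k. t - (1/2) ^ k) \<longlonglongrightarrow> t"
    using tendsto_diff[OF tendsto_const LIMSEQ_power_zero[of "1/2 :: real"], of t] by simp
qed (use steps_le in auto)

lemma euler_diff: "euler k t x - euler k t y = euler k t (x - y)"
  by (simp add: euler_def E_diff)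

lemma euler_le: "norm x \<le> c \<Longrightarrow> norm (euler k t x) \<le> \<bar>M\<bar> * c"
  unfolding euler_def by (intro E_le step_size)

lemma euler_Lipschitz: "dist (euler k t x) (euler k t y) \<le> \<bar>M\<bar> * dist x y"
  unfolding dist_norm euler_diff by (rule euler_le) simp

text \<open>Halving the step size may also produce one additional step at the end, when the binary expansion of \<open>t\<close> has a digit
\<open>1\<close> there; this is the number \<open>j\<close>.\<close>

lemma euler_refine:
  assumes t: "0 \<le> t" and x: "x \<in> D" "G x \<in> D"
  defines "c \<equiv> t * (\<bar>M\<bar> * (\<bar>M\<bar> * (\<bar>M\<bar> * (\<bar>M\<bar> * norm (G (G x)))))) + \<bar>M\<bar> * norm (G x)"
  shows "norm (euler (Suc k) t x - euler k t x) \<le> c * (1/2) ^ k"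
proof -
  define h :: real where "h = (1/2) ^ Suc k"
  have h: "0 < h" "2 * h \<le> 1" "h \<le> 1" and hh: "2 * h = (1/2) ^ k"
    using step_size[of k] step_size[of "Suc k"] by (auto simp: h_def)
  define n where "n = steps t k"
  have double: "t * 2 ^ Suc k = t * 2 ^ k + t * 2 ^ k"
    by simp
  have "steps t (Suc k) = n + n \<or> steps t (Suc k) = n + n + 1"
    unfolding n_def steps_def double using t by (intro floor_add_cases) auto
  then obtain j where j: "steps t (Suc k) = 2 * n + j" "j \<le> 1"
    by (metis add.right_neutral le_add2 le_numeral_extra(4) mult_2 add_0)
  have fine: "euler (Suc k) t x = E h (2 * n + j) x" and coarse: "euler k t x = E (2 * h) n x"
    by (simp_all only: euler_def h_def[symmetric] j(1) hh n_def)
  have "euler (Suc k) t x - euler k t x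
      = (E h (2 * n + j) x - E h (2 * n) x) + (E h (2 * n) x - E (2 * h) n x)"
    by (simp add: fine coarse)
  also have "norm \<dots> \<le> real j * h * (\<bar>M\<bar> * norm (G x))
      + real n * (h\<^sup>2 * (\<bar>M\<bar> * (\<bar>M\<bar> * (\<bar>M\<bar> * (\<bar>M\<bar> * norm (G (G x)))))))"
    using halving_iterated[OF h(1,2) x, of n 0]
    by (intro norm_triangle_mono E_steps h x) simp
  also have "\<dots> \<le> (2 * h) * (\<bar>M\<bar> * norm (G x))
      + (t * (2 * h)) * (\<bar>M\<bar> * (\<bar>M\<bar> * (\<bar>M\<bar> * (\<bar>M\<bar> * norm (G (G x))))))"
  proof -
    have "real j * h \<le> 2 * h"
      using j h by (intro mult_right_mono) auto
    moreover have "real n * (2 * h) * h \<le> t * (2 * h)"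
      using steps_le[OF t, of k, folded hh] h t by (intro mult_mono) (auto simp: n_def)
    then have "real n * h\<^sup>2 \<le> t * (2 * h)"
      using h t by (simp add: power2_eq_square)
    ultimately have "real j * h * q1 + real n * h\<^sup>2 * q2 \<le> 2 * h * q1 + t * (2 * h) * q2"
      if "0 \<le> q1" "0 \<le> q2" for q1 q2
      using that by (intro add_mono[OF mult_right_mono mult_right_mono])
    then show ?thesis
      unfolding mult.assoc[symmetric, of "real n"] by simp
  qed
  also have "\<dots> = c * (1/2) ^ k"
    by (simp add: hh[symmetric] c_def algebra_simps)
  finally show ?thesis .
qed

text \<open>The resolvents map \<open>D\<close> into the domain of the square of \<open>G\<close> and tend to the identity on \<open>D\<close>.\<close>

lemma domain_square_dense: "closure {x \<in> D. G x \<in> D} = UNIV"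
proof -
  have "D \<subseteq> closure {x \<in> D. G x \<in> D}"
  proof
    fix x assume x: "x \<in> D"
    have "(\<lambda>k. R ((1/2) ^ k) x) \<longlonglongrightarrow> x"
    proof (rule LIM_zero_cancel, rule Lim_null_comparison)
      show "\<forall>\<^sub>F k in sequentially. norm (R ((1/2) ^ k) x - x) \<le> (1/2) ^ k * (\<bar>M\<bar> * norm (G x))"
        using E_steps[OF step_size x, of 0 1] by (intro always_eventually) simp
      show "(\<lambda>k. (1/2) ^ k * (\<bar>M\<bar> * norm (G x))) \<longlonglongrightarrow> 0"
        by (intro tendsto_mult_left_zero LIMSEQ_power_zero) simp
    qed
    moreover have "R ((1/2) ^ k) x \<in> {x \<in> D. G x \<in> D}" for k
      using x by (simp add: R_D[OF step_size] G_R[OF step_size])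
    ultimately show "x \<in> closure {x \<in> D. G x \<in> D}"
      unfolding closure_sequential by (intro exI[of _ "\<lambda>k. R ((1/2) ^ k) x"]) auto
  qed
  then show ?thesis
    using dense by (metis closure_mono closure_closure UNIV_I subset_UNIV subset_antisym)
qed

text \<open>On the domain of \<open>G\<^sup>2\<close> the differences of consecutive approximations are summable by \<open>euler_refine\<close>.\<close>

lemma euler_convergent:
  assumes t: "0 \<le> t"
  shows "convergent (\<lambda>k. euler k t x)"
proof (rule equi_Lipschitz_convergent[OF euler_Lipschitz domain_square_dense])
  fix x assume "x \<in> {x \<in> D. G x \<in> D}"
  then have x: "x \<in> D" "G x \<in> D"
    by auto
  define c where "c = t * (\<bar>M\<bar> * (\<bar>M\<bar> * (\<bar>M\<bar> * (\<bar>M\<bar> * norm (G (G x)))))) + \<bar>M\<bar> * norm (G x)"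
  have "summable (\<lambda>k. euler (Suc k) t x - euler k t x)"
  proof (rule summable_comparison_test)
    show "\<exists>N. \<forall>k\<ge>N. norm (euler (Suc k) t x - euler k t x) \<le> c * (1/2) ^ k"
      using euler_refine[OF t x] by (auto simp: c_def)
    show "summable (\<lambda>k. c * (1/2) ^ k)"
      by (intro summable_mult summable_geometric) auto
  qed
  then have "convergent (\<lambda>k. euler k t x - euler 0 t x)"
    using sum_lessThan_telescope[of "\<lambda>k. euler k t x"]
    by (simp add: summable_iff_convergent)
  then show "convergent (\<lambda>k. euler k t x)"
    by (simp add: convergent_diff_const_right_iff)
qed

definition semigroup :: "real \<Rightarrow> 'a \<Rightarrow>\<^sub>L 'a" where
  "semigroup t = Blinfun (\<lambda>x. lim (\<lambda>k. euler k t x))"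

lemma semigroup_lim:
  assumes t: "0 \<le> t"
  shows "(\<lambda>k. euler k t x) \<longlonglongrightarrow> semigroup t x"
proof -
  have lim: "(\<lambda>k. euler k t x) \<longlonglongrightarrow> lim (\<lambda>k. euler k t x)" for x
    using euler_convergent[OF t] by (simp add: convergent_LIMSEQ_iff)
  have "bounded_linear (\<lambda>x. lim (\<lambda>k. euler k t x))"
  proof
    fix x y :: 'a and r :: real
    have lin: "linear (euler k t)" for k
      unfolding euler_def by (rule bounded_linear.linear[OF bounded_linear_E])
    show "lim (\<lambda>k. euler k t (x + y)) = lim (\<lambda>k. euler k t x) + lim (\<lambda>k. euler k t y)"
      using tendsto_add[OF lim lim] by (intro limI) (simp add: linear_add[OF lin])
    show "lim (\<lambda>k. euler k t (r *\<^sub>R x)) = r *\<^sub>R lim (\<lambda>k. euler k t x)"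
      using tendsto_scaleR[OF tendsto_const lim] by (intro limI) (simp add: linear_cmul[OF lin])
    have "norm (lim (\<lambda>k. euler k t x)) \<le> norm x * \<bar>M\<bar>" for x
      using euler_le[OF order_refl]
      by (intro LIMSEQ_le_const2[OF tendsto_norm[OF lim]]) (auto simp: mult.commute)
    then show "\<exists>K. \<forall>x. norm (lim (\<lambda>k. euler k t x)) \<le> norm x * K"
      by blast
  qed
  then show ?thesis
    using lim by (simp add: semigroup_def bounded_linear_Blinfun_apply)
qed

lemma semigroup_le: "0 \<le> t \<Longrightarrow> norm (semigroup t x) \<le> \<bar>M\<bar> * norm x"
  using euler_le[OF order_refl]
  by (intro LIMSEQ_le_const2[OF tendsto_norm[OF semigroup_lim]]) auto

lemma euler_add:
  assumes s: "0 \<le> s" and t: "0 \<le> t" and x: "x \<in> D"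
  shows "norm (euler k (s + t) x - euler k s (euler k t x)) \<le> (1/2) ^ k * (\<bar>M\<bar> * norm (G x))"
proof -
  obtain j where j: "steps (s + t) k = steps s k + steps t k + j" "j \<le> 1"
    using floor_add_cases[of "s * 2 ^ k" "t * 2 ^ k"] s t
    by (auto simp: steps_def distrib_right)
  have "euler k (s + t) x - euler k s (euler k t x)
      = E ((1/2) ^ k) (steps s k + steps t k + j) x - E ((1/2) ^ k) (steps s k + steps t k) x"
    by (simp add: euler_def j funpow_add)
  also have "norm \<dots> \<le> real j * (1/2) ^ k * (\<bar>M\<bar> * norm (G x))"
    by (rule E_steps[OF step_size x])
  also have "\<dots> \<le> 1 * (1/2) ^ k * (\<bar>M\<bar> * norm (G x))"
    using j by (intro mult_right_mono) auto
  finally show ?thesis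
    by simp
qed

text \<open>The numbers of steps for \<open>s\<close> and for \<open>t\<close> add up to the number for \<open>s + t\<close> up to one step, whose effect vanishes in the
limit.\<close>

lemma semigroup_add:
  assumes s: "0 \<le> s" and t: "0 \<le> t"
  shows "semigroup (s + t) = semigroup s o\<^sub>L semigroup t"
proof (rule blinfun_eq_on_dense[OF dense])
  fix x assume x: "x \<in> D"
  have "(\<lambda>k. euler k s (euler k t x)) \<longlonglongrightarrow> semigroup (s + t) x"
  proof (rule Lim_transform2[OF semigroup_lim], simp add: s t, rule Lim_null_comparison)
    show "\<forall>\<^sub>F k in sequentially. norm (euler k (s + t) x - euler k s (euler k t x))
        \<le> (1/2) ^ k * (\<bar>M\<bar> * norm (G x))"
      using euler_add[OF s t x] by simp
    show "(\<lambda>k. (1/2) ^ k * (\<bar>M\<bar> * norm (G x))) \<longlonglongrightarrow> 0"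
      by (intro tendsto_mult_left_zero LIMSEQ_power_zero) simp
  qed
  moreover have "(\<lambda>k. euler k s (euler k t x)) \<longlonglongrightarrow> semigroup s (semigroup t x)"
  proof (rule Lim_transform2[OF semigroup_lim[OF s]], rule Lim_null_comparison)
    show "\<forall>\<^sub>F k in sequentially. norm (euler k s (semigroup t x) - euler k s (euler k t x))
        \<le> \<bar>M\<bar> * norm (semigroup t x - euler k t x)"
      using euler_Lipschitz by (simp add: dist_norm)
    have "(\<lambda>k. \<bar>M\<bar> * norm (semigroup t x - euler k t x)) \<longlonglongrightarrow> \<bar>M\<bar> * norm (semigroup t x - semigroup t x)"
      by (intro tendsto_intros semigroup_lim t)
    then show "(\<lambda>k. \<bar>M\<bar> * norm (semigroup t x - euler k t x)) \<longlonglongrightarrow> 0"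
      by simp
  qed
  ultimately show "semigroup (s + t) x = (semigroup s o\<^sub>L semigroup t) x"
    using LIMSEQ_unique by auto
qed

lemma semigroup_0: "semigroup 0 = id_blinfun"
  using semigroup_lim[of 0]
  by (intro blinfun_eqI) (simp add: euler_def steps_def LIMSEQ_const_iff)

lemma semigroup_first_order:
  assumes t: "0 \<le> t" and x: "x \<in> D"
  shows "norm (semigroup t x - x) \<le> t * (\<bar>M\<bar> * norm (G x))"
proof (rule LIMSEQ_le_const2)
  show "(\<lambda>k. norm (euler k t x - x)) \<longlonglongrightarrow> norm (semigroup t x - x)"
    by (intro tendsto_intros semigroup_lim t)
  have "norm (euler k t x - x) \<le> (real (steps t k) * (1/2) ^ k) * (\<bar>M\<bar> * norm (G x))" for k
    using E_steps[OF step_size x, of 0 "steps t k" k] by (simp add: euler_def)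
  also have "\<dots> k \<le> t * (\<bar>M\<bar> * norm (G x))" for k
    by (intro mult_right_mono steps_le t) auto
  finally show "\<exists>N. \<forall>k\<ge>N. norm (euler k t x - x) \<le> t * (\<bar>M\<bar> * norm (G x))"
    by blast
qed

lemma semigroup_second_order:
  assumes t: "0 \<le> t" and x: "x \<in> D" "G x \<in> D"
  shows "norm (semigroup t x - x - t *\<^sub>R G x) \<le> t\<^sup>2 * (\<bar>M\<bar> * norm (G (G x)))"
proof (rule LIMSEQ_le)
  let ?t = "\<lambda>k. real (steps t k) * (1/2) ^ k"
  show "(\<lambda>k. norm (euler k t x - x - ?t k *\<^sub>R G x)) \<longlonglongrightarrow> norm (semigroup t x - x - t *\<^sub>R G x)"
    by (intro tendsto_intros semigroup_lim steps_lim t)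
  show "(\<lambda>k. (?t k)\<^sup>2 * (\<bar>M\<bar> * norm (G (G x)))) \<longlonglongrightarrow> t\<^sup>2 * (\<bar>M\<bar> * norm (G (G x)))"
    by (intro tendsto_intros steps_lim t)
  show "\<exists>N. \<forall>k\<ge>N. norm (euler k t x - x - ?t k *\<^sub>R G x) \<le> (?t k)\<^sup>2 * (\<bar>M\<bar> * norm (G (G x)))"
    using E_second_order[OF step_size x] by (simp add: euler_def)
qed

lemma semigroup_continuous_0: "((\<lambda>t. semigroup t x) \<longlongrightarrow> x) (at_right 0)"
proof (rule equi_Lipschitz_tendsto[where M' = 1, OF _ _ dense])
  show "\<forall>\<^sub>F t in at_right 0. \<forall>x y. dist (semigroup t x) (semigroup t y) \<le> \<bar>M\<bar> * dist x y"
    using semigroup_le by (auto simp: eventually_at_right_less dist_norm blinfun.diff_right[symmetric]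
        intro!: eventually_at_rightI[of 0 1])
  fix x assume x: "x \<in> D"
  show "((\<lambda>t. semigroup t x) \<longlongrightarrow> x) (at_right 0)"
  proof (rule LIM_zero_cancel, rule Lim_null_comparison)
    show "\<forall>\<^sub>F t in at_right 0. norm (semigroup t x - x) \<le> t * (\<bar>M\<bar> * norm (G x))"
      using semigroup_first_order x by (intro eventually_at_rightI[of 0 1]) auto
    show "((\<lambda>t. t * (\<bar>M\<bar> * norm (G x))) \<longlongrightarrow> 0) (at_right 0)"
      by (intro tendsto_mult_left_zero tendsto_ident_at)
  qed
qed simp

text \<open>For \<open>x\<close> in the domain of \<open>G\<^sup>2\<close> this is the second order estimate.  Every \<open>x\<close> in \<open>D\<close> is \<open>R 1 y\<close> for some \<open>y\<close>, and in terms
of \<open>y\<close> the difference quotients are uniformly Lipschitz, so that it suffices to take \<open>y\<close> in the dense set \<open>D\<close>, and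
then \<open>R 1 y\<close> is in the domain of \<open>G\<^sup>2\<close>.\<close>

lemma generator:
  assumes x: "x \<in> D"
  shows "((\<lambda>t. (semigroup t x - x) /\<^sub>R t) \<longlongrightarrow> G x) (at_right 0)"
proof -
  have 1: "0 < (1::real)" "(1::real) \<le> 1"
    by auto
  have GR1: "G (R 1 y) = R 1 y - y" for y
    using R_right[OF 1, of y] by (simp add: algebra_simps)
  let ?f = "\<lambda>t y. (semigroup t (R 1 y) - R 1 y) /\<^sub>R t"
  have "((\<lambda>t. ?f t y) \<longlongrightarrow> R 1 y - y) (at_right 0)" for y
  proof (rule equi_Lipschitz_tendsto[where f = ?f and M' = "\<bar>M\<bar> + 1" and M = "\<bar>M\<bar> * (\<bar>M\<bar> + 1)", OF _ _ dense])
    have R1: "norm (R 1 y - y) \<le> (\<bar>M\<bar> + 1) * norm y" for y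
      using R_le[OF order_refl 1, of y] norm_triangle_ineq4[of "R 1 y" y] by (simp add: algebra_simps)
    show "dist (R 1 x - x) (R 1 y - y) \<le> (\<bar>M\<bar> + 1) * dist x y" for x y
      using R1[of "x - y"] by (simp add: dist_norm blinfun.diff_right algebra_simps)
    have "dist (?f t x) (?f t y) \<le> \<bar>M\<bar> * (\<bar>M\<bar> + 1) * dist x y" if "0 < t" for t x y
    proof -
      let ?z = "R 1 (x - y)"
      have "norm (semigroup t ?z - ?z) \<le> t * (\<bar>M\<bar> * norm (G ?z))"
        using that by (intro semigroup_first_order R_D) auto
      also have "\<dots> \<le> t * (\<bar>M\<bar> * ((\<bar>M\<bar> + 1) * norm (x - y)))"
        using R1[of "x - y"] that unfolding GR1 by (intro mult_left_mono) auto
      finally have "norm (semigroup t ?z - ?z) / t \<le> \<bar>M\<bar> * ((\<bar>M\<bar> + 1) * norm (x - y))"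
        using that by (simp add: pos_divide_le_eq mult.commute[of t])
      then have "norm ((semigroup t ?z - ?z) /\<^sub>R t) \<le> \<bar>M\<bar> * ((\<bar>M\<bar> + 1) * norm (x - y))"
        using that by (simp add: divide_inverse mult.commute)
      moreover have "?f t x - ?f t y = (semigroup t ?z - ?z) /\<^sub>R t"
        by (simp add: blinfun.diff_right scaleR_diff_right)
      ultimately show ?thesis
        by (simp add: dist_norm mult.assoc)
    qed
    then show "\<forall>\<^sub>F t in at_right 0. \<forall>x y. dist (?f t x) (?f t y) \<le> \<bar>M\<bar> * (\<bar>M\<bar> + 1) * dist x y"
      by (intro eventually_at_rightI[of 0 1]) auto
    fix y assume y: "y \<in> D"
    let ?x = "R 1 y"
    have x: "?x \<in> D" "G ?x \<in> D"
      using y by (simp_all add: R_D G_R)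
    show "((\<lambda>t. ?f t y) \<longlongrightarrow> R 1 y - y) (at_right 0)"
    proof (rule LIM_zero_cancel, rule Lim_null_comparison)
      have "norm (?f t y - (?x - y)) \<le> t * (\<bar>M\<bar> * norm (G (G ?x)))" if t: "0 < t" for t
      proof -
        have "?f t y - (?x - y) = (semigroup t ?x - ?x - t *\<^sub>R G ?x) /\<^sub>R t"
          using t by (simp add: GR1 scaleR_diff_right)
        then have "norm (?f t y - (?x - y)) = norm (semigroup t ?x - ?x - t *\<^sub>R G ?x) / t"
          using t by (simp add: divide_inverse mult.commute)
        also have "\<dots> \<le> t\<^sup>2 * (\<bar>M\<bar> * norm (G (G ?x))) / t"
          using t by (intro divide_right_mono semigroup_second_order x) auto
        finally show ?thesis
          using t by (simp add: power2_eq_square)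
      qed
      then show "\<forall>\<^sub>F t in at_right 0. norm (?f t y - (R 1 y - y)) \<le> t * (\<bar>M\<bar> * norm (G (G ?x)))"
        by (intro eventually_at_rightI[of 0 1]) auto
      show "((\<lambda>t. t * (\<bar>M\<bar> * norm (G (G ?x)))) \<longlongrightarrow> 0) (at_right 0)"
        by (intro tendsto_mult_left_zero tendsto_ident_at)
    qed
  qed
  from this[of "x - 1 *\<^sub>R G x"] show ?thesis
    unfolding R_left[OF 1 x] by simp
qed

lemma semigroup_R1: 
  assumes t: "0 \<le> t"
  shows "semigroup t (R 1 x) = R 1 (semigroup t x)"
proof -
  have "E h n (R 1 x) = R 1 (E h n x)" if "0 < h" "h \<le> 1" for h n
    by (induction n) (simp_all add: R_commute that)
  then have "euler k t (R 1 x) = R 1 (euler k t x)" for k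
    using step_size by (simp add: euler_def)
  then have "(\<lambda>k. euler k t (R 1 x)) \<longlonglongrightarrow> R 1 (semigroup t x)"
    by (simp add: blinfun.tendsto semigroup_lim t)
  then show ?thesis
    using semigroup_lim[OF t] LIMSEQ_unique by blast
qed

text \<open>It remains to see that the generator has no larger domain than \<open>D\<close>.  If the difference quotients at \<open>x\<close> tend to \<open>y\<close>,
applying \<open>R 1\<close>, which commutes with the semigroup, gives \<open>R 1 y = G (R 1 x) = R 1 x - x\<close>, so \<open>x\<close> is in the range of
\<open>R 1\<close>.\<close>

theorem Hille_Yosida: "generated_by semigroup D G"
proof -
  have "x \<in> D" if y: "((\<lambda>t. (semigroup t x - x) /\<^sub>R t) \<longlongrightarrow> y) (at_right 0)" for x y
  proof -
    have "((\<lambda>t. R 1 ((semigroup t x - x) /\<^sub>R t)) \<longlongrightarrow> R 1 y) (at_right 0)"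
      by (intro blinfun.tendsto tendsto_const y)
    moreover have "\<forall>\<^sub>F t in at_right 0. R 1 ((semigroup t x - x) /\<^sub>R t)
        = (semigroup t (R 1 x) - R 1 x) /\<^sub>R t"
      by (intro eventually_at_rightI[of 0 1])
         (auto simp: semigroup_R1 blinfun.scaleR_right blinfun.diff_right)
    ultimately have "((\<lambda>t. (semigroup t (R 1 x) - R 1 x) /\<^sub>R t) \<longlongrightarrow> R 1 y) (at_right 0)"
      by (rule Lim_transform_eventually)
    then have "R 1 y = G (R 1 x)"
      using generator[of "R 1 x"] by (intro tendsto_unique[OF trivial_limit_at_right_real]) (simp_all add: R_D)
    then have "x = R 1 (x - y)"
      using R_right[of 1 x] by (simp add: blinfun.diff_right algebra_simps)
    then show "x \<in> D"
      by (metis R_D order_refl zero_less_one)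
  qed
  then have "D = {x. \<exists>y. ((\<lambda>t. (semigroup t x - x) /\<^sub>R t) \<longlongrightarrow> y) (at_right 0)}"
    using generator by blast
  then show ?thesis
    using generator semigroup_0 semigroup_add semigroup_continuous_0
    by (auto simp: generated_by_def C0_semigroup_def)
qed

end

lemma generated_by_shift_aux:
  fixes S :: "real \<Rightarrow> 'a::real_normed_vector \<Rightarrow>\<^sub>L 'a"
  assumes "((\<lambda>t. (S t x - x) /\<^sub>R t) \<longlongrightarrow> y) (at_right 0)"
  shows "((\<lambda>t. ((exp (w * t) *\<^sub>R S t) x - x) /\<^sub>R t) \<longlongrightarrow> y + w *\<^sub>R x) (at_right 0)"
proof -
  have "((\<lambda>t. exp (w * t)) has_field_derivative w) (at 0)"
    by (auto intro!: derivative_eq_intros)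
  then have "((\<lambda>t. (exp (w * t) - 1) / t) \<longlongrightarrow> w) (at_right 0)"
    by (auto simp: has_field_derivative_iff intro: tendsto_within_subset)
  moreover have "((\<lambda>t::real. exp (w * t)) \<longlongrightarrow> exp (w * 0)) (at_right 0)"
    by (intro tendsto_intros)
  ultimately have "((\<lambda>t. exp (w * t) *\<^sub>R ((S t x - x) /\<^sub>R t) + ((exp (w * t) - 1) / t) *\<^sub>R x)
      \<longlongrightarrow> exp (w * 0) *\<^sub>R y + w *\<^sub>R x) (at_right 0)"
    by (intro tendsto_intros assms)
  then show ?thesis
    by (simp add: blinfun.scaleR_left algebra_simps divide_inverse)
qed

text \<open>Reduces generators that are dissipative up to a multiple of the identity to stable ones.\<close>

lemma generated_by_shift:
  fixes S :: "real \<Rightarrow> 'a::real_normed_vector \<Rightarrow>\<^sub>L 'a"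
  assumes "generated_by S D G"
  shows "generated_by (\<lambda>t. exp (w * t) *\<^sub>R S t) D (\<lambda>x. G x + w *\<^sub>R x)"
proof -
  let ?S = "\<lambda>t. exp (w * t) *\<^sub>R S t"
  have S0: "S 0 = id_blinfun" and S_add: "\<And>s t. 0 \<le> s \<Longrightarrow> 0 \<le> t \<Longrightarrow> S (s + t) = S s o\<^sub>L S t"
    and S_lim: "\<And>x. ((\<lambda>t. S t x) \<longlongrightarrow> x) (at_right 0)"
    and D: "D = {x. \<exists>y. ((\<lambda>t. (S t x - x) /\<^sub>R t) \<longlongrightarrow> y) (at_right 0)}"
    and G: "\<And>x. x \<in> D \<Longrightarrow> ((\<lambda>t. (S t x - x) /\<^sub>R t) \<longlongrightarrow> G x) (at_right 0)"
    using assms by (auto simp: generated_by_def C0_semigroup_def)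
  have S_lim': "((\<lambda>t. ?S t x) \<longlongrightarrow> x) (at_right 0)" for x
  proof -
    have "((\<lambda>t. exp (w * t) *\<^sub>R S t x) \<longlongrightarrow> exp (w * 0) *\<^sub>R x) (at_right 0)"
      by (intro tendsto_intros S_lim)
    then show ?thesis
      by (simp add: blinfun.scaleR_left)
  qed
  have S_add': "?S (s + t) = ?S s o\<^sub>L ?S t" if "0 \<le> s" "0 \<le> t" for s t
    by (rule blinfun_eqI)
       (simp add: S_add that blinfun.scaleR_left blinfun.scaleR_right exp_add distrib_left)
  have "x \<in> D" if "((\<lambda>t. (?S t x - x) /\<^sub>R t) \<longlongrightarrow> y) (at_right 0)" for x y
  proof -
    have "exp (- w * t) *\<^sub>R ?S t = S t" for t
      by (simp add: exp_minus)
    then show ?thesis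
      using generated_by_shift_aux[OF that, of "- w"] by (auto simp: D)
  qed
  moreover have "\<exists>y. ((\<lambda>t. (?S t x - x) /\<^sub>R t) \<longlongrightarrow> y) (at_right 0)" if "x \<in> D" for x
    using generated_by_shift_aux[OF G[OF that]] by blast
  ultimately have "D = {x. \<exists>y. ((\<lambda>t. (?S t x - x) /\<^sub>R t) \<longlongrightarrow> y) (at_right 0)}"
    by blast
  then show ?thesis
    using generated_by_shift_aux[OF G] S0 S_lim' S_add'
    unfolding generated_by_def C0_semigroup_def by auto
qed

section \<open>Orbits of strongly continuous semigroups\<close>

lemma has_vector_derivative_iff_quotient:
  "(f has_vector_derivative y) (at t within X) \<longleftrightarrow> ((\<lambda>s. (f s - f t) /\<^sub>R (s - t)) \<longlongrightarrow> y) (at t within X)"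
proof -
  have eq: "norm (((f s - f t) - (s - t) *\<^sub>R y) /\<^sub>R norm (s - t)) = norm ((f s - f t) /\<^sub>R (s - t) - y)"
    if "s \<noteq> t" for s
  proof -
    have "(f s - f t) /\<^sub>R (s - t) - y = ((f s - f t) - (s - t) *\<^sub>R y) /\<^sub>R (s - t)"
      using that by (simp add: scaleR_diff_right)
    then show ?thesis
      by simp
  qed
  have "(f has_vector_derivative y) (at t within X) \<longleftrightarrow>
      ((\<lambda>s. norm (((f s - f t) - (s - t) *\<^sub>R y) /\<^sub>R norm (s - t))) \<longlongrightarrow> 0) (at t within X)"
    unfolding has_vector_derivative_def has_derivative_within tendsto_norm_zero_iff
    by (simp add: bounded_linear_scaleR_left diff_diff_eq divide_inverse)
  also have "\<dots> \<longleftrightarrow> ((\<lambda>s. norm ((f s - f t) /\<^sub>R (s - t) - y)) \<longlongrightarrow> 0) (at t within X)"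
    by (intro filterlim_cong refl, unfold eventually_at_filter)
       (intro always_eventually allI impI eq)
  also have "\<dots> \<longleftrightarrow> ((\<lambda>s. (f s - f t) /\<^sub>R (s - t)) \<longlongrightarrow> y) (at t within X)"
    by (simp only: tendsto_norm_zero_iff LIM_zero_iff)
  finally show ?thesis .
qed

text \<open>The principle of uniform boundedness for a family that converges strongly as \<open>t\<close> decreases to \<open>0\<close>.  The sets \<open>F k\<close> of
points whose orbits are bounded by \<open>k + 1\<close> up to the time \<open>1 / (k + 1)\<close> are closed and cover the space, so by Baire's
theorem one of them contains a ball.\<close>

lemma uniform_boundedness_at_0:
  fixes S :: "real \<Rightarrow> 'a::banach \<Rightarrow>\<^sub>L 'b::real_normed_vector"
  assumes lim: "\<And>x. ((\<lambda>t. S t x) \<longlongrightarrow> g x) (at_right 0)"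
  obtains d M where "0 < d" "\<And>t. 0 < t \<Longrightarrow> t \<le> d \<Longrightarrow> norm (S t) \<le> M"
proof -
  define F where "F k = {x. \<forall>t\<in>{0<..inverse (real (Suc k))}. norm (S t x) \<le> real (Suc k)}" for k
  have F_closed: "closed (F k)" for k
  proof -
    have "F k = (\<Inter>t\<in>{0<..inverse (real (Suc k))}. {x. norm (S t x) \<le> real (Suc k)})"
      by (auto simp: F_def)
    moreover have "closed {x. norm (S t x) \<le> real (Suc k)}" for t
      by (intro closed_Collect_le continuous_intros)
    ultimately show ?thesis
      by (simp only:) (intro closed_INT ballI)
  qed
  have "x \<in> (\<Union>k. F k)" for x
  proof -
    have "((\<lambda>t. norm (S t x)) \<longlongrightarrow> norm (g x)) (at_right 0)"
      by (intro tendsto_norm lim)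
    then have "\<forall>\<^sub>F t in at_right 0. norm (S t x) < norm (g x) + 1"
      by (rule order_tendstoD) simp
    then obtain b where b: "0 < b" "\<And>t. 0 < t \<Longrightarrow> t < b \<Longrightarrow> norm (S t x) < norm (g x) + 1"
      by (auto simp: eventually_at_right_field)
    obtain k1 where k1: "inverse (real (Suc k1)) < b"
      using reals_Archimedean[OF b(1)] by blast
    obtain k2 where k2: "norm (g x) + 1 < real k2"
      using reals_Archimedean2 by blast
    let ?k = "max k1 k2"
    have "inverse (real (Suc ?k)) \<le> inverse (real (Suc k1))"
      by (intro le_imp_inverse_le) auto
    have "norm (S t x) \<le> real (Suc ?k)" if "0 < t" "t \<le> inverse (real (Suc ?k))" for t
    proof -
      have "norm (S t x) < norm (g x) + 1"
        using that k1 \<open>inverse (real (Suc ?k)) \<le> inverse (real (Suc k1))\<close> by (intro b(2)) linarith+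
      also have "\<dots> < real (Suc ?k)"
        using k2 by simp
      finally show ?thesis
        by simp
    qed
    then have "x \<in> F ?k"
      by (simp add: F_def)
    then show ?thesis
      by blast
  qed
  then have UN: "(\<Union>k. F k) = UNIV"
    by blast
  have "\<exists>k. interior (F k) \<noteq> {}"
  proof (rule ccontr)
    assume "\<not> ?thesis"
    then have "euclidean interior_of \<Union>(range F) = {}"
      by (intro Baire_category_alt) (use completely_metrizable_space_euclidean F_closed in auto)
    then show False
      using UN by simp
  qed
  then obtain k x where "x \<in> interior (F k)"
    by blast
  then obtain r where r: "0 < r" "ball x r \<subseteq> F k"
    using open_contains_ball[of "interior (F k)"] interior_subset by (meson open_interior subset_trans)
  define C where "C = 2 * real (Suc k)"
  have "norm (S t) \<le> 2 * C / r" if t: "0 < t" "t \<le> inverse (real (Suc k))" for t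
  proof (rule norm_blinfun_bound)
    fix y
    show "norm (S t y) \<le> 2 * C / r * norm y"
    proof (cases "y = 0")
      case False
      define s where "s = r / (2 * norm y)"
      have s: "0 < s"
        using False r by (simp add: s_def)
      have "x \<in> F k" "x + s *\<^sub>R y \<in> F k"
        using r False s by (auto simp: subset_iff dist_norm s_def)
      then have "norm (S t x) \<le> real (Suc k)" "norm (S t (x + s *\<^sub>R y)) \<le> real (Suc k)"
        using t by (auto simp: F_def)
      then have "norm (S t (x + s *\<^sub>R y) - S t x) \<le> C"
        using norm_triangle_ineq4[of "S t (x + s *\<^sub>R y)" "S t x"] by (simp add: C_def)
      then have "s * norm (S t y) \<le> C"
        using s by (simp add: blinfun.add_right blinfun.scaleR_right)
      then show ?thesis
        using r False by (simp add: s_def field_simps)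
    qed simp
  qed (use r in \<open>auto simp: C_def\<close>)
  then show thesis
    by (rule that[of "inverse (real (Suc k))" "2 * C / r", rotated]) auto
qed

lemma C0_semigroup_bounded:
  fixes S :: "real \<Rightarrow> 'a::banach \<Rightarrow>\<^sub>L 'a"
  assumes S: "C0_semigroup S"
  obtains M where "0 \<le> M" "\<And>t. 0 \<le> t \<Longrightarrow> t \<le> T \<Longrightarrow> norm (S t) \<le> M"
proof -
  have S0: "S 0 = id_blinfun" and S_add: "\<And>s t. 0 \<le> s \<Longrightarrow> 0 \<le> t \<Longrightarrow> S (s + t) = S s o\<^sub>L S t"
    and S_lim: "\<And>x. ((\<lambda>t. S t x) \<longlongrightarrow> x) (at_right 0)"
    using S by (auto simp: C0_semigroup_def)
  obtain d M where d: "0 < d" "\<And>t. 0 < t \<Longrightarrow> t \<le> d \<Longrightarrow> norm (S t) \<le> M"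
    using uniform_boundedness_at_0[OF S_lim] by blast
  define C where "C = max 1 M"
  have C: "norm (S t) \<le> C" if "0 \<le> t" "t \<le> d" for t
    using d(2)[of t] that norm_blinfun_id_le[where 'a='a] S0 by (cases "t = 0") (auto simp: C_def)
  have "\<forall>t. 0 \<le> t \<longrightarrow> t \<le> real (Suc n) * d \<longrightarrow> norm (S t) \<le> C ^ Suc n" for n
  proof (induction n)
    case (Suc n)
    show ?case
    proof (intro allI impI)
      fix t assume t: "0 \<le> t" "t \<le> real (Suc (Suc n)) * d"
      show "norm (S t) \<le> C ^ Suc (Suc n)"
      proof (cases "t \<le> d")
        case True
        then have "norm (S t) \<le> C ^ 1"
          using C t by simp
        also have "\<dots> \<le> C ^ Suc (Suc n)"
          by (intro power_increasing) (auto simp: C_def)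
        finally show ?thesis .
      next
        case False
        then have "S t = S d o\<^sub>L S (t - d)"
          using S_add[of d "t - d"] d by simp
        also have "norm \<dots> \<le> norm (S d) * norm (S (t - d))"
          by (rule norm_blinfun_compose)
        also have "\<dots> \<le> C * C ^ Suc n"
          using C[of d] d Suc.IH False t by (intro mult_mono) (auto simp: C_def algebra_simps)
        finally show ?thesis
          by simp
      qed
    qed
  qed (use C in auto)
  note bound = this
  obtain n where "T / d < real n"
    using reals_Archimedean2 by blast
  then have "T \<le> real (Suc n) * d"
    using d by (simp add: field_simps) 
  then show thesis
    using that[of "C ^ Suc n"] bound[of n] by (auto simp: C_def)
qed

text \<open>Joint continuity of \<open>(t, x) \<mapsto> S t x\<close>, in the form in which it is used for difference quotients.\<close>

lemma C0_semigroup_tendsto: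
  fixes S :: "real \<Rightarrow> 'a::banach \<Rightarrow>\<^sub>L 'a"
  assumes S: "C0_semigroup S"
    and a: "(a \<longlongrightarrow> a0) F" "\<forall>\<^sub>F t in F. 0 \<le> a t" "0 \<le> a0"
    and b: "(b \<longlongrightarrow> b0) F"
  shows "((\<lambda>t. S (a t) (b t)) \<longlongrightarrow> S a0 b0) F"
proof -
  have S0: "S 0 = id_blinfun" and S_add: "\<And>s t. 0 \<le> s \<Longrightarrow> 0 \<le> t \<Longrightarrow> S (s + t) = S s o\<^sub>L S t"
    and S_lim: "((\<lambda>t. S t b0) \<longlongrightarrow> b0) (at_right 0)"
    using S by (auto simp: C0_semigroup_def)
  obtain M where M: "0 \<le> M" "\<And>t. 0 \<le> t \<Longrightarrow> t \<le> a0 + 1 \<Longrightarrow> norm (S t) \<le> M"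
    using C0_semigroup_bounded[OF S, of "a0 + 1"] by blast
  have M': "norm (S t x) \<le> M * norm x" if "0 \<le> t" "t \<le> a0 + 1" for t x
    using M(2)[OF that] norm_blinfun[of "S t" x] mult_right_mono[of "norm (S t)" M "norm x"] by simp
  have near: "((\<lambda>t. S \<bar>a t - a0\<bar> b0) \<longlongrightarrow> b0) F"
  proof (rule tendstoI)
    fix e :: real assume e: "0 < e"
    obtain d where d: "0 < d" "\<And>t. 0 < t \<Longrightarrow> t < d \<Longrightarrow> dist (S t b0) b0 < e"
      using tendstoD[OF S_lim e] by (auto simp: eventually_at_right_field)
    have "\<forall>\<^sub>F t in F. dist (a t) a0 < d"
      by (rule tendstoD[OF a(1) d(1)])
    then show "\<forall>\<^sub>F t in F. dist (S \<bar>a t - a0\<bar> b0) b0 < e"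
    proof eventually_elim
      case (elim t)
      then show ?case
        using d(2)[of "\<bar>a t - a0\<bar>"] e S0 by (cases "a t = a0") (auto simp: dist_real_def)
    qed
  qed
  have le: "norm (S s b0 - S a0 b0) \<le> M * norm (S \<bar>s - a0\<bar> b0 - b0)" if s: "0 \<le> s" "s \<le> a0 + 1" for s
  proof (cases "a0 \<le> s")
    case True
    then have "S s b0 - S a0 b0 = S a0 (S \<bar>s - a0\<bar> b0 - b0)"
      using S_add[of a0 "s - a0"] a(3) by (simp add: blinfun.diff_right)
    then show ?thesis
      using M' a(3) by simp
  next
    case False
    then have "S a0 b0 - S s b0 = S s (S \<bar>s - a0\<bar> b0 - b0)"
      using S_add[of s "a0 - s"] s by (simp add: blinfun.diff_right)
    then show ?thesis
      using M'[OF s] by (metis norm_minus_commute)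
  qed
  show ?thesis
  proof (rule LIM_zero_cancel, rule Lim_null_comparison)
    have "\<forall>\<^sub>F t in F. a t < a0 + 1"
      by (rule order_tendstoD[OF a(1)]) simp
    with a(2) show "\<forall>\<^sub>F t in F. norm (S (a t) (b t) - S a0 b0)
        \<le> M * norm (b t - b0) + M * norm (S \<bar>a t - a0\<bar> b0 - b0)"
    proof eventually_elim
      case (elim t)
      have "S (a t) (b t) - S a0 b0 = S (a t) (b t - b0) + (S (a t) b0 - S a0 b0)"
        by (simp add: blinfun.diff_right)
      also have "norm \<dots> \<le> M * norm (b t - b0) + M * norm (S \<bar>a t - a0\<bar> b0 - b0)"
        using elim by (intro norm_triangle_mono M' le) auto
      finally show ?case .
    qed
    have "((\<lambda>t. M * norm (b t - b0) + M * norm (S \<bar>a t - a0\<bar> b0 - b0))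
        \<longlongrightarrow> M * norm (b0 - b0) + M * norm (b0 - b0)) F"
      by (intro tendsto_intros near b)
    then show "((\<lambda>t. M * norm (b t - b0) + M * norm (S \<bar>a t - a0\<bar> b0 - b0)) \<longlongrightarrow> 0) F"
      by simp
  qed
qed

lemma C0_semigroup_continuous_on:
  fixes S :: "real \<Rightarrow> 'a::banach \<Rightarrow>\<^sub>L 'a"
  assumes "C0_semigroup S" "continuous_on X a" "\<And>x. x \<in> X \<Longrightarrow> 0 \<le> a x" "continuous_on X b"
  shows "continuous_on X (\<lambda>x. S (a x) (b x))"
  unfolding continuous_on_def
proof
  fix x assume "x \<in> X"
  then show "((\<lambda>x. S (a x) (b x)) \<longlongrightarrow> S (a x) (b x)) (at x within X)"
    using assms by (intro C0_semigroup_tendsto) (auto simp: continuous_on_def eventually_at_filter)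
qed

lemma generated_by_limit_iff:
  fixes S :: "real \<Rightarrow> 'a::real_normed_vector \<Rightarrow>\<^sub>L 'a"
  assumes "generated_by S D G"
  shows "((\<lambda>t. (S t x - x) /\<^sub>R t) \<longlongrightarrow> y) (at_right 0) \<longleftrightarrow> x \<in> D \<and> G x = y"
  using assms tendsto_unique[OF trivial_limit_at_right_real]
  unfolding generated_by_def by blast

text \<open>The difference quotient between \<open>s\<close> and \<open>t\<close> is \<open>S (min s t)\<close> applied to the quotient between \<open>0\<close> and \<open>\<bar>s - t\<bar>\<close>, which
tends to \<open>G x\<close>; by joint continuity one argument covers both one-sided derivatives.\<close>

lemma generated_by_orbit:
  fixes S :: "real \<Rightarrow> 'a::banach \<Rightarrow>\<^sub>L 'a"
  assumes gen: "generated_by S D G" and x: "x \<in> D" and t: "0 \<le> t"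
  shows "S t x \<in> D" "G (S t x) = S t (G x)"
    and "((\<lambda>t. S t x) has_vector_derivative S t (G x)) (at t within {0..})"
proof -
  have S: "C0_semigroup S" and S_add: "\<And>s t. 0 \<le> s \<Longrightarrow> 0 \<le> t \<Longrightarrow> S (s + t) = S s o\<^sub>L S t"
    using gen by (auto simp: generated_by_def C0_semigroup_def)
  have lim: "((\<lambda>h. (S h x - x) /\<^sub>R h) \<longlongrightarrow> G x) (at_right 0)"
    using generated_by_limit_iff[OF gen] x by blast
  have "((\<lambda>h. S t ((S h x - x) /\<^sub>R h)) \<longlongrightarrow> S t (G x)) (at_right 0)"
    by (intro blinfun.tendsto tendsto_const lim)
  moreover have "\<forall>\<^sub>F h in at_right 0. S t ((S h x - x) /\<^sub>R h) = (S h (S t x) - S t x) /\<^sub>R h"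
  proof (rule eventually_at_rightI[of 0 1])
    fix h :: real assume "h \<in> {0<..<1}"
    then have "S t (S h x) = S h (S t x)"
      using S_add[of t h] S_add[of h t] t by (metis add.commute blinfun_apply_blinfun_compose
          greaterThanLessThan_iff less_imp_le)
    then show "S t ((S h x - x) /\<^sub>R h) = (S h (S t x) - S t x) /\<^sub>R h"
      by (simp add: blinfun.scaleR_right blinfun.diff_right)
  qed simp
  ultimately have "((\<lambda>h. (S h (S t x) - S t x) /\<^sub>R h) \<longlongrightarrow> S t (G x)) (at_right 0)"
    by (rule Lim_transform_eventually)
  then show "S t x \<in> D" "G (S t x) = S t (G x)"
    using generated_by_limit_iff[OF gen] by blast+
  let ?F = "at t within {0..}"
  have "((\<lambda>s. \<bar>s - t\<bar>) \<longlongrightarrow> \<bar>t - t\<bar>) ?F"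
    by (intro tendsto_intros)
  then have "filterlim (\<lambda>s. \<bar>s - t\<bar>) (at_right 0) ?F"
    unfolding filterlim_at by (auto simp: eventually_at_filter)
  then have "((\<lambda>s. (S \<bar>s - t\<bar> x - x) /\<^sub>R \<bar>s - t\<bar>) \<longlongrightarrow> G x) ?F"
    by (rule filterlim_compose[OF lim])
  moreover have "((\<lambda>s. min s t) \<longlongrightarrow> min t t) ?F"
    by (intro tendsto_intros)
  ultimately have "((\<lambda>s. S (min s t) ((S \<bar>s - t\<bar> x - x) /\<^sub>R \<bar>s - t\<bar>)) \<longlongrightarrow> S t (G x)) ?F"
    using t by (intro C0_semigroup_tendsto[OF S]) (auto simp: eventually_at_filter)
  moreover have "\<forall>\<^sub>F s in ?F. S (min s t) ((S \<bar>s - t\<bar> x - x) /\<^sub>R \<bar>s - t\<bar>) = (S s x - S t x) /\<^sub>R (s - t)"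
    unfolding eventually_at_filter
  proof (intro always_eventually allI impI)
    fix s assume s: "s \<noteq> t" "s \<in> {0..}"
    show "S (min s t) ((S \<bar>s - t\<bar> x - x) /\<^sub>R \<bar>s - t\<bar>) = (S s x - S t x) /\<^sub>R (s - t)"
    proof (cases "s < t")
      case True
      then have "S (min s t) ((S \<bar>s - t\<bar> x - x) /\<^sub>R \<bar>s - t\<bar>) = (S t x - S s x) /\<^sub>R (t - s)"
        using S_add[of s "t - s"] s by (simp add: blinfun.scaleR_right blinfun.diff_right)
      also have "\<dots> = (- (S t x - S s x)) /\<^sub>R (- (t - s))"
        by (simp only: inverse_minus_eq scaleR_minus_left scaleR_minus_right minus_minus)
      finally show ?thesis
        by simp
    next
      case False
      then show ?thesis
        using S_add[of t "s - t"] t by (simp add: blinfun.scaleR_right blinfun.diff_right)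
    qed
  qed
  ultimately have "((\<lambda>s. (S s x - S t x) /\<^sub>R (s - t)) \<longlongrightarrow> S t (G x)) ?F"
    by (rule Lim_transform_eventually)
  then show "((\<lambda>t. S t x) has_vector_derivative S t (G x)) ?F"
    by (simp add: has_vector_derivative_iff_quotient)
qed

section \<open>Duhamel's formula\<close>

text \<open>The function \<open>s \<mapsto> S (t - s) (w s)\<close> has the derivative \<open>S (t - s) (v s - G (w s)) = S (t - s) (p s)\<close>.  This gives
uniqueness: a classical solution with zero initial value is given by Duhamel's formula.\<close>

lemma classical_solution_Duhamel:
  fixes S :: "real \<Rightarrow> 'a::banach \<Rightarrow>\<^sub>L 'a"
  assumes gen: "generated_by S D G" and t: "0 \<le> t" and w0: "w 0 = 0"
    and w: "\<And>s. s \<in> {0..t} \<Longrightarrow> (w has_vector_derivative v s) (at s within {0..t})"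
    and D: "\<And>s. s \<in> {0..t} \<Longrightarrow> w s \<in> D"
    and eq: "\<And>s. s \<in> {0..t} \<Longrightarrow> v s = G (w s) + p s"
  shows "((\<lambda>s. S (t - s) (p s)) has_integral w t) {0..t}"
proof -
  have S: "C0_semigroup S" and S0: "S 0 = id_blinfun"
    using gen by (auto simp: generated_by_def C0_semigroup_def)
  have "((\<lambda>s. S (t - s) (p s)) has_integral (S (t - t) (w t) - S (t - 0) (w 0))) {0..t}"
  proof (rule fundamental_theorem_of_calculus[OF t])
    fix s assume s: "s \<in> {0..t}"
    let ?F = "at s within {0..t}"
    have "((\<lambda>r. S (t - r) ((w r - w s) /\<^sub>R (r - s))) \<longlongrightarrow> S (t - s) (v s)) ?F"
    proof (rule C0_semigroup_tendsto[OF S])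
      show "((\<lambda>r. (w r - w s) /\<^sub>R (r - s)) \<longlongrightarrow> v s) ?F"
        using w[OF s] by (simp add: has_vector_derivative_iff_quotient)
      show "((\<lambda>r. t - r) \<longlongrightarrow> t - s) ?F"
        by (intro tendsto_intros)
    qed (use s in \<open>auto simp: eventually_at_filter\<close>)
    moreover have "((\<lambda>r. (S (t - r) (w s) - S (t - s) (w s)) /\<^sub>R (r - s)) \<longlongrightarrow> - S (t - s) (G (w s))) ?F"
    proof -
      have "((\<lambda>r. t - r) has_vector_derivative - 1) ?F"
        by (auto intro!: derivative_eq_intros)
      moreover have "((\<lambda>r. S r (w s)) has_vector_derivative S (t - s) (G (w s)))
          (at (t - s) within (\<lambda>r. t - r) ` {0..t})"
        by (rule has_vector_derivative_within_subset[OF generated_by_orbit(3)[OF gen D[OF s]]])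
           (use s in auto)
      ultimately have "(((\<lambda>r. S r (w s)) \<circ> (\<lambda>r. t - r)) has_vector_derivative
          - 1 *\<^sub>R S (t - s) (G (w s))) ?F"
        by (rule vector_diff_chain_within)
      then show ?thesis
        by (simp add: has_vector_derivative_iff_quotient o_def)
    qed
    ultimately have "((\<lambda>r. S (t - r) ((w r - w s) /\<^sub>R (r - s))
        + (S (t - r) (w s) - S (t - s) (w s)) /\<^sub>R (r - s)) \<longlongrightarrow> S (t - s) (v s) + - S (t - s) (G (w s))) ?F"
      by (rule tendsto_add)
    also have "S (t - s) (v s) + - S (t - s) (G (w s)) = S (t - s) (p s)"
      by (simp add: eq[OF s] blinfun.add_right)
    finally show "((\<lambda>r. S (t - r) (w r)) has_vector_derivative S (t - s) (p s)) ?F"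
      by (simp add: has_vector_derivative_iff_quotient blinfun.diff_right blinfun.scaleR_right
          scaleR_add_right[symmetric] scaleR_diff_right)
  qed
  then show ?thesis
    by (simp add: w0 S0)
qed

definition Duhamel :: "(real \<Rightarrow> 'a::banach \<Rightarrow>\<^sub>L 'a) \<Rightarrow> (real \<Rightarrow> 'a) \<Rightarrow> real \<Rightarrow> 'a" where
  "Duhamel S p t = integral {0..t} (\<lambda>s. S (t - s) (p s))"

context
  fixes S :: "real \<Rightarrow> 'a::banach \<Rightarrow>\<^sub>L 'a" and p :: "real \<Rightarrow> 'a"
  assumes S: "C0_semigroup S" and p: "continuous_on {0..} p"
begin

lemma Duhamel_integrand_continuous:
  "0 \<le> a \<Longrightarrow> b \<le> t \<Longrightarrow> continuous_on {a..b} (\<lambda>s. S (t - s) (p s))"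
  by (intro C0_semigroup_continuous_on[OF S] continuous_intros continuous_on_subset[OF p]) auto

text \<open>To have a fixed interval of integration, the integrand is continued to \<open>s > t\<close> as \<open>S 0 (p s) = p s\<close>, and the integral
over this part is subtracted again.\<close>

lemma continuous_on_Duhamel: "continuous_on {0..T} (Duhamel S p)"
proof -
  have "continuous_on {0..T} (\<lambda>t. integral (cbox 0 T) (\<lambda>s. S (max 0 (t - s)) (p s)))"
  proof (rule integral_continuous_on_param)
    show "continuous_on ({0..T} \<times> cbox 0 T) (\<lambda>(t, s). S (max 0 (t - s)) (p s))"
      unfolding split_beta
      by (intro C0_semigroup_continuous_on[OF S] continuous_intros continuous_on_compose2[OF p]) auto
  qed
  moreover have "continuous_on {0..T} (\<lambda>t. integral {t..T} p)"
    by (intro indefinite_integral_continuous_1' integrable_continuous_real continuous_on_subset[OF p]) auto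
  ultimately have "continuous_on {0..T} (\<lambda>t. integral {0..T} (\<lambda>s. S (max 0 (t - s)) (p s)) - integral {t..T} p)"
    by (simp add: continuous_on_diff)
  moreover have "integral {0..T} (\<lambda>s. S (max 0 (t - s)) (p s)) - integral {t..T} p = Duhamel S p t"
    if t: "t \<in> {0..T}" for t
  proof -
    have cont: "continuous_on {0..T} (\<lambda>s. S (max 0 (t - s)) (p s))"
      by (intro C0_semigroup_continuous_on[OF S] continuous_intros continuous_on_subset[OF p]) auto
    have "integral {0..T} (\<lambda>s. S (max 0 (t - s)) (p s))
        = integral {0..t} (\<lambda>s. S (max 0 (t - s)) (p s)) + integral {t..T} (\<lambda>s. S (max 0 (t - s)) (p s))"
      using t by (intro Henstock_Kurzweil_Integration.integral_combine[symmetric] integrable_continuous_real cont) auto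
    also have "integral {0..t} (\<lambda>s. S (max 0 (t - s)) (p s)) = Duhamel S p t"
      unfolding Duhamel_def by (intro integral_cong) auto
    also have "integral {t..T} (\<lambda>s. S (max 0 (t - s)) (p s)) = integral {t..T} p"
      using S by (intro integral_cong) (auto simp: C0_semigroup_def)
    finally show ?thesis
      by simp
  qed
  ultimately show ?thesis
    by (rule continuous_on_eq)
qed

lemma Duhamel_0: "Duhamel S p 0 = 0"
  by (simp add: Duhamel_def)

lemma Duhamel_shift:
  assumes "0 \<le> t" "0 \<le> h"
  shows "S h (Duhamel S p t) = Duhamel S p (t + h) - integral {t..t + h} (\<lambda>s. S (t + h - s) (p s))"
proof -
  have S_add: "\<And>s t. 0 \<le> s \<Longrightarrow> 0 \<le> t \<Longrightarrow> S (s + t) = S s o\<^sub>L S t"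
    using S by (auto simp: C0_semigroup_def)
  have "S h (Duhamel S p t) = integral {0..t} (\<lambda>s. S h (S (t - s) (p s)))"
    unfolding Duhamel_def
    using integral_linear[OF integrable_continuous_real[OF Duhamel_integrand_continuous[of 0 t t]]
        blinfun.bounded_linear_right[of "S h"]] by (simp add: o_def)
  also have "\<dots> = integral {0..t} (\<lambda>s. S (t + h - s) (p s))"
  proof (rule integral_cong)
    fix s assume "s \<in> {0..t}"
    then have "S (h + (t - s)) = S h o\<^sub>L S (t - s)"
      using assms by (intro S_add) auto
    then show "S h (S (t - s) (p s)) = S (t + h - s) (p s)"
      by (simp add: algebra_simps)
  qed
  also have "\<dots> + integral {t..t + h} (\<lambda>s. S (t + h - s) (p s)) = Duhamel S p (t + h)"
    unfolding Duhamel_def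
    using assms by (intro Henstock_Kurzweil_Integration.integral_combine integrable_continuous_real Duhamel_integrand_continuous) auto
  ultimately show ?thesis
    by (simp add: algebra_simps)
qed

text \<open>On a compact rectangle \<open>(r, s) \<mapsto> S r (p s)\<close> is uniformly continuous, so near \<open>(0, \<tau>)\<close> it is close to \<open>p \<tau>\<close> at the
same scale for all \<open>\<tau>\<close>.\<close>

lemma Duhamel_short_time:
  assumes t: "0 \<le> t" and e: "0 < e"
  obtains d where "0 < d" "\<And>h \<tau>. 0 < h \<Longrightarrow> h < d \<Longrightarrow> \<tau> \<in> {0..t} \<Longrightarrow>
    norm (integral {\<tau>..\<tau> + h} (\<lambda>s. S (\<tau> + h - s) (p s)) - h *\<^sub>R p \<tau>) \<le> e * h"
proof -
  have "continuous_on ({0..1} \<times> {0..t + 1}) (\<lambda>x. S (fst x) (p (snd x)))"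
    by (intro C0_semigroup_continuous_on[OF S] continuous_intros continuous_on_compose2[OF p]) auto
  then have "uniformly_continuous_on ({0..1} \<times> {0..t + 1}) (\<lambda>x. S (fst x) (p (snd x)))"
    by (rule compact_uniformly_continuous) (intro compact_Times compact_Icc)
  then obtain d where d: "0 < d" and unif: "\<And>x y. x \<in> {0..1} \<times> {0..t + 1} \<Longrightarrow> y \<in> {0..1} \<times> {0..t + 1}
      \<Longrightarrow> dist y x < d \<Longrightarrow> dist (S (fst y) (p (snd y))) (S (fst x) (p (snd x))) < e"
    using e unfolding uniformly_continuous_on_def by metis
  show thesis
  proof (rule that[of "min 1 (d / 2)"])
    show "0 < min 1 (d / 2)"
      using d by simp
    fix h \<tau> assume h: "0 < h" "h < min 1 (d / 2)" and \<tau>: "\<tau> \<in> {0..t}"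
    have cont: "continuous_on {\<tau>..\<tau> + h} (\<lambda>s. S (\<tau> + h - s) (p s))"
      using \<tau> by (intro Duhamel_integrand_continuous) auto
    have "integral {\<tau>..\<tau> + h} (\<lambda>s. S (\<tau> + h - s) (p s)) - h *\<^sub>R p \<tau>
        = integral {\<tau>..\<tau> + h} (\<lambda>s. S (\<tau> + h - s) (p s) - p \<tau>)"
      using h by (subst integral_diff) (auto intro!: integrable_continuous_real cont)
    also have "norm \<dots> \<le> e * (\<tau> + h - \<tau>)"
    proof (rule integral_bound)
      fix s assume s: "s \<in> {\<tau>..\<tau> + h}"
      have "dist (\<tau> + h - s, s) (0, \<tau>) \<le> \<bar>\<tau> + h - s\<bar> + \<bar>s - \<tau>\<bar>"
        unfolding dist_prod_def by (rule order_trans[OF sqrt_sum_squares_le_sum_abs]) (simp add: dist_real_def)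
      also have "\<dots> < d"
        using s h by auto
      finally have "dist (S (\<tau> + h - s) (p s)) (S 0 (p \<tau>)) < e"
        using unif[of "(0, \<tau>)" "(\<tau> + h - s, s)"] s h \<tau> by auto
      then show "norm (S (\<tau> + h - s) (p s) - p \<tau>) \<le> e"
        using S by (simp add: C0_semigroup_def dist_norm)
    qed (use h in \<open>auto intro!: continuous_intros cont\<close>)
    finally show "norm (integral {\<tau>..\<tau> + h} (\<lambda>s. S (\<tau> + h - s) (p s)) - h *\<^sub>R p \<tau>) \<le> e * h"
      by simp
  qed
qed

text \<open>The converse direction, valid for merely continuous \<open>p\<close>: the primitive \<open>w\<close> of a mild solution \<open>v\<close> is a classical
solution for the inhomogeneity \<open>integral p\<close>.  By the semigroup law \<open>S h (v \<tau>)\<close> is \<open>v (\<tau> + h)\<close> minus the contribution of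
\<open>{\<tau>..\<tau> + h}\<close>.  Integration over \<open>\<tau>\<close> expresses the difference quotient of \<open>h \<mapsto> S h (w t)\<close> at \<open>0\<close> by averages of \<open>v\<close> near
\<open>t\<close> and near \<open>0\<close> and by averages of \<open>p\<close>, all of which converge.\<close>

lemma Duhamel_primitive:
  assumes gen: "generated_by S D G" and t: "0 \<le> t"
  defines "w \<equiv> \<lambda>t. integral {0..t} (Duhamel S p)"
  shows "w t \<in> D" "Duhamel S p t = G (w t) + integral {0..t} p"
proof -
  let ?v = "Duhamel S p"
  have v_cont: "continuous_on {a..b} ?v" if "0 \<le> a" for a b
    using continuous_on_Duhamel[of b] by (rule continuous_on_subset) (use that in auto)
  have right: "((\<lambda>h. (w (t + h) - w t) /\<^sub>R h) \<longlongrightarrow> ?v t) (at_right 0)" if t: "0 \<le> t" for t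
  proof -
    have "(w has_vector_derivative ?v t) (at t within {0..t + 1})"
      unfolding w_def using t by (intro integral_has_vector_derivative v_cont) auto
    then have "((\<lambda>s. (w s - w t) /\<^sub>R (s - t)) \<longlongrightarrow> ?v t) (at t within {0..t + 1})"
      by (simp add: has_vector_derivative_iff_quotient)
    then have "((\<lambda>s. (w s - w t) /\<^sub>R (s - t)) \<longlongrightarrow> ?v t) (at t within {t..t + 1})"
      by (rule tendsto_within_subset) (use t in auto)
    then have "((\<lambda>s. (w s - w t) /\<^sub>R (s - t)) \<longlongrightarrow> ?v t) (at_right t)"
      by (simp add: at_within_Icc_at_right)
    then show ?thesis
      by (subst (asm) filterlim_at_right_to_0) (simp add: add.commute)
  qed
  have quot: "(S h (w t) - w t) /\<^sub>R h = (w (t + h) - w t) /\<^sub>R h - (w (0 + h) - w 0) /\<^sub>R h - integral {0..t} p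
      - integral {0..t} (\<lambda>\<tau>. integral {\<tau>..\<tau> + h} (\<lambda>s. S (\<tau> + h - s) (p s)) - h *\<^sub>R p \<tau>) /\<^sub>R h"
    and rest_cont: "continuous_on {0..t} (\<lambda>\<tau>. integral {\<tau>..\<tau> + h} (\<lambda>s. S (\<tau> + h - s) (p s)) - h *\<^sub>R p \<tau>)"
    if h: "0 < h" for h
  proof -
    let ?r = "\<lambda>\<tau>. integral {\<tau>..\<tau> + h} (\<lambda>s. S (\<tau> + h - s) (p s))"
    have vh: "continuous_on {0..t} (\<lambda>\<tau>. ?v (\<tau> + h))"
      by (intro continuous_on_compose2[OF v_cont[of 0 "t + h"]] continuous_intros) (use h in auto)
    have r_eq: "?r \<tau> = ?v (\<tau> + h) - S h (?v \<tau>)" if "\<tau> \<in> {0..t}" for \<tau>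
      using Duhamel_shift[of \<tau> h] that h by simp
    have "continuous_on {0..t} (\<lambda>\<tau>. ?v (\<tau> + h) - S h (?v \<tau>))"
      by (intro continuous_intros vh blinfun.continuous_on v_cont) auto
    then have r_cont: "continuous_on {0..t} ?r"
      by (rule continuous_on_eq) (simp only: r_eq)
    have p_cont: "continuous_on {0..t} p"
      by (rule continuous_on_subset[OF p]) auto
    show "continuous_on {0..t} (\<lambda>\<tau>. ?r \<tau> - h *\<^sub>R p \<tau>)"
      by (intro continuous_intros r_cont p_cont)
    have "S h (w t) = integral {0..t} (\<lambda>\<tau>. S h (?v \<tau>))"
      unfolding w_def
      using integral_linear[OF integrable_continuous_real[OF v_cont[of 0 t]]
          blinfun.bounded_linear_right[of "S h"]] by (simp add: o_def)
    also have "\<dots> = integral {0..t} (\<lambda>\<tau>. ?v (\<tau> + h) - h *\<^sub>R p \<tau> - (?r \<tau> - h *\<^sub>R p \<tau>))"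
      by (intro integral_cong) (simp add: r_eq)
    also have "\<dots> = integral {0..t} (\<lambda>\<tau>. ?v (\<tau> + h)) - h *\<^sub>R integral {0..t} p
        - integral {0..t} (\<lambda>\<tau>. ?r \<tau> - h *\<^sub>R p \<tau>)"
      by (simp add: integral_diff integrable_continuous_real vh r_cont p_cont continuous_intros)
    also have "integral {0..t} (\<lambda>\<tau>. ?v (\<tau> + h)) = integral {h..t + h} ?v"
      using integral_shift_real_ivl[of h h "t + h" ?v] by simp
    also have "\<dots> = w (t + h) - w h"
      using Henstock_Kurzweil_Integration.integral_combine[of 0 h "t + h" ?v] h t v_cont
      by (simp add: w_def integrable_continuous_real algebra_simps)
    finally show "(S h (w t) - w t) /\<^sub>R h = (w (t + h) - w t) /\<^sub>R h - (w (0 + h) - w 0) /\<^sub>R h - integral {0..t} p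
      - integral {0..t} (\<lambda>\<tau>. ?r \<tau> - h *\<^sub>R p \<tau>) /\<^sub>R h"
      using h by (simp add: w_def scaleR_diff_right)
  qed
  have "((\<lambda>h. integral {0..t} (\<lambda>\<tau>. integral {\<tau>..\<tau> + h} (\<lambda>s. S (\<tau> + h - s) (p s)) - h *\<^sub>R p \<tau>) /\<^sub>R h)
      \<longlongrightarrow> 0) (at_right 0)"
  proof (rule tendstoI)
    fix e :: real assume e: "0 < e"
    define e' where "e' = e / (t + 1)"
    have e': "0 < e'" "e' * t < e"
      using e t by (auto simp: e'_def field_simps)
    obtain d where d: "0 < d" "\<And>h \<tau>. 0 < h \<Longrightarrow> h < d \<Longrightarrow> \<tau> \<in> {0..t} \<Longrightarrow>
        norm (integral {\<tau>..\<tau> + h} (\<lambda>s. S (\<tau> + h - s) (p s)) - h *\<^sub>R p \<tau>) \<le> e' * h"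
      using Duhamel_short_time[OF t e'(1)] by blast
    show "\<forall>\<^sub>F h in at_right 0.
        dist (integral {0..t} (\<lambda>\<tau>. integral {\<tau>..\<tau> + h} (\<lambda>s. S (\<tau> + h - s) (p s)) - h *\<^sub>R p \<tau>) /\<^sub>R h) 0 < e"
    proof (rule eventually_at_rightI[OF _ d(1)])
      fix h assume h: "h \<in> {0<..<d}"
      let ?I = "integral {0..t} (\<lambda>\<tau>. integral {\<tau>..\<tau> + h} (\<lambda>s. S (\<tau> + h - s) (p s)) - h *\<^sub>R p \<tau>)"
      have "norm ?I \<le> e' * h * (t - 0)"
        using h by (intro integral_bound t rest_cont d(2)) auto
      also have "\<dots> < e * h"
        using e'(2) h by (simp add: mult.commute mult.left_commute)
      finally have "norm ?I / h < e"
        using h by (simp add: pos_divide_less_eq)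
      then show "dist (?I /\<^sub>R h) 0 < e"
        using h by (simp add: divide_inverse mult.commute)
    qed
  qed
  with right[OF t] right[of 0]
  have "((\<lambda>h. (w (t + h) - w t) /\<^sub>R h - (w (0 + h) - w 0) /\<^sub>R h - integral {0..t} p
      - integral {0..t} (\<lambda>\<tau>. integral {\<tau>..\<tau> + h} (\<lambda>s. S (\<tau> + h - s) (p s)) - h *\<^sub>R p \<tau>) /\<^sub>R h)
      \<longlongrightarrow> ?v t - ?v 0 - integral {0..t} p - 0) (at_right 0)"
    by (intro tendsto_diff tendsto_const) auto
  then have "((\<lambda>h. (S h (w t) - w t) /\<^sub>R h) \<longlongrightarrow> ?v t - integral {0..t} p) (at_right 0)"
    unfolding Duhamel_0 diff_0_right
    by (rule Lim_transform_eventually) (auto simp: quot intro!: eventually_at_rightI[of 0 1])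
  then have "w t \<in> D \<and> G (w t) = ?v t - integral {0..t} p"
    using generated_by_limit_iff[OF gen] by blast
  then show "w t \<in> D" "?v t = G (w t) + integral {0..t} p"
    by auto
qed

end

section \<open>The evolution equation for one coefficient\<close>

text \<open>The form \<open>q\<close> of \<open>B\<close> is an equivalent Hilbert space norm, squared, in which \<open>inv B \<circ> A\<close> is monotone.  All estimates below
are made in this norm and translated back with the constants \<open>\<beta>m\<close> and \<open>\<beta>p\<close>.\<close>

locale coercive_evolution =
  fixes D :: "'a::{real_inner,banach} set" and A :: "'a \<Rightarrow> 'a" and Q B :: "'a \<Rightarrow>\<^sub>L 'a"
    and \<beta>m \<beta>p :: real
  assumes A: "maximal_monotone D A"
    and sym: "inner (B x) y = inner x (B y)"
    and lower: "\<beta>m * (norm x)\<^sup>2 \<le> inner (B x) x"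
    and upper: "inner (B x) x \<le> \<beta>p * (norm x)\<^sup>2"
    and \<beta>m: "0 < \<beta>m" and \<beta>p: "0 < \<beta>p"
begin

abbreviation q :: "'a \<Rightarrow> real" where
  "q x \<equiv> inner (B x) x"

definition gen :: "'a \<Rightarrow> 'a" where
  "gen = (\<lambda>x. - (inv (blinfun_apply B) (A x) + Q x))"

definition \<omega> :: real where
  "\<omega> = sqrt (\<beta>p / \<beta>m) * norm Q"

lemma q_nonneg: "0 \<le> q x"
  using lower[of x] \<beta>m by (smt (verit) mult_nonneg_nonneg zero_le_power2)

lemma Cauchy_Schwarz: "(inner (B x) y)\<^sup>2 \<le> q x * q y"
proof (cases "y = 0")
  case False
  then have qy: "0 < q y"
    using lower[of y] \<beta>m by (smt (verit) mult_pos_pos zero_less_norm_iff zero_less_power)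
  define r where "r = inner (B x) y / q y"
  have "0 \<le> q (x - r *\<^sub>R y)"
    by (rule q_nonneg)
  also have "\<dots> = q x - 2 * r * inner (B x) y + r * r * q y"
    using sym[of y x] by (simp add: blinfun.diff_right blinfun.scaleR_right inner_diff_left
        inner_diff_right inner_commute algebra_simps)
  also have "\<dots> = q x - (inner (B x) y)\<^sup>2 / q y"
    using qy by (simp add: r_def power2_eq_square field_simps)
  finally show ?thesis
    using qy by (simp add: field_simps)
qed simp

lemma inverse_exists: "\<exists>x. B x = y"
  using maximal_monotone_onto_coercive[of UNIV "\<lambda>_. 0" \<beta>m B y] lower \<beta>m
  by (auto simp: maximal_monotone_def)

lemma norm_le_B: "\<beta>m * norm x \<le> norm (B x)"
proof -
  have "\<beta>m * norm x * norm x \<le> norm (B x) * norm x"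
    using lower[of x] norm_cauchy_schwarz[of "B x" x] by (simp add: power2_eq_square)
  then show ?thesis
    by (cases "norm x = 0") (auto simp: mult_le_cancel_right)
qed

lemma inj_B: "inj (blinfun_apply B)"
proof (rule injI)
  fix x y assume "B x = B y"
  then have "\<beta>m * norm (x - y) \<le> 0"
    using norm_le_B[of "x - y"] by (simp add: blinfun.diff_right)
  then have "norm (x - y) \<le> 0"
    using \<beta>m by (simp add: mult_le_0_iff)
  then show "x = y"
    by simp
qed

lemma B_inv: "B (inv (blinfun_apply B) x) = x"
  using inverse_exists by (intro f_inv_into_f) (auto simp: image_iff, metis)

definition Binv :: "'a \<Rightarrow>\<^sub>L 'a" where
  "Binv = Blinfun (inv (blinfun_apply B))"

lemma norm_inv_le: "norm (inv (blinfun_apply B) x) \<le> norm x / \<beta>m"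
  using norm_le_B[of "inv (blinfun_apply B) x"] \<beta>m by (simp add: B_inv field_simps)

lemma Binv_apply: "blinfun_apply Binv = inv (blinfun_apply B)"
proof -
  have "bounded_linear (inv (blinfun_apply B))"
  proof (rule bounded_linear_intro)
    fix x y r
    show "inv (blinfun_apply B) (x + y) = inv (blinfun_apply B) x + inv (blinfun_apply B) y"
      by (rule injD[OF inj_B]) (simp add: B_inv blinfun.add_right)
    show "inv (blinfun_apply B) (r *\<^sub>R x) = r *\<^sub>R inv (blinfun_apply B) x"
      by (rule injD[OF inj_B]) (simp add: B_inv blinfun.scaleR_right)
    show "norm (inv (blinfun_apply B) x) \<le> norm x * (1 / \<beta>m)"
      using norm_inv_le[of x] by simp
  qed
  then show ?thesis
    by (simp add: Binv_def bounded_linear_Blinfun_apply)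
qed

lemma B_gen: "B (gen x) = - (A x + B (Q x))"
  by (simp add: gen_def blinfun.bilinear_simps B_inv)

lemma Q_form_bound: "\<bar>inner (B (Q x)) x\<bar> \<le> \<omega> * q x"
proof (rule power2_le_imp_le)
  have "(inner (B (Q x)) x)\<^sup>2 \<le> q (Q x) * q x"
    by (rule Cauchy_Schwarz)
  also have "\<dots> \<le> (\<beta>p * (norm Q)\<^sup>2 * (q x / \<beta>m)) * q x"
  proof (rule mult_right_mono[OF _ q_nonneg])
    have "q (Q x) \<le> \<beta>p * (norm (Q x))\<^sup>2"
      by (rule upper)
    also have "\<dots> \<le> \<beta>p * (norm Q * norm x)\<^sup>2"
      using \<beta>p by (intro mult_left_mono power_mono norm_blinfun) auto
    also have "\<dots> = \<beta>p * (norm Q)\<^sup>2 * (norm x)\<^sup>2"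
      by (simp add: power_mult_distrib)
    also have "\<dots> \<le> \<beta>p * (norm Q)\<^sup>2 * (q x / \<beta>m)"
      using \<beta>p \<beta>m lower[of x] by (intro mult_left_mono) (auto simp: field_simps)
    finally show "q (Q x) \<le> \<beta>p * (norm Q)\<^sup>2 * (q x / \<beta>m)" .
  qed
  also have "\<dots> = (\<omega> * q x)\<^sup>2"
    using \<beta>p \<beta>m by (simp add: \<omega>_def power_mult_distrib) (simp add: power2_eq_square)
  finally show "\<bar>inner (B (Q x)) x\<bar>\<^sup>2 \<le> (\<omega> * q x)\<^sup>2"
    by simp
  show "0 \<le> \<omega> * q x"
    using \<beta>p \<beta>m q_nonneg by (simp add: \<omega>_def)
qed

lemma gen_quasi_dissipative: "x \<in> D \<Longrightarrow> inner (B (gen x)) x \<le> \<omega> * q x"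
  using A Q_form_bound[of x] by (auto simp: B_gen inner_diff_left maximal_monotone_def inner_add_left)

lemma gen_resolvent_le:
  assumes x: "x \<in> D" and h: "0 < h" and eq: "x - h *\<^sub>R (gen x - \<omega> *\<^sub>R x) = y"
  shows "q x \<le> q y"
proof -
  have "inner (B y) x = q x + h * (\<omega> * q x - inner (B (gen x)) x)"
    unfolding eq[symmetric]
    by (simp add: blinfun.bilinear_simps inner_diff_left algebra_simps)
  moreover have "0 \<le> h * (\<omega> * q x - inner (B (gen x)) x)"
    using gen_quasi_dissipative[OF x] h by simp
  ultimately have le: "q x \<le> inner (B y) x"
    by linarith
  have "q x * q x \<le> (inner (B y) x)\<^sup>2"
    unfolding power2_eq_square using le q_nonneg[of x] by (intro mult_mono) auto
  also have "\<dots> \<le> q y * q x"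
    by (rule Cauchy_Schwarz)
  finally show ?thesis
    using q_nonneg[of x] q_nonneg[of y] by (cases "q x = 0") (auto simp: mult_le_cancel_right)
qed

lemma gen_linear:
  assumes "x \<in> D" "y \<in> D"
  shows "gen (x + y) = gen x + gen y" "gen (r *\<^sub>R x) = r *\<^sub>R gen x"
  using assms A
  by (auto simp: gen_def Binv_apply[symmetric] blinfun.bilinear_simps maximal_monotone_def algebra_simps)

text \<open>Multiplication by \<open>B\<close> turns the equation into \<open>P x + A x = B y / h\<close> with the coercive operator
\<open>P = (1 / h + \<omega>) B + B Q\<close>; the shift \<open>\<omega>\<close> absorbs the indefinite part \<open>B Q\<close>.\<close>

lemma gen_resolvent_exists:
  assumes h: "0 < h"
  shows "\<exists>x\<in>D. x - h *\<^sub>R (gen x - \<omega> *\<^sub>R x) = y"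
proof -
  define P where "P = (1 / h + \<omega>) *\<^sub>R B + (B o\<^sub>L Q)"
  have "\<beta>m / h * (norm x)\<^sup>2 \<le> inner (P x) x" for x
  proof -
    have "\<beta>m / h * (norm x)\<^sup>2 \<le> q x / h"
      using lower[of x] h by (simp add: field_simps)
    also have "\<dots> \<le> inner (P x) x"
      using Q_form_bound[of x] by (simp add: P_def blinfun.bilinear_simps inner_add_left algebra_simps)
    finally show ?thesis .
  qed
  then obtain x where x: "x \<in> D" "P x + A x = (1 / h) *\<^sub>R B y"
    using maximal_monotone_onto_coercive[OF A, of "\<beta>m / h" P "(1 / h) *\<^sub>R B y"] h \<beta>m by auto
  have "B (x - h *\<^sub>R (gen x - \<omega> *\<^sub>R x)) = h *\<^sub>R (P x + A x)"
    using h by (simp add: P_def B_gen blinfun.bilinear_simps algebra_simps)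
  also have "\<dots> = B y"
    using h by (simp add: x(2))
  finally show ?thesis
    using x(1) injD[OF inj_B] by blast
qed

lemma gen_resolvent_unique:
  assumes h: "0 < h" and x: "x \<in> D" "x' \<in> D"
    and eq: "x - h *\<^sub>R (gen x - \<omega> *\<^sub>R x) = x' - h *\<^sub>R (gen x' - \<omega> *\<^sub>R x')"
  shows "x = x'"
proof -
  have D: "x - x' \<in> D" "- x' \<in> D"
    using x A by (auto simp: maximal_monotone_def subspace_diff subspace_neg)
  have diff: "gen (x - x') = gen x - gen x'"
    using gen_linear(1)[of x "- x'"] gen_linear(2)[of x' x' "- 1"] x D by simp
  then have "(x - x') - h *\<^sub>R (gen (x - x') - \<omega> *\<^sub>R (x - x')) = 0"
    unfolding diff using eq by (simp add: algebra_simps)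
  from gen_resolvent_le[OF D(1) h this] have "q (x - x') \<le> 0"
    by simp
  then have "\<beta>m * (norm (x - x'))\<^sup>2 \<le> 0"
    using lower[of "x - x'"] by linarith
  then show ?thesis
    using \<beta>m by (simp add: mult_le_0_iff)
qed

definition Res :: "real \<Rightarrow> 'a \<Rightarrow> 'a" where
  "Res h y = (SOME x. x \<in> D \<and> x - h *\<^sub>R (gen x - \<omega> *\<^sub>R x) = y)"

lemma Res:
  assumes "0 < h"
  shows "Res h y \<in> D" "Res h y - h *\<^sub>R (gen (Res h y) - \<omega> *\<^sub>R Res h y) = y"
proof -
  have "\<exists>x. x \<in> D \<and> x - h *\<^sub>R (gen x - \<omega> *\<^sub>R x) = y"
    using gen_resolvent_exists[OF assms, of y] by blast
  from someI_ex[OF this] show "Res h y \<in> D" "Res h y - h *\<^sub>R (gen (Res h y) - \<omega> *\<^sub>R Res h y) = y"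
    by (simp_all add: Res_def)
qed

lemma Res_eqI:
  assumes h: "0 < h" and x: "x \<in> D" and eq: "x - h *\<^sub>R (gen x - \<omega> *\<^sub>R x) = y"
  shows "Res h y = x"
  by (rule gen_resolvent_unique[OF h Res(1)[OF h] x trans[OF Res(2)[OF h] eq[symmetric]]])

lemma norm_le_sqrt_q: "q x \<le> q y \<Longrightarrow> norm x \<le> sqrt (\<beta>p / \<beta>m) * norm y"
proof (rule power2_le_imp_le)
  assume "q x \<le> q y"
  then have "\<beta>m * (norm x)\<^sup>2 \<le> \<beta>p * (norm y)\<^sup>2"
    using lower[of x] upper[of y] by linarith
  then show "(norm x)\<^sup>2 \<le> (sqrt (\<beta>p / \<beta>m) * norm y)\<^sup>2"
    using \<beta>m \<beta>p by (simp add: power_mult_distrib field_simps)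
qed (use \<beta>m \<beta>p in auto)

lemma bounded_linear_Res:
  assumes h: "0 < h"
  shows "bounded_linear (Res h)"
proof (rule bounded_linear_intro)
  fix x y r
  have sub: "subspace D"
    using A by (simp add: maximal_monotone_def)
  note R = Res[OF h]
  show "Res h (x + y) = Res h x + Res h y"
    using R[of x] R[of y] sub
    by (intro Res_eqI h) (auto simp: subspace_add gen_linear algebra_simps)
  show "Res h (r *\<^sub>R x) = r *\<^sub>R Res h x"
  proof (intro Res_eqI h)
    have "r *\<^sub>R Res h x - h *\<^sub>R (gen (r *\<^sub>R Res h x) - \<omega> *\<^sub>R r *\<^sub>R Res h x)
        = r *\<^sub>R (Res h x - h *\<^sub>R (gen (Res h x) - \<omega> *\<^sub>R Res h x))"
      using gen_linear(2)[OF R(1) R(1)] by (simp add: algebra_simps)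
    then show "r *\<^sub>R Res h x - h *\<^sub>R (gen (r *\<^sub>R Res h x) - \<omega> *\<^sub>R r *\<^sub>R Res h x) = r *\<^sub>R x"
      by (simp only: R(2))
  qed (use R sub in \<open>auto simp: subspace_scale\<close>)
  show "norm (Res h x) \<le> norm x * sqrt (\<beta>p / \<beta>m)"
    using norm_le_sqrt_q[OF gen_resolvent_le[OF R(1) h R(2)], of x] by (simp add: mult.commute)
qed

lemma generation: "\<exists>S. generated_by S D gen"
proof -
  have R: "blinfun_apply (Blinfun (Res h)) = Res h" if "0 < h" for h
    using that by (simp add: bounded_linear_Res bounded_linear_Blinfun_apply)
  interpret resolvents D "\<lambda>x. gen x - \<omega> *\<^sub>R x" "\<lambda>h. Blinfun (Res h)" "sqrt (\<beta>p / \<beta>m)"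
  proof
    fix h :: real assume h: "0 < h" "h \<le> 1"
    fix x
    show "Blinfun (Res h) x \<in> D"
      and "Blinfun (Res h) x - h *\<^sub>R (gen (Blinfun (Res h) x) - \<omega> *\<^sub>R Blinfun (Res h) x) = x"
      using h by (simp_all add: R Res)
    show "Blinfun (Res h) (x - h *\<^sub>R (gen x - \<omega> *\<^sub>R x)) = x" if "x \<in> D"
      using h that by (simp add: R Res_eqI)
    have "q ((Res h ^^ n) x) \<le> q x" for n
      using h by (induction n) (auto intro: order_trans[OF gen_resolvent_le[OF Res(1) _ Res(2)]])
    then show "norm ((blinfun_apply (Blinfun (Res h)) ^^ n) x) \<le> sqrt (\<beta>p / \<beta>m) * norm x" for n
      using h by (simp add: R norm_le_sqrt_q)
  qed (rule maximal_monotone_dense[OF A])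
  show ?thesis
    using generated_by_shift[OF Hille_Yosida, of \<omega>] by auto
qed

text \<open>Energy estimate: along an orbit in \<open>D\<close> the derivative of \<open>q\<close> is at most \<open>2 \<omega> q\<close>.  The bound applies to every semigroup
with this generator, hence to the one that is selected in the definition of the mild solution.\<close>

lemma semigroup_bound:
  assumes S: "generated_by S D gen" and t: "0 \<le> t"
  shows "norm (S t) \<le> sqrt (\<beta>p / \<beta>m) * exp (\<omega> * t)"
proof (rule norm_blinfun_bound)
  have S0: "S 0 = id_blinfun"
    using S by (simp add: generated_by_def C0_semigroup_def)
  have D: "norm (S t x) \<le> sqrt (\<beta>p / \<beta>m) * exp (\<omega> * t) * norm x" if x: "x \<in> D" for x
  proof -
    define e where "e s = exp (- (2 * \<omega> * s)) * q (S s x)" for s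
    define e' where "e' s = exp (- (2 * \<omega> * s)) * (2 * inner (B (gen (S s x))) (S s x))
      + - (2 * \<omega>) * exp (- (2 * \<omega> * s)) * q (S s x)" for s
    have "(e' has_integral (e t - e 0)) {0..t}"
    proof (rule fundamental_theorem_of_calculus[OF t])
      fix s assume s: "s \<in> {0..t}"
      let ?F = "at s within {0..t}"
      have u: "((\<lambda>s. S s x) has_vector_derivative gen (S s x)) ?F"
        using generated_by_orbit(2,3)[OF S x, of s] s
        by (auto intro: has_vector_derivative_within_subset)
      then have "((\<lambda>s. q (S s x)) has_vector_derivative
          inner (B (S s x)) (gen (S s x)) + inner (B (gen (S s x))) (S s x)) ?F"
        by (intro bounded_bilinear.has_vector_derivative[OF bounded_bilinear_inner]
            bounded_linear.has_vector_derivative[OF blinfun.bounded_linear_right])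
      then have 1: "((\<lambda>s. q (S s x)) has_vector_derivative 2 * inner (B (gen (S s x))) (S s x)) ?F"
        using sym[of "gen (S s x)" "S s x"] by (simp add: inner_commute)
      have 2: "((\<lambda>s. exp (- (2 * \<omega> * s))) has_vector_derivative - (2 * \<omega>) * exp (- (2 * \<omega> * s))) ?F"
        unfolding has_real_derivative_iff_has_vector_derivative[symmetric]
        by (auto intro!: derivative_eq_intros)
      show "(e has_vector_derivative e' s) ?F"
        unfolding e_def e'_def
        by (rule bounded_bilinear.has_vector_derivative[OF bounded_bilinear_mult 2 1])
    qed
    moreover have "e' s \<le> 0" if "s \<in> {0..t}" for s
    proof -
      have "inner (B (gen (S s x))) (S s x) \<le> \<omega> * q (S s x)"
        using that by (intro gen_quasi_dissipative generated_by_orbit(1)[OF S x]) auto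
      then have "exp (- (2 * \<omega> * s)) * (2 * inner (B (gen (S s x))) (S s x))
          \<le> exp (- (2 * \<omega> * s)) * (2 * (\<omega> * q (S s x)))"
        by (intro mult_left_mono) auto
      then show ?thesis
        by (simp add: e'_def mult_ac)
    qed
    ultimately have "e t - e 0 \<le> 0"
      using has_integral_le[OF _ has_integral_0] by blast
    then have "exp (- (2 * \<omega> * t)) * q (S t x) \<le> q x"
      by (simp add: e_def S0)
    moreover have "exp (- (2 * \<omega> * t)) = exp (- (\<omega> * t)) * exp (- (\<omega> * t))"
      by (simp add: exp_add[symmetric])
    ultimately have "q (exp (- (\<omega> * t)) *\<^sub>R S t x) \<le> q x"
      by (simp add: blinfun.scaleR_right)
    then have "exp (- (\<omega> * t)) * norm (S t x) \<le> sqrt (\<beta>p / \<beta>m) * norm x"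
      using norm_le_sqrt_q by fastforce
    then show ?thesis
      by (simp add: exp_minus field_simps)
  qed
  fix x
  have "closed {x. norm (S t x) \<le> sqrt (\<beta>p / \<beta>m) * exp (\<omega> * t) * norm x}"
    by (intro closed_Collect_le continuous_intros)
  then have "closure D \<subseteq> {x. norm (S t x) \<le> sqrt (\<beta>p / \<beta>m) * exp (\<omega> * t) * norm x}"
    using D by (intro closure_minimal) auto
  then show "norm (S t x) \<le> sqrt (\<beta>p / \<beta>m) * exp (\<omega> * t) * norm x"
    using maximal_monotone_dense[OF A] by auto
qed (use \<beta>m \<beta>p in auto)

end

section \<open>Operators on continuous functions, and Sobolev data\<close>

definition clamped :: "real \<Rightarrow> (real \<Rightarrow> 'a::metric_space) \<Rightarrow> real \<Rightarrow>\<^sub>C 'a" where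
  "clamped T f = Bcontfun (ext_cont f 0 T)"

lemma clamped_apply:
  assumes "continuous_on {0..T} f"
  shows "clamped T f t = f (clamp 0 T t)"
proof -
  obtain g :: "real \<Rightarrow>\<^sub>C 'a" where g: "\<And>x. g x = f (clamp 0 T x)"
    using continuous_on_cbox_bcontfunE[of 0 T f] assms by auto
  then have "ext_cont f 0 T = apply_bcontfun g"
    by (simp add: ext_cont_def fun_eq_iff)
  then have "clamped T f = g"
    by (simp add: clamped_def apply_bcontfun_inverse)
  then show ?thesis
    by (simp add: g)
qed

lemma clamp_Icc: "0 \<le> T \<Longrightarrow> clamp 0 T t \<in> {0..T::real}"
  using clamp_in_interval[of "0::real" T t] by auto

lemma clamp_real: "0 \<le> T \<Longrightarrow> clamp 0 T t = max 0 (min T t :: real)"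
  unfolding clamp_def Basis_real_def by (simp add: max_def min_def)

lemma clamp_eq: "t \<in> {0..T} \<Longrightarrow> clamp 0 T t = (t::real)"
  using clamp_cancel_cbox[of t "0::real" T] by simp

lemma clamped_apply_Icc: "continuous_on {0..T} f \<Longrightarrow> t \<in> {0..T} \<Longrightarrow> clamped T f t = f t"
  by (simp add: clamped_apply clamp_eq)

lemma clamped_cong: "0 \<le> T \<Longrightarrow> (\<And>t. t \<in> {0..T} \<Longrightarrow> f t = g t) \<Longrightarrow> clamped T f = clamped T g"
  unfolding clamped_def ext_cont_def
  by (intro arg_cong[of _ _ Bcontfun] ext) (use clamp_Icc in blast)

lemma norm_clamped_le:
  fixes f :: "real \<Rightarrow> 'a::real_normed_vector"
  assumes "0 \<le> T" "continuous_on {0..T} f" "\<And>t. t \<in> {0..T} \<Longrightarrow> norm (f t) \<le> c"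
  shows "norm (clamped T f) \<le> c"
  by (rule norm_bound) (simp add: clamped_apply assms clamp_Icc del: atLeastAtMost_iff)

text \<open>Common frame for integration and for the solution operators, both of which are given by integrals from \<open>0\<close> to \<open>t\<close>.  The
bound by the \<open>L\<^sup>1\<close> norm is the one that survives when the third derivative of the data is only integrable.\<close>

locale causal_operator =
  fixes T c :: real and U :: "(real \<Rightarrow> 'a::real_normed_vector) \<Rightarrow> real \<Rightarrow> 'a"
  assumes T: "0 \<le> T" and c: "0 \<le> c"
    and U_cont: "continuous_on {0..} p \<Longrightarrow> continuous_on {0..T} (U p)"
    and U_add: "continuous_on {0..} p \<Longrightarrow> continuous_on {0..} r \<Longrightarrow> t \<in> {0..T} \<Longrightarrow>
      U (\<lambda>s. p s + r s) t = U p t + U r t"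
    and U_scaleR: "continuous_on {0..} p \<Longrightarrow> t \<in> {0..T} \<Longrightarrow> U (\<lambda>s. a *\<^sub>R p s) t = a *\<^sub>R U p t"
    and U_le: "continuous_on {0..} p \<Longrightarrow> t \<in> {0..T} \<Longrightarrow>
      norm (U p t) \<le> c * integral {0..T} (\<lambda>s. norm (p s))"
begin

definition op :: "(real \<Rightarrow>\<^sub>C 'a) \<Rightarrow>\<^sub>L (real \<Rightarrow>\<^sub>C 'a)" where
  "op = Blinfun (\<lambda>p. clamped T (U (apply_bcontfun p)))"

lemma clamped_U_le: "norm (clamped T (U (apply_bcontfun p))) \<le> c * integral {0..T} (\<lambda>s. norm (p s))"
  by (intro norm_clamped_le T U_cont U_le continuous_on_apply_bcontfun)

lemma integral_norm_le: "integral {0..T} (\<lambda>s. norm (p s)) \<le> T * norm p" for p :: "real \<Rightarrow>\<^sub>C 'a"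
proof -
  have "integral {0..T} (\<lambda>s. norm (p s)) \<le> integral {0..T} (\<lambda>s. norm p)"
    by (intro integral_le integrable_continuous_real continuous_intros norm_bounded) auto
  then show ?thesis
    using T by simp
qed

lemma bounded_linear_U: "bounded_linear (\<lambda>p. clamped T (U (apply_bcontfun p)))"
proof (rule bounded_linear_intro)
  fix p r :: "real \<Rightarrow>\<^sub>C 'a" and a :: real
  show "clamped T (U (apply_bcontfun (p + r))) = clamped T (U (apply_bcontfun p)) + clamped T (U (apply_bcontfun r))"
    by (rule bcontfun_eqI) (simp add: clamped_apply U_cont continuous_on_add plus_bcontfun.rep_eq U_add clamp_Icc T del: atLeastAtMost_iff)
  show "clamped T (U (apply_bcontfun (a *\<^sub>R p))) = a *\<^sub>R clamped T (U (apply_bcontfun p))"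
    by (rule bcontfun_eqI) (simp add: clamped_apply U_cont continuous_on_scaleR scaleR_bcontfun.rep_eq U_scaleR clamp_Icc T del: atLeastAtMost_iff)
  show "norm (clamped T (U (apply_bcontfun p))) \<le> norm p * (c * T)"
    using clamped_U_le[of p] mult_left_mono[OF integral_norm_le[of p] c] by (simp add: mult_ac)
qed

lemma op_eq: "op p = clamped T (U p)"
  by (simp add: op_def bounded_linear_Blinfun_apply bounded_linear_U)

lemma op_apply: "t \<in> {0..T} \<Longrightarrow> op p t = U p t"
  by (simp add: op_eq clamped_apply_Icc U_cont del: atLeastAtMost_iff)

lemma norm_op_le_L1: "norm (op p) \<le> c * integral {0..T} (\<lambda>s. norm (p s))"
  unfolding op_eq by (rule clamped_U_le)

lemma norm_op: "norm op \<le> c * T"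
proof (rule norm_blinfun_bound)
  show "norm (op p) \<le> c * T * norm p" for p
    using norm_op_le_L1[of p] mult_left_mono[OF integral_norm_le[of p] c] by (simp add: mult_ac)
qed (use T c in simp)

end

lemma causal_operator_integral:
  assumes T: "0 \<le> T"
  shows "causal_operator T 1 (\<lambda>p t. integral {0..t} p :: 'a::banach)"
proof
  fix p r :: "real \<Rightarrow> 'a" and t a :: real
  assume p: "continuous_on {0..} p"
  have int: "p integrable_on {a..b}" if "0 \<le> a" "continuous_on {0..} p" for p :: "real \<Rightarrow> 'a" and a b
    using that by (intro integrable_continuous_real) (auto intro: continuous_on_subset)
  show "continuous_on {0..T} (\<lambda>t. integral {0..t} p)"
    by (intro indefinite_integral_continuous_1 int p) auto
  assume t: "t \<in> {0..T}"
  show "integral {0..t} (\<lambda>s. a *\<^sub>R p s) = a *\<^sub>R integral {0..t} p"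
    by simp
  have norm_int: "(\<lambda>s. norm (p s)) integrable_on {0..b}" for b
    by (intro integrable_continuous_real continuous_intros continuous_on_subset[OF p]) auto
  have "norm (integral {0..t} p) \<le> integral {0..t} (\<lambda>s. norm (p s))"
    by (intro integral_norm_bound_integral int norm_int p) auto
  also have "\<dots> \<le> integral {0..T} (\<lambda>s. norm (p s))"
    using t by (intro integral_subset_le norm_int) auto
  finally show "norm (integral {0..t} p) \<le> 1 * integral {0..T} (\<lambda>s. norm (p s))"
    by simp
  show "integral {0..t} (\<lambda>s. p s + r s) = integral {0..t} p + integral {0..t} r" if "continuous_on {0..} r"
    by (intro integral_add int p that) auto
qed (use T in auto)

definition integral_op :: "real \<Rightarrow> (real \<Rightarrow>\<^sub>C 'a::banach) \<Rightarrow>\<^sub>L (real \<Rightarrow>\<^sub>C 'a)" where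
  "integral_op T = causal_operator.op T (\<lambda>p t. integral {0..t} p)"

lemma integral_op_eq: "0 \<le> T \<Longrightarrow> integral_op T p = clamped T (\<lambda>t. integral {0..t} p)"
  unfolding integral_op_def by (rule causal_operator.op_eq[OF causal_operator_integral])

lemma integral_op_apply: "t \<in> {0..T} \<Longrightarrow> integral_op T p t = integral {0..t} p"
  unfolding integral_op_def by (rule causal_operator.op_apply[OF causal_operator_integral]) auto

lemma norm_integral_op: "0 \<le> T \<Longrightarrow> norm (integral_op T) \<le> T"
  unfolding integral_op_def using causal_operator.norm_op[OF causal_operator_integral] by fastforce

definition pointwise :: "('a::real_normed_vector \<Rightarrow>\<^sub>L 'b::real_normed_vector) \<Rightarrow> (real \<Rightarrow>\<^sub>C 'a) \<Rightarrow>\<^sub>L (real \<Rightarrow>\<^sub>C 'b)" where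
  "pointwise L = Blinfun (\<lambda>p. Bcontfun (\<lambda>t. L (apply_bcontfun p t)))"

lemma Bcontfun_pointwise: "apply_bcontfun (Bcontfun (\<lambda>t. blinfun_apply L (p t))) = (\<lambda>t. L (p t))"
  for p :: "real \<Rightarrow>\<^sub>C 'a::real_normed_vector"
proof (rule Bcontfun_inverse, rule bcontfun_normI)
  show "continuous_on UNIV (\<lambda>t. L (p t))"
    by (intro blinfun.continuous_on continuous_on_const continuous_on_apply_bcontfun)
  show "norm (L (p t)) \<le> norm L * norm p" for t
    by (meson mult_left_mono norm_blinfun norm_bounded norm_ge_zero order_trans)
qed

lemma pointwise_le: "norm (Bcontfun (\<lambda>t. blinfun_apply L (p t))) \<le> norm L * norm p"
  for p :: "real \<Rightarrow>\<^sub>C 'a::real_normed_vector"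
  by (rule norm_bound, unfold Bcontfun_pointwise)
     (meson mult_left_mono norm_blinfun norm_bounded norm_ge_zero order_trans)

lemma pointwise_apply:
  fixes L :: "'a::real_normed_vector \<Rightarrow>\<^sub>L 'b::real_normed_vector"
  shows "pointwise L p t = L (p t)"
proof -
  have "bounded_linear (\<lambda>p :: real \<Rightarrow>\<^sub>C 'a. Bcontfun (\<lambda>t. L (apply_bcontfun p t)))"
  proof (rule bounded_linear_intro)
    show "norm (Bcontfun (\<lambda>t. L (apply_bcontfun p t))) \<le> norm p * norm L" for p :: "real \<Rightarrow>\<^sub>C 'a"
      using pointwise_le[of L p] by (simp add: mult.commute)
  qed (rule bcontfun_eqI, subst Bcontfun_pointwise,
      simp add: Bcontfun_pointwise plus_bcontfun.rep_eq scaleR_bcontfun.rep_eq blinfun.bilinear_simps)+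
  then show ?thesis
    by (simp add: pointwise_def bounded_linear_Blinfun_apply Bcontfun_pointwise)
qed

lemma norm_pointwise: "norm (pointwise L) \<le> norm L"
proof (rule norm_blinfun_bound)
  show "norm (pointwise L p) \<le> norm L * norm p" for p
    by (rule norm_bound, unfold pointwise_apply)
       (meson mult_left_mono norm_blinfun norm_bounded norm_ge_zero order_trans)
qed simp

lemma bounded_linear_pointwise: "bounded_linear pointwise"
proof (rule bounded_linear_intro)
  show "norm (pointwise L) \<le> norm L * 1" for L :: "'a::real_normed_vector \<Rightarrow>\<^sub>L 'b::real_normed_vector"
    using norm_pointwise[of L] by simp
qed (rule blinfun_eqI, rule bcontfun_eqI, simp add: pointwise_apply blinfun.bilinear_simps
    plus_bcontfun.rep_eq scaleR_bcontfun.rep_eq)+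

lemma continuous_on_integral_bcontfun:
  fixes p :: "real \<Rightarrow>\<^sub>C 'a::banach"
  shows "continuous_on {0..T} (\<lambda>t. integral {0..t} (apply_bcontfun p))"
  by (intro indefinite_integral_continuous_1 integrable_continuous_real) simp

lemma pointwise_integral_op:
  fixes L :: "'a::banach \<Rightarrow>\<^sub>L 'b::banach"
  assumes T: "0 \<le> T"
  shows "pointwise L (integral_op T p) = integral_op T (pointwise L p)"
proof (rule bcontfun_eqI)
  fix t
  let ?t = "clamp 0 T t"
  have "L (integral {0..?t} p) = integral {0..?t} (\<lambda>s. L (p s))"
    using integral_linear[OF integrable_continuous_real[OF continuous_on_apply_bcontfun]
        blinfun.bounded_linear_right[of L]] by (simp add: o_def)
  moreover have "apply_bcontfun (pointwise L p) = (\<lambda>s. L (p s))"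
    by (auto simp: pointwise_apply)
  ultimately show "pointwise L (integral_op T p) t = integral_op T (pointwise L p) t"
    unfolding pointwise_apply integral_op_eq[OF T] clamped_apply[OF continuous_on_integral_bcontfun]
    by simp
qed

lemma integral_Icc_diff:
  fixes F :: "real \<Rightarrow> 'a::banach"
  assumes F: "F integrable_on {0..T}" and st: "0 \<le> s" "s \<le> t" "t \<le> T"
  shows "integral {0..t} F - integral {0..s} F = integral {s..t} F"
proof -
  have "F integrable_on {0..t}"
    using st by (intro integrable_on_subinterval[OF F]) auto
  then show ?thesis
    using Henstock_Kurzweil_Integration.integral_combine[of 0 s t F] st by (simp add: algebra_simps)
qed

lemma integral_shift_diff:
  fixes F :: "real \<Rightarrow> 'a::banach"
  assumes t: "0 \<le> t" and h: "0 \<le> h" and F: "\<And>a b. F integrable_on {a..b}"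
  shows "integral {0..t} (\<lambda>s. F (s + h)) - integral {0..t} F = integral {t..t + h} F - integral {0..h} F"
proof -
  have "integral {0..t} (\<lambda>s. F (s + h)) = integral {h..t + h} F"
    using integral_shift_real_ivl[of h h "t + h" F] by simp
  moreover have "integral {0..t + h} F - integral {0..h} F = integral {h..t + h} F"
    and "integral {0..t + h} F - integral {0..t} F = integral {t..t + h} F"
    using integral_Icc_diff[of F "t + h" h "t + h"] integral_Icc_diff[of F "t + h" t "t + h"] F t h by auto
  ultimately show ?thesis
    by (simp add: algebra_simps)
qed

lemma norm_scaleR_inverse: "0 < h \<Longrightarrow> norm (x /\<^sub>R h) = norm x / h"
  by (simp add: divide_inverse mult.commute)

text \<open>The difference quotients \<open>(G (t + h) - G t) / h\<close> do it.  Their primitives are differences of averages of \<open>G\<close>, which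
converge uniformly.  Their \<open>L\<^sup>1\<close> norms are at most the integrals of the difference quotients of the nondecreasing
function \<open>nu\<close>, and those integrals again are averages, bounded by \<open>nu T\<close>.\<close>

lemma mollification:
  fixes G :: "real \<Rightarrow> 'a::banach" and nu :: "real \<Rightarrow> real"
  assumes T: "0 < T" and G: "continuous_on {0..T} G" and G0: "G 0 = 0"
    and nu: "continuous_on {0..T} nu" and nu0: "nu 0 = 0"
    and le: "\<And>s t. 0 \<le> s \<Longrightarrow> s \<le> t \<Longrightarrow> t \<le> T \<Longrightarrow> norm (G t - G s) \<le> nu t - nu s"
  obtains g :: "nat \<Rightarrow> real \<Rightarrow>\<^sub>C 'a"
    where "(\<lambda>n. integral_op T (g n)) \<longlonglongrightarrow> clamped T G"
      and "\<And>n. integral {0..T} (\<lambda>t. norm (g n t)) \<le> nu T"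
proof -
  let ?G = "clamped T G"
  define N where "N t = nu (clamp 0 T t)" for t
  have N_cont: "continuous_on X N" for X
    unfolding N_def using clamp_continuous_on[of 0 T nu] nu by simp
  have mono: "nu s \<le> nu t" if "0 \<le> s" "s \<le> t" "t \<le> T" for s t
    using le[OF that] norm_ge_zero[of "G t - G s"] by linarith
  have N_bounds: "0 \<le> N t" "N t \<le> nu T" for t
    using mono[of 0 "clamp 0 T t"] mono[of "clamp 0 T t" T] clamp_Icc[of T t] nu0 T by (auto simp: N_def)
  have clamp_mono: "clamp 0 T s \<le> clamp 0 T t" if "s \<le> t" for s t
    using that T by (auto simp: clamp_real)
  have clamp_ge: "clamp 0 T t = T" if "T \<le> t" for t
    using that T by (simp add: clamp_real)
  have G_diff: "norm (?G t - ?G s) \<le> N t - N s" if "s \<le> t" for s t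
    using le[OF _ clamp_mono[OF that]] clamp_Icc[of T] T by (auto simp: clamped_apply[OF G] N_def)
  have unif: "\<exists>d>0. \<forall>s t. \<bar>s - t\<bar> < d \<longrightarrow> norm (?G s - ?G t) < e" if e: "0 < e" for e
  proof -
    have "uniformly_continuous_on {0..T} G"
      by (intro compact_uniformly_continuous G) simp
    then obtain d where d: "0 < d" "\<And>s t. s \<in> {0..T} \<Longrightarrow> t \<in> {0..T} \<Longrightarrow> dist s t < d \<Longrightarrow> dist (G s) (G t) < e"
      using e unfolding uniformly_continuous_on_def by metis
    have "norm (?G s - ?G t) < e" if "\<bar>s - t\<bar> < d" for s t
    proof -
      have "dist (clamp 0 T s) (clamp 0 T t) < d"
        using dist_clamps_le_dist_args[of "0::real" T s t] that by (simp add: dist_real_def)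
      then show ?thesis
        using d(2) clamp_Icc[of T] T by (simp add: clamped_apply[OF G] dist_norm del: atLeastAtMost_iff)
    qed
    then show ?thesis
      using d(1) by blast
  qed
  define h where "h n = inverse (real (Suc n))" for n
  have h: "0 < h n" for n
    by (simp add: h_def)
  define g where "g n = Bcontfun (\<lambda>t. (?G (t + h n) - ?G t) /\<^sub>R h n)" for n
  have g_apply: "g n t = (?G (t + h n) - ?G t) /\<^sub>R h n" for n t
  proof -
    have "apply_bcontfun (g n) = (\<lambda>t. (?G (t + h n) - ?G t) /\<^sub>R h n)"
      unfolding g_def
    proof (rule Bcontfun_inverse, rule bcontfun_normI)
      show "continuous_on UNIV (\<lambda>t. (?G (t + h n) - ?G t) /\<^sub>R h n)"
        by (intro continuous_intros continuous_on_compose2[OF continuous_on_apply_bcontfun[of UNIV]]) auto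
      show "norm ((?G (t + h n) - ?G t) /\<^sub>R h n) \<le> (norm ?G + norm ?G) / h n" for t
      proof -
        have "norm (?G (t + h n) - ?G t) \<le> norm ?G + norm ?G"
          by (rule order_trans[OF norm_triangle_ineq4]) (intro add_mono norm_bounded)
        then show ?thesis
          unfolding norm_scaleR_inverse[OF h] using h[of n] by (intro divide_right_mono) auto
      qed
    qed
    then show ?thesis
      by simp
  qed
  have G_int: "apply_bcontfun ?G integrable_on {a..b}" for a b
    by (intro integrable_continuous_real continuous_on_apply_bcontfun)
  have N_int: "N integrable_on {a..b}" for a b
    by (intro integrable_continuous_real N_cont)
  show thesis
  proof (rule that)
    show "integral {0..T} (\<lambda>t. norm (g n t)) \<le> nu T" for n
    proof -
      have "integral {0..T} (\<lambda>t. norm (g n t)) \<le> integral {0..T} (\<lambda>t. (N (t + h n) - N t) / h n)"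
      proof (rule integral_le)
        show "(\<lambda>t. norm (g n t)) integrable_on {0..T}"
          by (intro integrable_continuous_real continuous_on_norm continuous_on_apply_bcontfun)
        show "(\<lambda>t. (N (t + h n) - N t) / h n) integrable_on {0..T}"
          using h[of n] by (intro integrable_continuous_real continuous_intros continuous_on_compose2[OF N_cont[of UNIV]]) auto
        show "norm (g n t) \<le> (N (t + h n) - N t) / h n" for t
          using G_diff[of t "t + h n"] h[of n] unfolding g_apply norm_scaleR_inverse[OF h]
          by (intro divide_right_mono) auto
      qed
      also have "\<dots> = (integral {0..T} (\<lambda>t. N (t + h n)) - integral {0..T} N) / h n"
        by (simp add: integral_diff N_int integrable_continuous_real continuous_on_compose2[OF N_cont[of UNIV]] continuous_intros)
      also have "\<dots> = (integral {T..T + h n} N - integral {0..h n} N) / h n"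
        using T h[of n] by (simp add: integral_shift_diff N_int)
      also have "integral {T..T + h n} N = integral {T..T + h n} (\<lambda>_. nu T)"
        by (intro integral_cong) (simp add: N_def clamp_ge)
      also have "\<dots> = h n * nu T"
        using h[of n] by simp
      also have "(h n * nu T - integral {0..h n} N) / h n \<le> (h n * nu T) / h n"
        using h[of n] N_bounds by (intro divide_right_mono) (auto intro!: integral_nonneg N_int)
      finally show ?thesis
        using h[of n] by simp
    qed
    show "(\<lambda>n. integral_op T (g n)) \<longlonglongrightarrow> ?G"
    proof (rule metric_LIMSEQ_I)
      fix e :: real assume e: "0 < e"
      obtain d where d: "0 < d" "\<And>s t. \<bar>s - t\<bar> < d \<Longrightarrow> norm (?G s - ?G t) < e / 4"
        using unif[of "e / 4"] e by auto
      obtain n0 where n0: "h n0 < d"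
        using reals_Archimedean[OF d(1)] by (auto simp: h_def)
      have avg: "norm (integral {t..t + h n} ?G /\<^sub>R h n - ?G t) \<le> e / 4" if n: "n0 \<le> n" for n t
      proof -
        have "h n \<le> h n0"
          using n by (simp add: h_def)
        have "norm (integral {t..t + h n} ?G - h n *\<^sub>R ?G t) = norm (integral {t..t + h n} (\<lambda>s. ?G s - ?G t))"
          using h[of n] by (subst integral_diff) (auto intro: G_int)
        also have "\<dots> \<le> e / 4 * (t + h n - t)"
        proof (rule integral_bound)
          fix s assume "s \<in> {t..t + h n}"
          then have "\<bar>s - t\<bar> < d"
            using n0 \<open>h n \<le> h n0\<close> by auto
          then show "norm (?G s - ?G t) \<le> e / 4"
            using d(2) by (simp add: less_imp_le)
        qed (use h[of n] in \<open>auto intro!: continuous_intros\<close>)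
        finally have "norm (integral {t..t + h n} ?G - h n *\<^sub>R ?G t) / h n \<le> e / 4"
          using h[of n] by (simp add: pos_divide_le_eq)
        then have "norm ((integral {t..t + h n} ?G - h n *\<^sub>R ?G t) /\<^sub>R h n) \<le> e / 4"
          unfolding norm_scaleR_inverse[OF h] .
        also have "(integral {t..t + h n} ?G - h n *\<^sub>R ?G t) /\<^sub>R h n = integral {t..t + h n} ?G /\<^sub>R h n - ?G t"
          by (simp only: scaleR_diff_right scaleR_scaleR left_inverse[OF less_imp_neq[OF h, symmetric]] scaleR_one)
        finally show ?thesis .
      qed
      have "norm (integral_op T (g n) - ?G) < e" if n: "n0 \<le> n" for n
      proof -
        have "norm (integral_op T (g n) - ?G) \<le> e / 2"
        proof (rule norm_bound)
          fix t
          define u where "u = clamp 0 T t"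
          have u: "0 \<le> u" "u \<in> {0..T}"
            using clamp_Icc[of T t] T by (auto simp: u_def)
          have G_u: "?G t = ?G u"
            using u by (simp add: clamped_apply[OF G] clamp_eq u_def)
          have "integral_op T (g n) t = integral {0..u} (apply_bcontfun (g n))"
            using T by (simp add: integral_op_eq clamped_apply[OF continuous_on_integral_bcontfun] u_def)
          also have "apply_bcontfun (g n) = (\<lambda>s. (?G (s + h n) - ?G s) /\<^sub>R h n)"
            by (rule ext) (rule g_apply)
          also have "integral {0..u} \<dots> = (integral {0..u} (\<lambda>s. ?G (s + h n)) - integral {0..u} ?G) /\<^sub>R h n"
            by (subst integral_cmul, subst integral_diff)
               (auto intro!: integrable_continuous_real continuous_on_compose2[OF continuous_on_apply_bcontfun[of UNIV]] continuous_intros)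
          also have "\<dots> = integral {u..u + h n} ?G /\<^sub>R h n - integral {0..h n} ?G /\<^sub>R h n"
            using integral_shift_diff[OF u(1) less_imp_le[OF h] G_int, of n]
            by (simp add: scaleR_diff_right)
          finally have "(integral_op T (g n) - ?G) t = (integral {u..u + h n} ?G /\<^sub>R h n - ?G u)
              - (integral {0..0 + h n} ?G /\<^sub>R h n - ?G 0)"
            using T by (simp add: minus_bcontfun.rep_eq G_u clamped_apply_Icc[OF G] G0)
          also have "norm \<dots> \<le> norm (integral {u..u + h n} ?G /\<^sub>R h n - ?G u)
              + norm (integral {0..0 + h n} ?G /\<^sub>R h n - ?G 0)"
            by (rule norm_triangle_ineq4)
          also have "\<dots> \<le> e / 4 + e / 4"
            by (intro add_mono avg n)
          finally show "norm ((integral_op T (g n) - ?G) t) \<le> e / 2"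
            by simp
        qed
        then show ?thesis
          using e by linarith
      qed
      then show "\<exists>n0. \<forall>n\<ge>n0. dist (integral_op T (g n)) ?G < e"
        by (auto simp: dist_norm)
    qed
  qed
qed

lemma has_integral_Icc_imp_continuous:
  fixes f g :: "real \<Rightarrow> 'a::banach"
  assumes "0 \<le> T" and int: "\<And>t. t \<in> {0..T} \<Longrightarrow> (g has_integral (f t - f 0)) {0..t}"
  shows "continuous_on {0..T} f"
proof -
  have "g integrable_on {0..T}"
    using int[of T] assms(1) by auto
  then have "continuous_on {0..T} (\<lambda>t. f 0 + integral {0..t} g)"
    by (intro continuous_intros indefinite_integral_continuous_1)
  then show ?thesis
    by (rule continuous_on_eq) (use integral_unique[OF int] in simp)
qed

lemma deriv_on_primitive:
  fixes f g :: "real \<Rightarrow> 'a::banach"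
  assumes T: "0 < T" and int: "\<And>t. t \<in> {0..T} \<Longrightarrow> (g has_integral (f t - f 0)) {0..t}"
    and g: "continuous_on {0..T} g" and t: "t \<in> {0..T}"
  shows "deriv_on T f t = g t"
proof -
  have "((\<lambda>t. f 0 + integral {0..t} g) has_vector_derivative 0 + g t) (at t within {0..T})"
    by (intro has_vector_derivative_add has_vector_derivative_const integral_has_vector_derivative g t)
  then have "(f has_vector_derivative 0 + g t) (at t within {0..T})"
    by (rule has_vector_derivative_transform[OF t, rotated]) (use integral_unique[OF int] in simp)
  then show ?thesis
    using vector_derivative_within_cbox[of 0 T t f "0 + g t"] T t by (simp add: deriv_on_def)
qed

text \<open>Here \<open>G\<close> is the second derivative of \<open>f\<close>, and the primitive \<open>nu\<close> of the norm of the third derivative bounds its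
increments.\<close>

lemma sobolev_W1_3_representation:
  fixes f :: "real \<Rightarrow> 'a::banach"
  assumes T: "0 < T" and f: "sobolev_W1 3 T f"
    and 0: "f 0 = 0" "deriv_on T f 0 = 0" "deriv_on T (deriv_on T f) 0 = 0"
  obtains G nu where "continuous_on {0..T} G" "G 0 = 0" "continuous_on {0..T} nu" "nu 0 = (0::real)"
    and "\<And>s t. 0 \<le> s \<Longrightarrow> s \<le> t \<Longrightarrow> t \<le> T \<Longrightarrow> norm (G t - G s) \<le> nu t - nu s"
    and "clamped T f = integral_op T (integral_op T (clamped T G))" "continuous_on {0..T} f"
proof -
  obtain f1 f2 f3 where f3: "bochner_L1 T f3"
    and i1: "\<And>t. t \<in> {0..T} \<Longrightarrow> (f1 has_integral (f t - f 0)) {0..t}"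
    and i2: "\<And>t. t \<in> {0..T} \<Longrightarrow> (f2 has_integral (f1 t - f1 0)) {0..t}"
    and i3: "\<And>t. t \<in> {0..T} \<Longrightarrow> (f3 has_integral (f2 t - f2 0)) {0..t}"
    using f unfolding numeral_3_eq_3 sobolev_W1.simps by blast
  have cont: "continuous_on {0..T} f" "continuous_on {0..T} f1" "continuous_on {0..T} f2"
    using has_integral_Icc_imp_continuous T i1 i2 i3 by (meson less_imp_le)+
  have d1: "deriv_on T f t = f1 t" if "t \<in> {0..T}" for t
    using deriv_on_primitive[OF T i1 cont(2) that] .
  have f1_0: "f1 0 = 0"
    using d1[of 0] 0 T by simp
  have "deriv_on T (deriv_on T f) 0 = f2 0"
    by (rule deriv_on_primitive[OF T _ cont(3)]) (use i2 d1 T in auto)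
  then have f2_0: "f2 0 = 0"
    using 0 by simp
  define nu where "nu t = integral {0..t} (\<lambda>s. norm (f3 s))" for t
  have "integrable (lebesgue_on {0..T}) (\<lambda>t. norm (f3 t))"
    using f3 by (simp add: bochner_L1_def)
  then have norm_int: "(\<lambda>s. norm (f3 s)) integrable_on {0..T}"
    by (rule integrable_on_lebesgue_on) simp
  have f3_int: "f3 integrable_on {0..T}"
    using i3[of T] T by auto
  have le: "norm (f2 t - f2 s) \<le> nu t - nu s" if st: "0 \<le> s" "s \<le> t" "t \<le> T" for s t
  proof -
    have "f2 t - f2 s = integral {0..t} f3 - integral {0..s} f3"
      using i3[of t] i3[of s] st by (simp add: integral_unique f2_0)
    also have "\<dots> = integral {s..t} f3"
      by (rule integral_Icc_diff[OF f3_int st])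
    also have "norm \<dots> \<le> integral {s..t} (\<lambda>s. norm (f3 s))"
      using st by (intro integral_norm_bound_integral integrable_on_subinterval[OF f3_int]
          integrable_on_subinterval[OF norm_int]) auto
    also have "\<dots> = nu t - nu s"
      unfolding nu_def by (rule integral_Icc_diff[OF norm_int st, symmetric])
    finally show ?thesis .
  qed
  have "clamped T f1 = integral_op T (clamped T f2)"
  proof -
    have "f1 t = integral {0..t} (clamped T f2)" if "t \<in> {0..T}" for t
    proof -
      have "integral {0..t} (clamped T f2) = integral {0..t} f2"
        using that cont by (intro integral_cong) (auto simp: clamped_apply_Icc)
      then show ?thesis
        using i2[OF that] by (simp add: integral_unique f1_0)
    qed
    then show ?thesis
      using T by (simp add: integral_op_eq del: atLeastAtMost_iff) (intro clamped_cong, auto)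
  qed
  moreover have "clamped T f = integral_op T (clamped T f1)"
  proof -
    have "f t = integral {0..t} (clamped T f1)" if "t \<in> {0..T}" for t
    proof -
      have "integral {0..t} (clamped T f1) = integral {0..t} f1"
        using that cont by (intro integral_cong) (auto simp: clamped_apply_Icc)
      then show ?thesis
        using i1[OF that] by (simp add: integral_unique 0)
    qed
    then show ?thesis
      using T by (simp add: integral_op_eq del: atLeastAtMost_iff) (intro clamped_cong, auto)
  qed
  ultimately have "clamped T f = integral_op T (integral_op T (clamped T f2))"
    by simp
  moreover have "continuous_on {0..T} nu"
    unfolding nu_def by (rule indefinite_integral_continuous_1[OF norm_int])
  ultimately show thesis
    using that[of f2 nu] cont f2_0 le by (simp add: nu_def)
qed

section \<open>The parameter-to-solution map\<close>

text \<open>Bound for the kernel \<open>S (t - s) \<circ> inv B\<close> of the solution operator, the same for all coefficients \<open>B\<close> and all \<open>A\<close>.\<close>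

definition solution_bound :: "real \<Rightarrow> real \<Rightarrow> ('a::real_normed_vector \<Rightarrow>\<^sub>L 'a) \<Rightarrow> real \<Rightarrow> real" where
  "solution_bound \<beta>m \<beta>p Q T = sqrt (\<beta>p / \<beta>m) * exp (sqrt (\<beta>p / \<beta>m) * norm Q * T) / \<beta>m"

locale parameter_problem =
  fixes D :: "'a::{real_inner,banach} set" and A :: "'a \<Rightarrow> 'a" and Q :: "'a \<Rightarrow>\<^sub>L 'a"
    and T \<beta>m \<beta>p :: real
  assumes A: "maximal_monotone D A" and T: "0 < T" and \<beta>m: "0 < \<beta>m" and \<beta>p: "0 < \<beta>p"
begin

abbreviation P :: "'a selfadj set" where
  "P \<equiv> param_dom \<beta>m \<beta>p"

abbreviation J :: "(real \<Rightarrow>\<^sub>C 'a) \<Rightarrow>\<^sub>L (real \<Rightarrow>\<^sub>C 'a)" where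
  "J \<equiv> integral_op T"

abbreviation c :: real where
  "c \<equiv> solution_bound \<beta>m \<beta>p Q T"

lemma T0: "0 \<le> T"
  using T by simp

lemma coercive: "B \<in> P \<Longrightarrow> coercive_evolution D A (op_of B) \<beta>m \<beta>p"
  using op_of[of B] A \<beta>m \<beta>p by (simp add: coercive_evolution_def param_dom_def)

lemma mild_solution_Duhamel:
  assumes B: "B \<in> P"
  shows "\<exists>S. generated_by S D (coercive_evolution.gen A Q (op_of B)) \<and>
    (\<forall>p. mild_solution D A Q (op_of B) p 0 = Duhamel S (\<lambda>s. coercive_evolution.Binv (op_of B) (p s))) \<and>
    (\<forall>t\<in>{0..T}. \<forall>x. norm (S t (coercive_evolution.Binv (op_of B) x)) \<le> c * norm x)"
proof -
  interpret coercive_evolution D A Q "op_of B" \<beta>m \<beta>p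
    by (rule coercive[OF B])
  define S where "S = (SOME S. generated_by S D gen)"
  have S: "generated_by S D gen"
    unfolding S_def by (rule someI_ex[OF generation])
  show ?thesis
  proof (intro exI[of _ S] conjI allI ballI S)
    show "mild_solution D A Q (op_of B) p 0 = Duhamel S (\<lambda>s. Binv (p s))" for p
      unfolding mild_solution_def Let_def S_def gen_def Duhamel_def Binv_apply by simp
    fix t x assume t: "t \<in> {0..T}"
    have "norm (S t (Binv x)) \<le> norm (S t) * norm (Binv x)"
      by (rule norm_blinfun)
    also have "\<dots> \<le> (sqrt (\<beta>p / \<beta>m) * exp (\<omega> * T)) * (norm x / \<beta>m)"
    proof (intro mult_mono)
      have "norm (S t) \<le> sqrt (\<beta>p / \<beta>m) * exp (\<omega> * t)"
        using t by (intro semigroup_bound[OF S]) simp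
      also have "\<dots> \<le> sqrt (\<beta>p / \<beta>m) * exp (\<omega> * T)"
        using t \<beta>m \<beta>p by (intro mult_left_mono) (auto simp: \<omega>_def intro!: mult_left_mono)
      finally show "norm (S t) \<le> sqrt (\<beta>p / \<beta>m) * exp (\<omega> * T)" .
      show "norm (Binv x) \<le> norm x / \<beta>m"
        by (simp add: Binv_apply norm_inv_le)
    qed (use \<beta>m \<beta>p in auto)
    finally show "norm (S t (Binv x)) \<le> c * norm x"
      by (simp add: solution_bound_def \<omega>_def)
  qed
qed

lemma causal_operator_mild_solution:
  assumes B: "B \<in> P"
  shows "causal_operator T c (\<lambda>p. mild_solution D A Q (op_of B) p 0)"
proof -
  obtain S where gen: "generated_by S D (coercive_evolution.gen A Q (op_of B))"
    and eq: "\<And>p. mild_solution D A Q (op_of B) p 0 = Duhamel S (\<lambda>s. coercive_evolution.Binv (op_of B) (p s))"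
    and le: "\<And>t x. t \<in> {0..T} \<Longrightarrow> norm (S t (coercive_evolution.Binv (op_of B) x)) \<le> c * norm x"
    using mild_solution_Duhamel[OF B] by metis
  let ?L = "coercive_evolution.Binv (op_of B)"
  have S: "C0_semigroup S"
    using gen by (simp add: generated_by_def)
  have L_cont: "continuous_on {0..} (\<lambda>s. ?L (p s))" if "continuous_on {0..} p" for p
    using that by (intro continuous_intros)
  have int: "(\<lambda>s. S (t - s) (?L (p s))) integrable_on {0..t}" if "continuous_on {0..} p" for p t
    by (intro integrable_continuous_real Duhamel_integrand_continuous[OF S L_cont[OF that]]) auto
  show ?thesis
    unfolding eq
  proof
    show "0 \<le> T" "0 \<le> c"
      using T \<beta>m \<beta>p by (auto simp: solution_bound_def)
    fix p r :: "real \<Rightarrow> 'a" and t a :: real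
    assume p: "continuous_on {0..} p"
    show "continuous_on {0..T} (Duhamel S (\<lambda>s. ?L (p s)))"
      by (rule continuous_on_Duhamel[OF S L_cont[OF p]])
    show "Duhamel S (\<lambda>s. ?L (p s + r s)) t = Duhamel S (\<lambda>s. ?L (p s)) t + Duhamel S (\<lambda>s. ?L (r s)) t"
      if "continuous_on {0..} r"
      by (simp add: Duhamel_def blinfun.add_right integral_add int p that)
    show "Duhamel S (\<lambda>s. ?L (a *\<^sub>R p s)) t = a *\<^sub>R Duhamel S (\<lambda>s. ?L (p s)) t"
      by (simp add: Duhamel_def blinfun.scaleR_right)
    assume t: "t \<in> {0..T}"
    have norm_int: "(\<lambda>s. c * norm (p s)) integrable_on {0..b}" for b
      by (intro integrable_continuous_real continuous_intros continuous_on_subset[OF p]) auto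
    have "norm (Duhamel S (\<lambda>s. ?L (p s)) t) \<le> integral {0..t} (\<lambda>s. c * norm (p s))"
      unfolding Duhamel_def using t
      by (intro Henstock_Kurzweil_Integration.integral_norm_bound_integral int p norm_int le) auto
    also have "\<dots> \<le> integral {0..T} (\<lambda>s. c * norm (p s))"
      using t \<beta>m \<beta>p by (intro integral_subset_le norm_int) (auto simp: solution_bound_def)
    finally show "norm (Duhamel S (\<lambda>s. ?L (p s)) t) \<le> c * integral {0..T} (\<lambda>s. norm (p s))"
      by simp
  qed
qed

definition V :: "'a selfadj \<Rightarrow> (real \<Rightarrow>\<^sub>C 'a) \<Rightarrow>\<^sub>L (real \<Rightarrow>\<^sub>C 'a)" where
  "V B = causal_operator.op T (\<lambda>p. mild_solution D A Q (op_of B) p 0)"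

lemma V_apply: "B \<in> P \<Longrightarrow> t \<in> {0..T} \<Longrightarrow> V B p t = mild_solution D A Q (op_of B) p 0 t"
  unfolding V_def by (rule causal_operator.op_apply[OF causal_operator_mild_solution])

lemma V_eq: "B \<in> P \<Longrightarrow> V B p = clamped T (mild_solution D A Q (op_of B) p 0)"
  unfolding V_def by (rule causal_operator.op_eq[OF causal_operator_mild_solution])

lemma norm_V: "B \<in> P \<Longrightarrow> norm (V B) \<le> c * T"
  unfolding V_def by (rule causal_operator.norm_op[OF causal_operator_mild_solution])

lemma norm_V_L1: "B \<in> P \<Longrightarrow> norm (V B p) \<le> c * integral {0..T} (\<lambda>t. norm (p t))"
  unfolding V_def by (rule causal_operator.norm_op_le_L1[OF causal_operator_mild_solution])

text \<open>In this form of \<open>Duhamel_primitive\<close> the operator \<open>A\<close> appears separately from \<open>B\<close>, so that equations for different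
coefficients can be subtracted.\<close>

lemma primitive_of_solution:
  fixes p :: "real \<Rightarrow>\<^sub>C 'a"
  assumes B: "B \<in> P" and t: "t \<in> {0..T}"
  defines "w \<equiv> J (V B p)"
  shows "w t \<in> D" "op_of B (V B p t + Q (w t)) + A (w t) = J p t"
proof -
  interpret coercive_evolution D A Q "op_of B" \<beta>m \<beta>p
    by (rule coercive[OF B])
  obtain S where gen: "generated_by S D gen"
    and eq: "\<And>p. mild_solution D A Q (op_of B) p 0 = Duhamel S (\<lambda>s. Binv (p s))"
    using mild_solution_Duhamel[OF B] by metis
  have S: "C0_semigroup S"
    using gen by (simp add: generated_by_def)
  have cont: "continuous_on {0..} (\<lambda>s. Binv (p s))"
    by (intro blinfun.continuous_on continuous_on_const continuous_on_apply_bcontfun)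
  have "w t = integral {0..t} (V B p)"
    unfolding w_def by (rule integral_op_apply[OF t])
  also have "\<dots> = integral {0..t} (Duhamel S (\<lambda>s. Binv (p s)))"
    using t by (intro integral_cong) (auto simp: V_apply[OF B] eq)
  finally have w: "w t = integral {0..t} (Duhamel S (\<lambda>s. Binv (p s)))" .
  have t0: "0 \<le> t"
    using t by simp
  show "w t \<in> D"
    unfolding w by (rule Duhamel_primitive(1)[OF S cont gen t0])
  have "integral {0..t} (\<lambda>s. Binv (p s)) = Binv (J p t)"
    using integral_linear[OF integrable_continuous_real[OF continuous_on_apply_bcontfun]
        blinfun.bounded_linear_right[of Binv]] t by (simp add: o_def integral_op_apply)
  then have v: "V B p t = gen (w t) + Binv (J p t)"
    using Duhamel_primitive(2)[OF S cont gen t0] t by (simp add: V_apply[OF B] eq w)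
  show "op_of B (V B p t + Q (w t)) + A (w t) = J p t"
    unfolding v by (simp add: blinfun.add_right B_gen Binv_apply B_inv)
qed

lemma solution_unique:
  fixes v r :: "real \<Rightarrow>\<^sub>C 'a"
  assumes B: "B \<in> P"
    and D: "\<And>t. t \<in> {0..T} \<Longrightarrow> J v t \<in> D"
    and eq: "\<And>t. t \<in> {0..T} \<Longrightarrow> op_of B (v t + Q (J v t)) + A (J v t) = r t"
  shows "J v = V B r"
proof -
  interpret coercive_evolution D A Q "op_of B" \<beta>m \<beta>p
    by (rule coercive[OF B])
  obtain S where gen: "generated_by S D gen"
    and eq_S: "\<And>p. mild_solution D A Q (op_of B) p 0 = Duhamel S (\<lambda>s. Binv (p s))"
    using mild_solution_Duhamel[OF B] by metis
  have "integral {0..t} v = Duhamel S (\<lambda>s. Binv (r s)) t" if t: "t \<in> {0..T}" for t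
  proof -
    have "((\<lambda>s. S (t - s) (Binv (r s))) has_integral (integral {0..t} v)) {0..t}"
    proof (rule classical_solution_Duhamel[OF gen])
      fix s assume s: "s \<in> {0..t}"
      then have s': "s \<in> {0..T}"
        using t by simp
      show "((\<lambda>t. integral {0..t} v) has_vector_derivative v s) (at s within {0..t})"
        by (rule integral_has_vector_derivative[OF continuous_on_apply_bcontfun s])
      have w: "J v s = integral {0..s} v"
        by (rule integral_op_apply[OF s'])
      show "integral {0..s} v \<in> D"
        using D[OF s'] by (simp only: w)
      have r: "op_of B (v s) + op_of B (Q (J v s)) + A (J v s) = r s"
        using eq[OF s'] by (simp only: blinfun.add_right)
      have "op_of B (gen (J v s) + Binv (r s)) = - (A (J v s) + op_of B (Q (J v s))) + r s"
        by (simp only: blinfun.add_right B_gen Binv_apply B_inv)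
      also have "\<dots> = op_of B (v s)"
        unfolding r[symmetric] by simp
      finally show "v s = gen (integral {0..s} v) + Binv (r s)"
        unfolding w[symmetric] by (rule injD[OF inj_B, symmetric])
    qed (use t in auto)
    then show ?thesis
      by (simp add: Duhamel_def integral_unique)
  qed
  then show ?thesis
    unfolding V_eq[OF B] integral_op_eq[OF T0] eq_S by (intro clamped_cong T0)
qed

text \<open>Both sides are the classical solution for the inhomogeneity \<open>J p\<close>.\<close>

lemma V_integral: "B \<in> P \<Longrightarrow> V B (J p) = J (V B p)"
  by (rule solution_unique[symmetric]) (auto simp: primitive_of_solution simp del: atLeastAtMost_iff)

definition K :: "(real \<Rightarrow>\<^sub>C 'a) \<Rightarrow>\<^sub>L (real \<Rightarrow>\<^sub>C 'a)" where
  "K = id_blinfun + (pointwise Q o\<^sub>L J)"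

definition N :: "'a selfadj \<Rightarrow>\<^sub>L (real \<Rightarrow>\<^sub>C 'a) \<Rightarrow>\<^sub>L (real \<Rightarrow>\<^sub>C 'a)" where
  "N = Blinfun (\<lambda>H. pointwise (op_of H) o\<^sub>L K)"

lemma norm_K: "norm K \<le> 1 + norm Q * T"
  unfolding K_def
proof (intro norm_triangle_mono norm_blinfun_id_le order_trans[OF norm_blinfun_compose])
  show "norm (pointwise Q) * norm J \<le> norm Q * T"
    by (intro mult_mono norm_pointwise norm_integral_op T0) auto
qed

lemma N_blinfun: "blinfun_apply N = (\<lambda>H. pointwise (op_of H) o\<^sub>L K)"
proof -
  have "bounded_linear (op_of :: 'a selfadj \<Rightarrow> _)"
    by (rule bounded_linear_intro[of _ 1]) (simp_all add: op_of_plus op_of_scaleR norm_selfadj_def)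
  then have "bounded_linear (\<lambda>H. pointwise (op_of H) o\<^sub>L K)"
    by (intro bounded_linear_compose[OF bounded_bilinear.bounded_linear_left[OF bounded_bilinear_blinfun_compose]]
        bounded_linear_compose[OF bounded_linear_pointwise])
  then show ?thesis
    by (simp add: N_def bounded_linear_Blinfun_apply)
qed

lemma N_apply: "N H p t = op_of H (p t + Q (J p t))"
  by (simp add: N_blinfun K_def pointwise_apply blinfun.add_left plus_bcontfun.rep_eq)

lemma norm_N: "norm N \<le> 1 + norm Q * T"
proof (rule norm_blinfun_bound)
  fix H
  have "norm (N H) \<le> norm (pointwise (op_of H)) * norm K"
    unfolding N_blinfun by (rule norm_blinfun_compose)
  also have "\<dots> \<le> norm H * (1 + norm Q * T)"
    using norm_pointwise[of "op_of H"] norm_K by (intro mult_mono) (auto simp: norm_selfadj_def)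
  finally show "norm (N H) \<le> (1 + norm Q * T) * norm H"
    by (simp add: mult.commute)
qed (use T in simp)

lemma N_integral: "N H (J p) = J (N H p)"
  by (simp add: N_blinfun K_def blinfun.bilinear_simps pointwise_integral_op[OF T0])

text \<open>The function \<open>J (V B' p)\<close> solves the equation of \<open>B'\<close> with inhomogeneity \<open>J p\<close>.  Moving \<open>B' - B\<close> to the right-hand side
turns this into the equation of \<open>B\<close>.\<close>

lemma resolvent_identity:
  assumes B: "B \<in> P" and B': "B' \<in> P"
  shows "V B' (J p) - V B (J p) = - V B (N (B' - B) (V B' p))"
proof -
  have "J (V B' p) = V B (J p - N (B' - B) (V B' p))"
  proof (rule solution_unique[OF B])
    fix t assume t: "t \<in> {0..T}"
    show "J (V B' p) t \<in> D"
      by (rule primitive_of_solution(1)[OF B' t])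
    show "op_of B (V B' p t + Q (J (V B' p) t)) + A (J (V B' p) t) = (J p - N (B' - B) (V B' p)) t"
      using primitive_of_solution(2)[OF B' t, of p]
      by (simp add: minus_bcontfun.rep_eq N_apply op_of_minus blinfun.diff_left algebra_simps)
  qed
  then show ?thesis
    by (simp add: V_integral[OF B'] blinfun.diff_right)
qed

lemma smoothed_resolvent_family:
  assumes g: "(\<lambda>n. J (g n)) \<longlonglongrightarrow> G" and L1: "\<And>n. integral {0..T} (\<lambda>t. norm (g n t)) \<le> m"
  shows "smoothed_resolvent_family V J N P G g (c * T) (1 + norm Q * T) (c * m)"
proof
  have c: "0 \<le> c"
    using \<beta>m \<beta>p by (simp add: solution_bound_def)
  have "0 \<le> integral {0..T} (\<lambda>t. norm (g 0 t))"
    by (intro integral_nonneg integrable_continuous_real continuous_on_norm continuous_on_apply_bcontfun) auto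
  then have "0 \<le> m"
    using L1[of 0] by linarith
  then show "0 \<le> c * T" "0 \<le> 1 + norm Q * T" "0 \<le> c * m"
    using c T by auto
  show "norm (V B (g n)) \<le> c * m" if "B \<in> P" for B n
    using norm_V_L1[OF that, of "g n"] mult_left_mono[OF L1[of n] c] by linarith
qed (assumption | rule norm_V norm_N V_integral N_integral resolvent_identity g)+

lemma sol_map_eq:
  assumes "continuous_on {0..T} f" "B \<in> P"
  shows "sol_map D A Q T f 0 B = V B (clamped T f)"
proof -
  have "mild_solution D A Q (op_of B) f 0 t = mild_solution D A Q (op_of B) (clamped T f) 0 t"
    if "t \<in> {0..T}" for t
    unfolding mild_solution_def Let_def using that assms(1)
    by (auto intro!: integral_cong simp: clamped_apply_Icc)
  then show ?thesis
    unfolding V_eq[OF assms(2)] sol_map_def clamped_def[symmetric] by (intro clamped_cong T0)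
qed

end

theorem theorem3p7:
  fixes T \<beta>m \<beta>p :: real
    and Q :: "'a::{real_inner,banach} \<Rightarrow>\<^sub>L 'a"
    and f :: "real \<Rightarrow> 'a"
  assumes "0 < T" and "0 < \<beta>m" and "\<beta>m < \<beta>p"
    and "sobolev_W1 3 T f"
    and "f 0 = 0" and "deriv_on T f 0 = 0" and "deriv_on T (deriv_on T f) 0 = 0"
  shows "\<exists>c>0. \<forall>D A. maximal_monotone D A \<longrightarrow>
    (\<forall>B\<in>interior (param_dom \<beta>m \<beta>p). twice_frechet_differentiable (sol_map D A Q T f 0) B) \<and>
    (\<forall>B\<in>interior (param_dom \<beta>m \<beta>p). \<forall>B'\<in>interior (param_dom \<beta>m \<beta>p).
       norm (frechet2 (sol_map D A Q T f 0) B - frechet2 (sol_map D A Q T f 0) B')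
         \<le> c * norm (B - B'))"
proof -
  obtain G nu where G: "continuous_on {0..T} G" "G 0 = 0"
    and nu: "continuous_on {0..T} nu" "nu 0 = (0::real)"
    and le: "\<And>s t. 0 \<le> s \<Longrightarrow> s \<le> t \<Longrightarrow> t \<le> T \<Longrightarrow> norm (G t - G s) \<le> nu t - nu s"
    and f: "clamped T f = integral_op T (integral_op T (clamped T G))" "continuous_on {0..T} f"
    using sobolev_W1_3_representation[OF assms(1,4-7)] by blast
  obtain g :: "nat \<Rightarrow> real \<Rightarrow>\<^sub>C 'a" where g: "(\<lambda>n. integral_op T (g n)) \<longlonglongrightarrow> clamped T G"
    and L1: "\<And>n. integral {0..T} (\<lambda>t. norm (g n t)) \<le> nu T"
    using mollification[OF assms(1) G nu le] by blast
  define c where "c = solution_bound \<beta>m \<beta>p Q T"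
  define C where "C = 6 * ((1 + norm Q * T) * (c * T)) ^ 3 * (c * nu T)"
  have c: "0 \<le> c"
    using assms by (simp add: c_def solution_bound_def)
  have "0 \<le> nu T"
    using le[of 0 T] assms(1) nu norm_ge_zero[of "G T - G 0"] by linarith
  then have C: "0 \<le> C"
    using c assms(1) by (simp add: C_def)
  show ?thesis
  \<comment> \<open>\<open>C\<close> may vanish, for instance for \<open>f = 0\<close>, while the constant has to be positive.\<close>
  proof (intro exI[of _ "C + 1"] conjI allI impI ballI)
    show "0 < C + 1"
      using C by simp
    fix D :: "'a set" and A assume A: "maximal_monotone D A"
    interpret parameter_problem D A Q T \<beta>m \<beta>p
      using A assms by unfold_locales auto
    interpret smoothed_resolvent_family V J N P "clamped T G" g
        "c * T" "1 + norm Q * T" "c * nu T"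
      unfolding c_def by (rule smoothed_resolvent_family[OF g L1])
    have F: "sol_map D A Q T f 0 B = V B (J (J (clamped T G)))" if "B \<in> P" for B
      using sol_map_eq[OF f(2) that] by (simp add: f(1))
    fix B assume B: "B \<in> interior P"
    show "twice_frechet_differentiable (sol_map D A Q T f 0) B"
      by (rule twice_differentiable_Lipschitz(1)[OF F B])
    fix B' assume B': "B' \<in> interior P"
    have "norm (frechet2 (sol_map D A Q T f 0) B - frechet2 (sol_map D A Q T f 0) B') \<le> C * norm (B - B')"
      using twice_differentiable_Lipschitz(2)[OF F B B'] by (simp add: C_def)
    also have "\<dots> \<le> (C + 1) * norm (B - B')"
      by (intro mult_right_mono) auto
    finally show "norm (frechet2 (sol_map D A Q T f 0) B - frechet2 (sol_map D A Q T f 0) B')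
        \<le> (C + 1) * norm (B - B')" .
  qed
qed

end
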